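(* Let $m,c,k\in\mathbb{C}^{n\times n}$ and consider the quadratic matrix pencil $\mathcal{A}_\epsilon=\epsilon X^2m+Xc+k$ depending on a parameter $\epsilon>0$. Assume that the pencil $Xc+k$ is regular, and that its Weierstrass normal form comprises $q_0$ Jordan blocks for the eigenvalue $0$, of respective sizes $s_0^1,\dots,s_0^{q_0}$, and $q_\infty$ Jordan blocks for the eigenvalue $\infty$, of respective sizes $s_\infty^1,\dots,s_\infty^{q_\infty}$. Let $q'_0$ be the number of one-dimensional Jordan blocks for the eigenvalue $0$ of $Xc+k$, and let $\lambda_1,\dots,\lambda_r$ be the finite non-zero eigenvalues of $Xc+k$. Let $\mu_1,\dots,\mu_t$ be the finite non-zero eigenvalues of the pencil $Xm+c$ (for this list to be well defined, $\det(Xm+c)$ is assumed not to be the zero polynomial; this concerns only the assertions involving $t$ and the $\mu_i$). All eigenvalues are counted with multiplicities. Then, as $\epsilon\to0^+$, the pencil $\mathcal{A}_\epsilon$ has precisely (i) $r$ eigenvalues of order $\epsilon^0$, which converge respectively to $\lambda_i$, for $i=1,\dots,r$; (ii) $t$ eigenvalues of order $\epsilon^{-1}$, which are respectively equivalent to $\mu_i\epsilon^{-1}$, for $i=1,\dots,t$. It has at least (iii) $2q_0-q'_0$ eigenvalues identically equal to zero. Finally, for generic values of the parameters $m_{ij}$ (with $c$ and $k$ fixed), we have $t=n-q_\infty$, and the pencil $\mathcal{A}_\epsilon$ has precisely (iv) $s_\infty^i+1$ eigenvalues of order $\epsilon^{-1/(s_\infty^i+1)}$, for $i=1,\dots,q_\infty$;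 (v) $s_0^i-2$ eigenvalues of order $\epsilon^{1/(s_0^i-2)}$, for every $i$ such that $1\le i\le q_0$ and $s_0^i>2$. (In (iv) and (v), the contributions of different indices $i$ with equal block sizes add up.)
   Context: **Eigenvalues of pencils.** The (finite) eigenvalues of a matrix pencil $\mathcal{B}=\mathcal{B}_0+X\mathcal{B}_1+\cdots+X^d\mathcal{B}_d$ with $\mathcal{B}_j\in\mathbb{C}^{n\times n}$ are the roots in $\mathbb{C}$ of the polynomial $\det(\mathcal{B})\in\mathbb{C}[X]$, counted with multiplicities. The eigenvalues of $\mathcal{A}_\epsilon$ are considered for small $\epsilon>0$, as functions of $\epsilon$. "Identically equal to zero" means being the root $0$ of $\det(\mathcal{A}_\epsilon)$ for all small $\epsilon>0$. **Regularity and Weierstrass form.** The pencil $Xc+k$ is regular if $\det(Xc+k)$ is not the zero polynomial. In that case there are invertible complex matrices $P,Q$ such that $P(Xc+k)Q$ is block diagonal, with blocks of the form $XI_s+J$ where $J$ is, up to sign, a Jordan block (these correspond to the finite eigenvalues; the blocks for the eigenvalue $0$ of size $s$ are $XI_s+N_s$), and blocks $I_s+XN_s$ (the Jordan blocks of size $s$ for the eigenvalue $\infty$), where $N_s$ denotes the $s\times s$ nilpotent Jordan block. One has $r+\sum_is_0^i+\sum_is_\infty^i=n$. **Order.** An eigenvalue $\mathcal{L}_\epsilon$ is of order $\epsilon^\Lambda$ (with $\Lambda\in\mathbb{R}$) if $\mathcal{L}_\epsilon\sim\lambda\epsilon^\Lambda$ as $\epsilon\to0^+$ for some $\lambda\in\mathbb{C}\setminus\{0\}$.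 **Generic.** A property holds for generic values of the parameters $m_{ij}$ if it holds for all $m\in\mathbb{C}^{n\times n}$ outside the zero set of some nonzero polynomial in the entries $m_{ij}$. *)

theory Defs
  imports
    "Jordan_Normal_Form.Jordan_Normal_Form"
    "HOL-Library.Landau_Symbols"
    "HOL-Library.Poly_Mapping"
begin

text \<open>The pencil \<open>B\<^sub>0 + X B\<^sub>1 + \<dots> + X\<^sup>d B\<^sub>d\<close> is given by the list \<open>[B\<^sub>0, \<dots>, B\<^sub>d]\<close> of its
  coefficients (constant term first); it is a matrix with entries in \<open>\<complex>[X]\<close>.\<close>

definition matrix_pencil :: "nat \<Rightarrow> complex mat list \<Rightarrow> complex poly mat" where
  "matrix_pencil n Bs = mat n n (\<lambda>(i, j). Poly (map (\<lambda>B. B $$ (i, j)) Bs))"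

definition regular_pencil :: "complex poly mat \<Rightarrow> bool" where
  "regular_pencil A \<longleftrightarrow> det A \<noteq> 0"

definition pencil_eigenvalues :: "complex poly mat \<Rightarrow> complex multiset" where
  "pencil_eigenvalues A = proots (det A)"

definition nonzero_eigenvalues :: "complex poly mat \<Rightarrow> complex multiset" where
  "nonzero_eigenvalues A = filter_mset (\<lambda>z. z \<noteq> 0) (pencil_eigenvalues A)"

text \<open>\<open>fs\<close> lists the (size, eigenvalue) pairs of the blocks for the finite non-zero eigenvalues,
  \<open>s0\<close> the sizes of the blocks for the eigenvalue \<open>0\<close>, \<open>sinf\<close> those of the blocks for \<open>\<infinity>\<close>. A block
  for \<open>\<lambda> \<noteq> 0\<close> is \<open>X I - J\<close> with \<open>J\<close> the Jordan block of \<open>\<lambda>\<close>, so that its only root is \<open>\<lambda>\<close>. The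
  identity below forces the block sizes to add up to \<open>n\<close>.\<close>

definition weierstrass_form ::
  "nat \<Rightarrow> complex mat \<Rightarrow> complex mat \<Rightarrow> (nat \<times> complex) list \<Rightarrow> nat list \<Rightarrow> nat list \<Rightarrow> bool" where
  "weierstrass_form n c k fs s0 sinf \<longleftrightarrow>
     (\<forall>(s, a) \<in> set fs. s > 0 \<and> a \<noteq> 0) \<and> (\<forall>s \<in> set s0. s > 0) \<and> (\<forall>s \<in> set sinf. s > 0) \<and>
     (\<exists>P \<in> carrier_mat n n. \<exists>Q \<in> carrier_mat n n. invertible_mat P \<and> invertible_mat Q \<and>
        map_mat (\<lambda>a. [:a:]) P * matrix_pencil n [k, c] * map_mat (\<lambda>a. [:a:]) Q =
        diag_block_mat
          (map (\<lambda>(s, a). matrix_pencil s [- jordan_block s a, 1\<^sub>m s]) fs @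
           map (\<lambda>s. matrix_pencil s [jordan_block s 0, 1\<^sub>m s]) s0 @
           map (\<lambda>s. matrix_pencil s [1\<^sub>m s, jordan_block s 0]) sinf))"

text \<open>\<open>L 0, \<dots>, L (N - 1)\<close> are the eigenvalues of \<open>A \<epsilon>\<close>, counted with multiplicities, as continuous
  functions of small \<open>\<epsilon> > 0\<close>. Without continuity, the values of distinct branches could be
  interchanged arbitrarily from one \<open>\<epsilon>\<close> to the next, and the order of an individual branch would
  be meaningless.\<close>

definition eigenvalue_functions ::
  "(real \<Rightarrow> complex poly mat) \<Rightarrow> nat \<Rightarrow> (nat \<Rightarrow> real \<Rightarrow> complex) \<Rightarrow> bool" where
  "eigenvalue_functions A N L \<longleftrightarrow>
     (\<exists>\<epsilon>0>0. (\<forall>i<N. continuous_on {0<..<\<epsilon>0} (L i)) \<and>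
        (\<forall>\<epsilon>\<in>{0<..<\<epsilon>0}. regular_pencil (A \<epsilon>) \<and>
           pencil_eigenvalues (A \<epsilon>) = mset (map (\<lambda>i. L i \<epsilon>) [0..<N])))"

definition of_order :: "(real \<Rightarrow> complex) \<Rightarrow> real \<Rightarrow> bool" where
  "of_order f \<Lambda> \<longleftrightarrow>
     (\<exists>a. a \<noteq> 0 \<and> f \<sim>[at_right 0] (\<lambda>\<epsilon>. a * complex_of_real (\<epsilon> powr \<Lambda>)))"

text \<open>Polynomials in the indeterminates \<open>m\<^sub>i\<^sub>j\<close>: finitely supported maps from monomials (finitely
  supported exponent maps) to coefficients.\<close>

definition entry_poly_eval ::
  "(((nat \<times> nat) \<Rightarrow>\<^sub>0 nat) \<Rightarrow>\<^sub>0 complex) \<Rightarrow> complex mat \<Rightarrow> complex" where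
  "entry_poly_eval p m =
     (\<Sum>u\<in>Poly_Mapping.keys p. Poly_Mapping.lookup p u *
        (\<Prod>ij\<in>Poly_Mapping.keys u. (m $$ ij) ^ Poly_Mapping.lookup u ij))"

definition generically :: "nat \<Rightarrow> (complex mat \<Rightarrow> bool) \<Rightarrow> bool" where
  "generically n \<P> \<longleftrightarrow>
     (\<exists>p. p \<noteq> 0 \<and> (\<forall>u\<in>Poly_Mapping.keys p. Poly_Mapping.keys u \<subseteq> {..<n} \<times> {..<n}) \<and>
        (\<forall>m\<in>carrier_mat n n. entry_poly_eval p m \<noteq> 0 \<longrightarrow> \<P> m))"

end

theory Submission
  imports Defs "HOL-Analysis.Homeomorphism" "Subresultants.Subresultant_Gcd"
    "HOL-Computational_Algebra.Field_as_Ring"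
begin

text \<open>
  Let \<open>F(\<epsilon>, X) = det (\<epsilon> X\<^sup>2 m + X c + k)\<close>. After the substitution \<open>X = Y \<epsilon>\<^sup>\<Lambda>\<close> and division by a power of
  \<open>\<epsilon>\<close>, the coefficients converge to those of a polynomial \<open>g(Y)\<close>, the edge polynomial of the Newton polygon of
  \<open>F\<close> for the slope \<open>\<Lambda>\<close>. By connectedness, a continuous branch of roots tends to a root of \<open>g\<close> or to
  infinity, so comparing factorizations shows that the branches of order \<open>\<epsilon>\<^sup>\<Lambda>\<close> are counted by the non-zero
  roots of \<open>g\<close>. For \<open>\<Lambda> = 0\<close> one gets \<open>g = det (X c + k)\<close>, and for \<open>\<Lambda> = -1\<close>
  one gets \<open>g = Y\<^sup>n det (Y m + c)\<close>.

  In Weierstrass coordinates, row and column potentials (feasible dual solutions of the assignment problem)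
  bound the Newton polygon of \<open>F\<close> from below for every \<open>m\<close>; for the weight that only counts the \<open>X\<close>-degree,
  this is the divisibility of \<open>F\<close> by the power of \<open>X\<close> in (iii). The coefficient of \<open>F\<close> at a vertex of the bound is a
  polynomial in the entries of \<open>m\<close>. It is not the zero polynomial: if \<open>m\<close> consists of a single
  entry \<open>1\<close> in the lower left corner of each block for \<open>0\<close> and \<open>\<infinity>\<close>, then \<open>F\<close> is a product of factors
  \<open>X - \<lambda>\<close>, \<open>X\<^sup>s \<plusminus> \<epsilon> X\<^sup>2\<close> and \<open>1 \<plusminus> \<epsilon> X\<^bsup>s+1\<^esup>\<close>, which attains all vertices except the one
  with coefficient \<open>det m\<close>.

  Continuous branches exist because \<open>F\<close> can be factored until each factor has a non-zero resultant with
  its derivative in \<open>X\<close>. For small \<open>\<epsilon> > 0\<close> the roots of such a factor are simple, so they form a covering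
  of an interval.
\<close>

text \<open>The branches \<open>L\<close> in the conclusion are arbitrary continuous enumerations,
  so orders must be read off from limits of whatever branches are given, not from one chosen
  expansion. Two families of weights occur: \<epsilon> and X weigh s + 1 and -1 for the blocks at
  infinity, s - 2 and 1 for the blocks at 0; the exponents -1/(s+1) and 1/(s-2) are the quotients.
  Edges for neighbouring s share a vertex, so the bounds for s - 1 and s + 1 cut the edge for s at
  its ends. The number of non-zero roots of an edge polynomial depends only on the positions of its
  extreme coefficients. Hence genericity is imposed on finitely many vertex coefficients, besides
  one condition for the regularity of X m + c, and coefficients inside an edge may take any value.
  The equality t = n - q_inf is obtained by counting the eigenvalues of order 1/\<epsilon> twice: by
  the non-zero eigenvalues of X m + c, and by the edge s = 0 at infinity, whose far end is the
  vertex with coefficient det m. This uses the existence of branches.\<close>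

hide_const (open) Finite_Cartesian_Product.mat

section \<open>Limits of root branches\<close>

text \<open>The modulus of a product of linear factors is a product of distances. Used in both
  directions: a limit polynomial is bounded below far from its roots, and contrapositively a small
  value forces a root nearby.\<close>

lemma norm_poly_ge_dist_roots:
  fixes g :: "complex poly"
  assumes "\<delta> > 0" and dist: "\<And>z. poly g z = 0 \<Longrightarrow> \<delta> \<le> dist y z"
  shows "norm (lead_coeff g) * \<delta> ^ size (proots g) \<le> norm (poly g y)"
proof (cases "g = 0")
  case False
  have *: "\<delta> ^ size M \<le> norm (poly (\<Prod>x\<in>#M. [:-x, 1:]) y)" if "\<forall>x\<in>#M. \<delta> \<le> dist y x" for M
    using that
  proof (induction M)
    case (add x M)
    then have "\<delta> * \<delta> ^ size M \<le> dist y x * norm (poly (\<Prod>x\<in>#M. [:-x, 1:]) y)"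
      using \<open>\<delta> > 0\<close> by (intro mult_mono) auto
    then show ?case
      by (simp add: dist_norm norm_mult flip: left_diff_distrib)
  qed auto
  have "\<forall>x\<in>#proots g. \<delta> \<le> dist y x"
    using dist False by auto
  from *[OF this] have "norm (lead_coeff g) * \<delta> ^ size (proots g)
      \<le> norm (lead_coeff g) * norm (poly (\<Prod>x\<in>#proots g. [:-x, 1:]) y)"
    by (intro mult_left_mono) auto
  also have "\<dots> = norm (poly (Polynomial.smult (lead_coeff g) (\<Prod>x\<in>#proots g. [:-x, 1:])) y)"
    by (simp add: norm_mult)
  also have "Polynomial.smult (lead_coeff g) (\<Prod>x\<in>#proots g. [:-x, 1:]) = g"
    by (rule complex_poly_decompose_multiset)
  finally show ?thesis .
qed auto

lemma poly_as_sum_atMost: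
  fixes p :: "'a::comm_semiring_1 poly"
  assumes "degree p \<le> D"
  shows "poly p y = (\<Sum>j\<le>D. coeff p j * y ^ j)"
  unfolding poly_altdef using assms
  by (intro sum.mono_neutral_left) (auto simp: coeff_eq_0)

lemma tendsto_poly_coeffs:
  fixes q :: "'b \<Rightarrow> complex poly"
  assumes coeffs: "\<And>j. ((\<lambda>e. coeff (q e) j) \<longlongrightarrow> coeff g j) F"
    and deg: "\<forall>\<^sub>F e in F. degree (q e) \<le> D"
  shows "((\<lambda>e. poly (q e) y) \<longlongrightarrow> poly g y) F"
proof -
  define D' where "D' = max D (degree g)"
  have "((\<lambda>e. \<Sum>j\<le>D'. coeff (q e) j * y ^ j) \<longlongrightarrow> (\<Sum>j\<le>D'. coeff g j * y ^ j)) F"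
    by (intro tendsto_intros coeffs)
  also have "(\<Sum>j\<le>D'. coeff g j * y ^ j) = poly g y"
    by (rule poly_as_sum_atMost [symmetric]) (simp add: D'_def)
  finally show ?thesis
    by (rule Lim_transform_eventually)
      (use deg in \<open>auto elim!: eventually_mono intro!: poly_as_sum_atMost[symmetric] simp: D'_def\<close>)
qed

text \<open>On the disc of radius \<open>R\<close> the difference of \<open>q e\<close> and
  \<open>g\<close> tends to 0 uniformly, whereas \<open>g\<close> is at least \<open>\<eta>\<close>
  in modulus off the \<delta>-balls around its roots. A disc is used because the degree of
  \<open>q e\<close> may exceed that of \<open>g\<close>, in which case roots escape to
  infinity.\<close>

lemma eventually_no_root_off_limit_roots:
  fixes q :: "'b \<Rightarrow> complex poly"
  assumes coeffs: "\<And>j. ((\<lambda>e. coeff (q e) j) \<longlongrightarrow> coeff g j) F"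
    and deg: "\<forall>\<^sub>F e in F. degree (q e) \<le> D"
    and "g \<noteq> 0" "\<delta> > 0"
  shows "\<forall>\<^sub>F e in F. \<forall>y. poly (q e) y = 0 \<longrightarrow> norm y \<le> R \<longrightarrow> (\<exists>z. poly g z = 0 \<and> dist y z < \<delta>)"
proof -
  define D' where "D' = max D (degree g)"
  define \<eta> where "\<eta> = norm (lead_coeff g) * \<delta> ^ size (proots g)"
  have "\<eta> > 0"
    using assms by (simp add: \<eta>_def)
  have "((\<lambda>e. \<Sum>j\<le>D'. norm (coeff (q e) j - coeff g j) * R ^ j) \<longlongrightarrow>
         (\<Sum>j\<le>D'. norm (coeff g j - coeff g j) * R ^ j)) F"
    by (intro tendsto_intros coeffs)
  then have "\<forall>\<^sub>F e in F. (\<Sum>j\<le>D'. norm (coeff (q e) j - coeff g j) * R ^ j) < \<eta>"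
    using \<open>\<eta> > 0\<close> by (intro order_tendstoD(2)[where a = \<eta>]) auto
  with deg show ?thesis
  proof eventually_elim
    case (elim e)
    show ?case
    proof (intro allI impI, rule ccontr)
      fix y assume y: "poly (q e) y = 0" "norm y \<le> R" and "\<nexists>z. poly g z = 0 \<and> dist y z < \<delta>"
      then have "\<eta> \<le> norm (poly g y)"
        unfolding \<eta>_def using \<open>\<delta> > 0\<close> by (intro norm_poly_ge_dist_roots) force+
      also have "poly g y = poly g y - poly (q e) y"
        using y by simp
      also have "\<dots> = (\<Sum>j\<le>D'. coeff g j * y ^ j) - (\<Sum>j\<le>D'. coeff (q e) j * y ^ j)"
        using elim by (intro arg_cong2[where f = minus] poly_as_sum_atMost) (auto simp: D'_def)
      also have "\<dots> = (\<Sum>j\<le>D'. (coeff g j - coeff (q e) j) * y ^ j)"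
        by (simp add: sum_subtractf algebra_simps)
      also have "norm \<dots> \<le> (\<Sum>j\<le>D'. norm (coeff (q e) j - coeff g j) * R ^ j)"
        using y(2) by (intro sum_norm_le)
          (auto simp: norm_mult norm_power norm_minus_commute intro!: mult_left_mono power_mono)
      finally show False
        using elim by simp
    qed
  qed
qed

lemma finite_separated:
  fixes Z :: "'a::metric_space set"
  assumes "finite Z"
  shows "\<exists>d>0. \<forall>z\<in>Z. \<forall>z'\<in>Z. z \<noteq> z' \<longrightarrow> 2 * d \<le> dist z z'"
proof -
  \<comment> \<open>The extra element 1 keeps the set non-empty when \<open>Z\<close> has at most
    one point.\<close>
  define S where "S = insert 1 ((\<lambda>(z, z'). dist z z') ` {(z, z'). z \<in> Z \<and> z' \<in> Z \<and> z \<noteq> z'})"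
  have "finite S"
    unfolding S_def using assms
    by (intro finite.insertI finite_imageI finite_subset[OF _ finite_cartesian_product[of Z Z]]) auto
  moreover have "\<forall>s\<in>S. s > 0" "S \<noteq> {}"
    by (auto simp: S_def)
  ultimately have "Min S > 0" and le: "\<And>s. s \<in> S \<Longrightarrow> Min S \<le> s"
    by auto
  moreover have "Min S \<le> dist z z'" if "z \<in> Z" "z' \<in> Z" "z \<noteq> z'" for z z'
    using that by (intro le) (auto simp: S_def)
  ultimately show ?thesis
    by (intro exI[of _ "Min S / 2"]) auto
qed

text \<open>A branch that does not tend to infinity returns to a bounded region for arbitrarily
  small parameters, where it is close to some root of \<open>g\<close>. Its image over a small
  interval is connected, so it cannot leave the ball around that root for another ball or for the
  region near infinity.\<close>

lemma root_branch_tendsto: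
  fixes q :: "real \<Rightarrow> complex poly"
  assumes coeffs: "\<And>j. ((\<lambda>e. coeff (q e) j) \<longlongrightarrow> coeff g j) (at_right 0)"
    and deg: "\<forall>\<^sub>F e in at_right 0. degree (q e) \<le> D"
    and "g \<noteq> 0" "e0 > 0" and cont: "continuous_on {0<..<e0} K"
    and root: "\<And>e. e \<in> {0<..<e0} \<Longrightarrow> poly (q e) (K e) = 0"
  shows "(\<exists>z. (K \<longlongrightarrow> z) (at_right 0)) \<or> filterlim K at_infinity (at_right 0)"
proof (rule disjCI)
  assume "\<not> filterlim K at_infinity (at_right 0)"
  then obtain R0 where R0: "\<exists>\<^sub>F e in at_right 0. norm (K e) < R0"
    by (auto simp: filterlim_at_infinity[OF order_refl] frequently_def not_less)
  define Z where "Z = {z. poly g z = 0}"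
  have fin: "finite Z"
    unfolding Z_def using \<open>g \<noteq> 0\<close> by (rule poly_roots_finite)
  obtain d where d: "d > 0" "\<And>z z'. z \<in> Z \<Longrightarrow> z' \<in> Z \<Longrightarrow> z \<noteq> z' \<Longrightarrow> 2 * d \<le> dist z z'"
    using finite_separated[OF fin] by blast
  obtain B where B: "\<And>z. z \<in> Z \<Longrightarrow> norm z \<le> B"
    using finite_imp_bounded[OF fin] by (auto simp: bounded_iff)
  \<comment> \<open>\<open>R0\<close> covers the parameters at which the branch is known to be
    bounded; \<open>B + d\<close> makes the disc contain the \<open>d\<close>-balls around all
    roots, so these do not meet the outside of the disc.\<close>
  define R where "R = max R0 (B + d)"
  have near: "\<forall>\<^sub>F e in at_right 0. norm (K e) \<le> R \<longrightarrow> (\<exists>z\<in>Z. dist (K e) z < \<delta>)" if "\<delta> > 0" for \<delta>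
  proof -
    have "\<forall>\<^sub>F e in at_right 0. e \<in> {0<..<e0}"
      using \<open>e0 > 0\<close> by (intro eventually_at_right_real)
    with eventually_no_root_off_limit_roots[OF coeffs deg \<open>g \<noteq> 0\<close> that, of R] show ?thesis
      by eventually_elim (use root in \<open>auto simp: Z_def\<close>)
  qed
  obtain e1 where e1: "e1 > 0" "\<And>e. 0 < e \<Longrightarrow> e < e1 \<Longrightarrow> norm (K e) \<le> R \<longrightarrow> (\<exists>z\<in>Z. dist (K e) z < d)"
    using near[OF \<open>d > 0\<close>] by (auto simp: eventually_at_right_field)
  define e2 where "e2 = min e0 e1"
  have "\<forall>\<^sub>F e in at_right 0. e \<in> {0<..<e2}"
    using \<open>e0 > 0\<close> \<open>e1 > 0\<close> by (intro eventually_at_right_real) (auto simp: e2_def)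
  with R0 have "\<exists>\<^sub>F e in at_right 0. norm (K e) < R0 \<and> e \<in> {0<..<e2}"
    by (rule frequently_eventually_frequently)
  then obtain e where e: "e \<in> {0<..<e2}" "norm (K e) < R0"
    using frequently_ex by blast
  with e1(2)[of e] obtain z where z: "z \<in> Z" "dist (K e) z < d"
    by (auto simp: e2_def R_def)
  define V where "V = (\<Union>z'\<in>Z - {z}. ball z' d) \<union> {y. norm y > R}"
  have "ball z d \<inter> V = {}"
  proof -
    have False if "y \<in> ball z d" "y \<in> V" for y
    proof -
      consider z' where "z' \<in> Z" "z' \<noteq> z" "dist z' y < d" | "norm y > R"
        using \<open>y \<in> V\<close> by (auto simp: V_def)
      then show False
      proof cases
        case 1
        then show False
          using d(2)[of z z'] z that dist_triangle2[of z z' y] by (auto simp: dist_commute)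
      next
        case 2
        have "norm y \<le> norm z + dist z y"
          by (metis add.commute dist_norm norm_minus_commute norm_triangle_sub)
        then show False
          using 2 B[OF z(1)] that by (auto simp: R_def)
      qed
    qed
    then show ?thesis by blast
  qed
  moreover have "connected (K ` {0<..<e2})"
    by (intro connected_continuous_image continuous_on_subset[OF cont]) (auto simp: e2_def)
  moreover have "K ` {0<..<e2} \<subseteq> ball z d \<union> V"
    using e1(2) by (force simp: e2_def V_def dist_commute)
  moreover have "open (ball z d)" "open V"
    by (auto simp: V_def intro!: open_Un open_Collect_less continuous_intros)
  moreover have "ball z d \<inter> K ` {0<..<e2} \<noteq> {}"
    using z e by (auto simp: dist_commute)
  ultimately have "V \<inter> K ` {0<..<e2} = {}"
    using connectedD[of "K ` {0<..<e2}" "ball z d" V] by auto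
  then have inball: "K e \<in> ball z d" if "e \<in> {0<..<e2}" for e
    using \<open>K ` {0<..<e2} \<subseteq> ball z d \<union> V\<close> that by blast
  have "(K \<longlongrightarrow> z) (at_right 0)"
  proof (rule tendstoI)
    fix \<delta> :: real assume "\<delta> > 0"
    then have "min \<delta> d > 0"
      using d by simp
    from near[OF this] \<open>\<forall>\<^sub>F e in at_right 0. e \<in> {0<..<e2}\<close>
    show "\<forall>\<^sub>F e in at_right 0. dist (K e) z < \<delta>"
    proof eventually_elim
      case (elim e)
      have "norm (K e) \<le> norm z + dist z (K e)"
        by (metis add.commute dist_norm norm_minus_commute norm_triangle_sub)
      then have "norm (K e) \<le> R"
        using inball[OF elim(2)] B[OF z(1)] by (auto simp: R_def)
      then obtain z' where "z' \<in> Z" "dist (K e) z' < min \<delta> d"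
        using elim by auto
      \<comment> \<open>The branch is within \<open>d\<close> of both roots, and distinct roots are
        at least \<open>2 * d\<close> apart.\<close>
      moreover from this have "z' = z"
        using d(2)[of z z'] z inball[OF elim(2)] dist_triangle2[of z z' "K e"] by (auto simp: dist_commute)
      ultimately show ?case by simp
    qed
  qed
  then show "\<exists>z. (K \<longlongrightarrow> z) (at_right 0)" ..
qed

text \<open>Roots that escape to infinity are split off as factors
  \<open>1 - y * inverse (K i e)\<close>, which tend to 1. The rest of \<open>q e\<close> tends to a
  multiple of the product of the \<open>y - l i\<close> over the convergent branches, and uniqueness
  of limits identifies it with \<open>g\<close>.\<close>

lemma card_branches_tendsto:
  fixes q :: "real \<Rightarrow> complex poly"
  assumes coeffs: "\<And>j. ((\<lambda>e. coeff (q e) j) \<longlongrightarrow> coeff g j) (at_right 0)"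
    and "g \<noteq> 0" "e0 > 0" and cont: "\<And>i. i < N \<Longrightarrow> continuous_on {0<..<e0} (K i)"
    and q0: "\<And>e. e \<in> {0<..<e0} \<Longrightarrow> q e \<noteq> 0"
    and roots: "\<And>e. e \<in> {0<..<e0} \<Longrightarrow> proots (q e) = mset (map (\<lambda>i. K i e) [0..<N])"
  shows "card {i. i < N \<and> (K i \<longlongrightarrow> z) (at_right 0)} = Polynomial.order z g"
proof -
  let ?F = "at_right (0::real)"
  have ev: "\<forall>\<^sub>F e in ?F. e \<in> {0<..<e0}"
    using \<open>e0 > 0\<close> by (intro eventually_at_right_real)
  have "degree (q e) = N" if "e \<in> {0<..<e0}" for e
    using size_proots_complex[of "q e"] roots[OF that] by simp
  with ev have deg: "\<forall>\<^sub>F e in ?F. degree (q e) \<le> N"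
    by (auto elim!: eventually_mono)
  have "\<exists>z. (K i \<longlongrightarrow> z) ?F" if "\<not> filterlim (K i) at_infinity ?F" "i < N" for i
  proof -
    have "poly (q e) (K i e) = 0" if "e \<in> {0<..<e0}" for e
    proof -
      have "K i e \<in># proots (q e)"
        using roots[OF that] \<open>i < N\<close> by auto
      then show ?thesis
        using q0[OF that] by simp
    qed
    then show ?thesis
      using root_branch_tendsto[OF coeffs deg \<open>g \<noteq> 0\<close> \<open>e0 > 0\<close> cont[OF \<open>i < N\<close>]] that by blast
  qed
  then obtain l where l: "\<And>i. i < N \<Longrightarrow> \<not> filterlim (K i) at_infinity ?F \<Longrightarrow> (K i \<longlongrightarrow> l i) ?F"
    by metis
  define I J where "I = {i. i < N \<and> \<not> filterlim (K i) at_infinity ?F}"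
    and "J = {i. i < N \<and> filterlim (K i) at_infinity ?F}"
  have IJ: "{..<N} = I \<union> J" "I \<inter> J = {}" "finite I" "finite J"
    by (auto simp: I_def J_def)
  \<comment> \<open>The leading coefficient may tend to 0 while the escaping roots tend to infinity;
    only this combination has a limit.\<close>
  define \<kappa> where "\<kappa> e = lead_coeff (q e) * (\<Prod>i\<in>J. - K i e)" for e
  have J_nz: "\<forall>\<^sub>F e in ?F. \<forall>i\<in>J. K i e \<noteq> 0"
    using IJ by (intro eventually_ball_finite ballI)
      (auto simp: J_def dest: filterlim_at_infinity_imp_eventually_ne)
  have inv: "((\<lambda>e. inverse (K i e)) \<longlongrightarrow> 0) ?F" if "i \<in> J" for i
    using that by (intro filterlim_compose[OF tendsto_inverse_0]) (auto simp: J_def)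
  define f where "f y e = (\<Prod>i\<in>I. y - K i e) * (\<Prod>i\<in>J. 1 - y * inverse (K i e))" for y e
  have f_lim: "(f y \<longlongrightarrow> (\<Prod>i\<in>I. y - l i)) ?F" for y
  proof -
    have "(f y \<longlongrightarrow> (\<Prod>i\<in>I. y - l i) * (\<Prod>i\<in>J. 1 - y * 0)) ?F"
      unfolding f_def by (intro tendsto_intros inv l) (auto simp: I_def)
    then show ?thesis by simp
  qed
  have q_eq: "\<forall>\<^sub>F e in ?F. poly (q e) y = \<kappa> e * f y e" for y
    using ev J_nz
  proof eventually_elim
    case (elim e)
    have "poly (q e) y = poly (Polynomial.smult (lead_coeff (q e)) (\<Prod>x\<in>#proots (q e). [:-x, 1:])) y"
      by (simp only: complex_poly_decompose_multiset)
    also have "\<dots> = lead_coeff (q e) * poly (\<Prod>i\<in>{..<N}. [:- K i e, 1:]) y"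
      using roots[OF elim(1)]
      by (simp add: image_mset.compositionality o_def prod_mset_prod_list flip: mset_map map_map)
        (simp add: prod.list_conv_set_nth atLeast0LessThan)
    also have "poly (\<Prod>i\<in>{..<N}. [:- K i e, 1:]) y = (\<Prod>i\<in>{..<N}. y - K i e)"
      by (simp add: poly_prod)
    also have "\<dots> = (\<Prod>i\<in>I. y - K i e) * (\<Prod>i\<in>J. y - K i e)"
      using IJ by (simp add: prod.union_disjoint)
    also have "(\<Prod>i\<in>J. y - K i e) = (\<Prod>i\<in>J. - K i e * (1 - y * inverse (K i e)))"
      using elim by (intro prod.cong) (auto simp: field_simps)
    also have "\<dots> = (\<Prod>i\<in>J. - K i e) * (\<Prod>i\<in>J. 1 - y * inverse (K i e))"
      by (rule prod.distrib)
    finally show ?case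
      by (simp only: \<kappa>_def f_def mult_ac)
  qed
  have "finite ({y. poly g y = 0} \<union> l ` I)"
    using IJ poly_roots_finite[OF \<open>g \<noteq> 0\<close>] by auto
  \<comment> \<open>Evaluation at one point that is neither a root of \<open>g\<close> nor the limit
    of a branch yields the limit of \<open>\<kappa>\<close> and shows that it is not 0.\<close>
  then obtain y0 where y0: "poly g y0 \<noteq> 0" "y0 \<notin> l ` I"
    using ex_new_if_finite[OF infinite_UNIV_char_0] by blast
  then have nz: "(\<Prod>i\<in>I. y0 - l i) \<noteq> 0"
    using IJ by auto
  define \<kappa>0 where "\<kappa>0 = poly g y0 / (\<Prod>i\<in>I. y0 - l i)"
  have "\<kappa>0 \<noteq> 0"
    using y0 nz by (simp add: \<kappa>0_def)
  have "((\<lambda>e. poly (q e) y0 / f y0 e) \<longlongrightarrow> \<kappa>0) ?F"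
    unfolding \<kappa>0_def by (intro tendsto_divide tendsto_poly_coeffs[OF coeffs deg] f_lim nz)
  moreover have "\<forall>\<^sub>F e in ?F. poly (q e) y0 / f y0 e = \<kappa> e"
    using q_eq[of y0] tendsto_imp_eventually_ne[OF f_lim nz] by eventually_elim auto
  ultimately have \<kappa>_lim: "(\<kappa> \<longlongrightarrow> \<kappa>0) ?F"
    by (rule Lim_transform_eventually)
  have "poly g y = \<kappa>0 * (\<Prod>i\<in>I. y - l i)" for y
  proof (rule tendsto_unique[of ?F])
    show "((\<lambda>e. poly (q e) y) \<longlongrightarrow> poly g y) ?F"
      by (rule tendsto_poly_coeffs[OF coeffs deg])
    have "((\<lambda>e. \<kappa> e * f y e) \<longlongrightarrow> \<kappa>0 * (\<Prod>i\<in>I. y - l i)) ?F"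
      by (intro tendsto_intros \<kappa>_lim f_lim)
    then show "((\<lambda>e. poly (q e) y) \<longlongrightarrow> \<kappa>0 * (\<Prod>i\<in>I. y - l i)) ?F"
      by (rule Lim_transform_eventually) (use q_eq[of y] in \<open>auto elim: eventually_mono\<close>)
  qed auto
  then have "poly g = poly (Polynomial.smult \<kappa>0 (\<Prod>i\<in>I. [:- l i, 1:]))"
    by (auto simp: poly_prod)
  then have g: "g = Polynomial.smult \<kappa>0 (\<Prod>i\<in>I. [:- l i, 1:])"
    by (simp only: poly_eq_poly_eq_iff)
  have linear: "proots [:- l i, 1:] = {#l i#}" for i
    by (simp only: proots_linear_factor minus_minus)
  have prod_roots: "proots (\<Prod>i\<in>I. [:- l i, 1:]) = (\<Sum>i\<in>I. {#l i#})"
    by (subst proots_prod) (simp_all only: linear pCons_eq_0_iff one_neq_zero simp_thms)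
  have "Polynomial.order z g = count (proots g) z"
    using \<open>g \<noteq> 0\<close> by simp
  also have "\<dots> = (\<Sum>i\<in>I. count {#l i#} z)"
    unfolding g using \<open>\<kappa>0 \<noteq> 0\<close> by (simp only: proots_smult prod_roots count_sum not_False_eq_True)
  also have "\<dots> = card {i\<in>I. l i = z}"
    using IJ by (simp add: sum.If_cases Int_def)
  also have "{i\<in>I. l i = z} = {i. i < N \<and> (K i \<longlongrightarrow> z) ?F}"
  proof -
    have "i \<in> I \<and> l i = z" if "i < N" "(K i \<longlongrightarrow> z) ?F" for i
    proof -
      have "\<not> filterlim (K i) at_infinity ?F"
        using that(2) not_tendsto_and_filterlim_at_infinity[of ?F "K i" z] by auto
      then show ?thesis
        using l[OF that(1)] that tendsto_unique[of ?F "K i" "l i" z] by (auto simp: I_def)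
    qed
    then show ?thesis
      using l by (auto simp: I_def)
  qed
  finally show ?thesis ..
qed

section \<open>From limits of rescaled branches to asymptotic orders\<close>

lemma proots_pcompose_scale:
  fixes p :: "complex poly"
  assumes "c \<noteq> 0"
  shows "proots (pcompose p [:0, c:]) = image_mset (\<lambda>x. x / c) (proots p)"
proof (cases "p = 0")
  case False
  have lin: "pcompose [:-x, 1:] [:0, c:] = Polynomial.smult c [:- (x / c), 1:]" for x
    using assms by (simp add: pcompose_pCons)
  have lin_roots: "proots [:-x, c:] = {#x / c#}" for x
  proof -
    have "[:-x, c:] = Polynomial.smult c [:- (x / c), 1:]"
      using assms by simp
    then show ?thesis
      using assms by (simp only: proots_smult proots_linear_factor minus_minus not_False_eq_True)
  qed
  have "proots (pcompose (\<Prod>x\<in>#M. [:-x, 1:]) [:0, c:]) = image_mset (\<lambda>x. x / c) M \<and>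
        pcompose (\<Prod>x\<in>#M. [:-x, 1:]) [:0, c:] \<noteq> 0" for M
  proof (induction M)
    case (add x M)
    then show ?case
      using assms by (simp add: pcompose_mult lin lin_roots proots_mult del: mult_pCons_left)
  qed (auto simp: pcompose_1)
  then have "proots (pcompose (\<Prod>x\<in>#proots p. [:-x, 1:]) [:0, c:]) = image_mset (\<lambda>x. x / c) (proots p)"
    by blast
  then have "proots (pcompose (Polynomial.smult (lead_coeff p) (\<Prod>x\<in>#proots p. [:-x, 1:])) [:0, c:])
      = image_mset (\<lambda>x. x / c) (proots p)"
    using False by (simp add: pcompose_smult)
  then show ?thesis
    by (simp only: complex_poly_decompose_multiset)
qed auto

lemma count_mset_map_filter: "count (mset (map f xs)) z = length (filter (\<lambda>x. f x = z) xs)"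
  by (induction xs) auto

text \<open>Equal fibre cardinalities say that the values of \<open>l\<close> on \<open>I\<close>
  and the entries of \<open>xs\<close> form the same multiset. Lists with the same multiset differ
  by a permutation of positions, which is composed with an enumeration of \<open>I\<close>.\<close>

lemma bij_betw_of_fibre_cards:
  assumes "finite I" and fibres: "\<And>z. card {i\<in>I. l i = z} = count (mset xs) z"
  shows "\<exists>\<sigma>. bij_betw \<sigma> {..<length xs} I \<and> (\<forall>j<length xs. l (\<sigma> j) = xs ! j)"
proof -
  obtain ks where ks: "set ks = I" "distinct ks"
    using finite_distinct_list[OF \<open>finite I\<close>] by blast
  have "mset (map l ks) = mset xs"
  proof (rule multiset_eqI)
    fix z
    have "count (mset (map l ks)) z = length (filter (\<lambda>i. l i = z) ks)"
      by (rule count_mset_map_filter)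
    also have "\<dots> = card {i\<in>I. l i = z}"
      using ks distinct_card[of "filter (\<lambda>i. l i = z) ks"] by auto
    finally show "count (mset (map l ks)) z = count (mset xs) z"
      using fibres by simp
  qed
  then obtain p where p: "p permutes {..<length xs}" "permute_list p (map l ks) = xs"
    by (metis mset_eq_permutation mset_eq_length)
  have len: "length ks = length xs"
    using arg_cong[OF p(2), of length] by simp
  have "bij_betw (\<lambda>j. ks ! j) {..<length xs} I"
    using bij_betw_nth[of ks "{..<length xs}" I] ks len by auto
  then have "bij_betw ((\<lambda>j. ks ! j) \<circ> p) {..<length xs} I"
    using permutes_imp_bij[OF p(1)] bij_betw_trans by blast
  moreover have "l (ks ! p j) = xs ! j" if "j < length xs" for j
  proof -
    have "p j < length ks"
      using permutes_in_image[OF p(1), of j] that len by auto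
    then show ?thesis
      using that p len by (metis length_map nth_map permute_list_nth)
  qed
  ultimately show ?thesis
    by (intro exI[of _ "(\<lambda>j. ks ! j) \<circ> p"]) auto
qed

lemma asymp_equiv_powr_iff:
  assumes "a \<noteq> 0"
  shows "f \<sim>[at_right 0] (\<lambda>\<epsilon>. a * complex_of_real (\<epsilon> powr \<Lambda>)) \<longleftrightarrow>
    ((\<lambda>\<epsilon>. f \<epsilon> / complex_of_real (\<epsilon> powr \<Lambda>)) \<longlongrightarrow> a) (at_right 0)"
proof -
  \<comment> \<open>The convention for 0 / 0 in \<open>asymp_equiv_def\<close> has no effect,
    because the comparison function has no zero for \<epsilon> > 0.\<close>
  have nz: "\<forall>\<^sub>F \<epsilon> in at_right (0::real). a * complex_of_real (\<epsilon> powr \<Lambda>) \<noteq> 0"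
    using assms by (auto simp: eventually_at_right_field intro!: exI[of _ 1])
  have "f \<sim>[at_right 0] (\<lambda>\<epsilon>. a * complex_of_real (\<epsilon> powr \<Lambda>)) \<longleftrightarrow>
     ((\<lambda>\<epsilon>. f \<epsilon> / (a * complex_of_real (\<epsilon> powr \<Lambda>))) \<longlongrightarrow> 1) (at_right 0)"
    unfolding asymp_equiv_def
    by (rule filterlim_cong) (use nz in \<open>auto elim!: eventually_mono\<close>)
  also have "(\<lambda>\<epsilon>. f \<epsilon> / (a * complex_of_real (\<epsilon> powr \<Lambda>))) = (\<lambda>\<epsilon>. (f \<epsilon> / complex_of_real (\<epsilon> powr \<Lambda>)) / a)"
    by (simp add: field_simps)
  also have "(\<dots> \<longlongrightarrow> 1) (at_right 0) \<longleftrightarrow> ((\<lambda>\<epsilon>. f \<epsilon> / complex_of_real (\<epsilon> powr \<Lambda>)) \<longlongrightarrow> a) (at_right 0)"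
    using tendsto_mult_right_iff[of "inverse a" _ a "at_right 0"] assms
    by (simp add: divide_inverse)
  finally show ?thesis .
qed

text \<open>The rescaling \<open>X = Y \<epsilon>\<^sup>\<Lambda>\<close> turns eigenvalues of order \<open>\<epsilon>\<^sup>\<Lambda>\<close> into roots that have a non-zero
  limit.\<close>

lemma eigenvalues_of_order:
  assumes L: "eigenvalue_functions A N L"
    and C: "\<And>\<epsilon>. \<epsilon> > 0 \<Longrightarrow> C \<epsilon> \<noteq> 0"
    and coeffs: "\<And>j. ((\<lambda>\<epsilon>. C \<epsilon> * coeff (det (A \<epsilon>)) j * complex_of_real (\<epsilon> powr \<Lambda>) ^ j)
                       \<longlongrightarrow> coeff g j) (at_right 0)"
    and "g \<noteq> 0" and xs: "mset xs = filter_mset (\<lambda>z. z \<noteq> 0) (proots g)"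
  shows "\<exists>\<sigma>. bij_betw \<sigma> {..<length xs} {i. i < N \<and> of_order (L i) \<Lambda>} \<and>
    (\<forall>j<length xs. L (\<sigma> j) \<sim>[at_right 0] (\<lambda>\<epsilon>. xs ! j * complex_of_real (\<epsilon> powr \<Lambda>)))"
proof -
  obtain e0 where e0: "e0 > 0" and cont: "\<And>i. i < N \<Longrightarrow> continuous_on {0<..<e0} (L i)"
    and reg: "\<And>\<epsilon>. \<epsilon> \<in> {0<..<e0} \<Longrightarrow> det (A \<epsilon>) \<noteq> 0"
    and roots: "\<And>\<epsilon>. \<epsilon> \<in> {0<..<e0} \<Longrightarrow> proots (det (A \<epsilon>)) = mset (map (\<lambda>i. L i \<epsilon>) [0..<N])"
    using L by (auto simp: eigenvalue_functions_def regular_pencil_def pencil_eigenvalues_def)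
  define K where "K i \<epsilon> = L i \<epsilon> / complex_of_real (\<epsilon> powr \<Lambda>)" for i \<epsilon>
  \<comment> \<open>The roots of \<open>q \<epsilon>\<close> are the rescaled branches
    \<open>K i \<epsilon>\<close>; the factor \<open>C \<epsilon>\<close> normalizes the
    coefficients without moving roots.\<close>
  define q where "q \<epsilon> = Polynomial.smult (C \<epsilon>) (pcompose (det (A \<epsilon>)) [:0, complex_of_real (\<epsilon> powr \<Lambda>):])" for \<epsilon>
  have coeff_q: "coeff (q \<epsilon>) j = C \<epsilon> * coeff (det (A \<epsilon>)) j * complex_of_real (\<epsilon> powr \<Lambda>) ^ j" for \<epsilon> j
    by (simp add: q_def coeff_pcompose_linear)
  have card_K: "card {i. i < N \<and> (K i \<longlongrightarrow> z) (at_right 0)} = Polynomial.order z g" for z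
  proof (rule card_branches_tendsto[where q = q and ?e0.0 = e0])
    fix \<epsilon> assume \<epsilon>: "\<epsilon> \<in> {0<..<e0}"
    then have nz: "complex_of_real (\<epsilon> powr \<Lambda>) \<noteq> 0" "C \<epsilon> \<noteq> 0"
      using C by auto
    show "proots (q \<epsilon>) = mset (map (\<lambda>i. K i \<epsilon>) [0..<N])"
      using nz roots[OF \<epsilon>]
      by (simp add: q_def proots_pcompose_scale image_mset.compositionality o_def K_def)
    show "q \<epsilon> \<noteq> 0"
      using nz reg[OF \<epsilon>] by (simp add: q_def pcompose_eq_0_iff)
  next
    fix i assume "i < N"
    then show "continuous_on {0<..<e0} (K i)"
      unfolding K_def by (intro continuous_intros cont) auto
  qed (use coeffs e0 \<open>g \<noteq> 0\<close> in \<open>auto simp: coeff_q\<close>)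
  define I where "I = {i. i < N \<and> of_order (L i) \<Lambda>}"
  have "\<exists>z. z \<noteq> 0 \<and> (K i \<longlongrightarrow> z) (at_right 0)" if "i \<in> I" for i
    using that by (auto simp: I_def of_order_def asymp_equiv_powr_iff K_def[abs_def])
  then obtain l where l: "\<And>i. i \<in> I \<Longrightarrow> l i \<noteq> 0" "\<And>i. i \<in> I \<Longrightarrow> (K i \<longlongrightarrow> l i) (at_right 0)"
    by metis
  have "\<exists>\<sigma>. bij_betw \<sigma> {..<length xs} I \<and> (\<forall>j<length xs. l (\<sigma> j) = xs ! j)"
  proof (rule bij_betw_of_fibre_cards)
    fix z
    show "card {i\<in>I. l i = z} = count (mset xs) z"
    \<comment> \<open>\<open>of_order\<close> demands a non-zero factor, so branches that tend to 0
      after rescaling are left out on one side, and the root 0 of \<open>g\<close> on the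
      other.\<close>
    proof (cases "z = 0")
      case True
      then have "{i\<in>I. l i = z} = {}"
        using l by auto
      then show ?thesis
        unfolding xs using True by (simp only: card.empty) simp
    next
      case False
      have "{i\<in>I. l i = z} = {i. i < N \<and> (K i \<longlongrightarrow> z) (at_right 0)}"
      proof (intro equalityI subsetI)
        fix i assume "i \<in> {i. i < N \<and> (K i \<longlongrightarrow> z) (at_right 0)}"
        then have i: "i < N" "(K i \<longlongrightarrow> z) (at_right 0)"
          by auto
        have "L i \<sim>[at_right 0] (\<lambda>\<epsilon>. z * complex_of_real (\<epsilon> powr \<Lambda>))"
          unfolding asymp_equiv_powr_iff[OF False] using i(2) by (simp only: K_def[abs_def])
        then have "i \<in> I"
          using False i(1) by (auto simp: I_def of_order_def)
        then show "i \<in> {i\<in>I. l i = z}"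
          using i l tendsto_unique[of "at_right 0" "K i" "l i" z] by auto
      qed (use l in \<open>auto simp: I_def\<close>)
      then show ?thesis
        unfolding xs using card_K[of z] False \<open>g \<noteq> 0\<close> by simp
    qed
  qed (auto simp: I_def)
  then obtain \<sigma> where \<sigma>: "bij_betw \<sigma> {..<length xs} I" "\<And>j. j < length xs \<Longrightarrow> l (\<sigma> j) = xs ! j"
    by auto
  have "L (\<sigma> j) \<sim>[at_right 0] (\<lambda>\<epsilon>. xs ! j * complex_of_real (\<epsilon> powr \<Lambda>))" if "j < length xs" for j
  proof -
    have "\<sigma> j \<in> I"
      using \<sigma>(1) that by (auto simp: bij_betw_def)
    then show ?thesis
      using l[of "\<sigma> j"] \<sigma>(2)[OF that] by (auto simp: asymp_equiv_powr_iff K_def[abs_def])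
  qed
  with \<sigma>(1) show ?thesis
    unfolding I_def by blast
qed

section \<open>Existence of continuous root branches\<close>

text \<open>The inner variable is \<epsilon> and the outer one is X, so gcds and resultants of these
  polynomials are taken in X over the polynomials in \<epsilon>.\<close>

definition eval_param :: "real \<Rightarrow> complex poly poly \<Rightarrow> complex poly" where
  "eval_param \<epsilon> F = map_poly (\<lambda>c. poly c (complex_of_real \<epsilon>)) F"

interpretation eval_param_hom: comm_ring_hom "eval_param \<epsilon>"
proof -
  interpret h: map_poly_comm_ring_hom "\<lambda>c. poly c (complex_of_real \<epsilon>)"
    by unfold_locales auto
  show "comm_ring_hom (eval_param \<epsilon>)"
    unfolding eval_param_def by (rule h.comm_ring_hom_axioms)
qed

lemma coeff_eval_param [simp]: "coeff (eval_param \<epsilon> F) j = poly (coeff F j) (complex_of_real \<epsilon>)"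
  by (simp add: eval_param_def coeff_map_poly)

lemma eventually_poly_of_real_nonzero:
  fixes p :: "complex poly"
  assumes "p \<noteq> 0"
  shows "\<forall>\<^sub>F \<epsilon> in at_right 0. poly p (complex_of_real \<epsilon>) \<noteq> 0"
proof -
  define S where "S = {\<epsilon>. poly p (complex_of_real \<epsilon>) = 0}"
  have "finite (complex_of_real ` S)"
    by (rule finite_subset[OF _ poly_roots_finite[OF assms]]) (auto simp: S_def)
  then have "finite S"
    by (rule finite_imageD) (auto simp: inj_on_def)
  \<comment> \<open>0 itself may lie in \<open>S\<close>; the neighbourhood
    \<open>- (S - {0})\<close> contains it all the same, and the punctured filter ignores
    it.\<close>
  then have "\<forall>\<^sub>F \<epsilon> in at 0. \<epsilon> \<notin> S"
    by (auto simp: eventually_at_topological finite_imp_closed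
        intro!: exI[of _ "- (S - {0})"])
  then have "\<forall>\<^sub>F \<epsilon> in at_right 0. \<epsilon> \<notin> S"
    by (rule filter_leD[OF at_le, rotated]) simp
  then show ?thesis
    by (simp add: S_def)
qed

text \<open>The property in \<open>eigenvalue_functions\<close>, phrased for a bivariate polynomial
  that need not be the determinant of a pencil, so that it can be established on factors and then
  combined.\<close>

definition has_root_branches :: "complex poly poly \<Rightarrow> bool" where
  "has_root_branches F \<longleftrightarrow> (\<exists>N L e0. e0 > 0 \<and> (\<forall>i<N. continuous_on {0<..<e0} (L i :: real \<Rightarrow> complex)) \<and>
     (\<forall>\<epsilon>\<in>{0<..<e0}. eval_param \<epsilon> F \<noteq> 0 \<and>
        proots (eval_param \<epsilon> F) = mset (map (\<lambda>i. L i \<epsilon>) [0..<N])))"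

lemma has_root_branches_mult:
  assumes "has_root_branches F" "has_root_branches G"
  shows "has_root_branches (F * G)"
proof -
  obtain N L e0 where F: "e0 > 0" "\<And>i. i < N \<Longrightarrow> continuous_on {0<..<e0} (L i :: real \<Rightarrow> complex)"
    "\<And>\<epsilon>. \<epsilon> \<in> {0<..<e0} \<Longrightarrow> eval_param \<epsilon> F \<noteq> 0 \<and> proots (eval_param \<epsilon> F) = mset (map (\<lambda>i. L i \<epsilon>) [0..<N])"
    using assms(1) unfolding has_root_branches_def by blast
  obtain N' L' e0' where G: "e0' > 0" "\<And>i. i < N' \<Longrightarrow> continuous_on {0<..<e0'} (L' i :: real \<Rightarrow> complex)"
    "\<And>\<epsilon>. \<epsilon> \<in> {0<..<e0'} \<Longrightarrow> eval_param \<epsilon> G \<noteq> 0 \<and> proots (eval_param \<epsilon> G) = mset (map (\<lambda>i. L' i \<epsilon>) [0..<N'])"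
    using assms(2) unfolding has_root_branches_def by blast
  define M where "M i = (if i < N then L i else L' (i - N))" for i
  have "mset (map (\<lambda>i. M i \<epsilon>) [0..<N + N']) =
      mset (map (\<lambda>i. L i \<epsilon>) [0..<N]) + mset (map (\<lambda>i. L' i \<epsilon>) [0..<N'])" for \<epsilon>
  proof -
    have "map (\<lambda>i. M i \<epsilon>) [N..<N + N'] = map (\<lambda>i. L' i \<epsilon>) [0..<N']"
      by (rule nth_equalityI) (auto simp: M_def)
    moreover have "map (\<lambda>i. M i \<epsilon>) [0..<N] = map (\<lambda>i. L i \<epsilon>) [0..<N]"
      by (auto simp: M_def)
    ultimately show ?thesis
      by (simp only: upt_add_eq_append[OF le0] map_append mset_append)
  qed
  moreover have "continuous_on {0<..<min e0 e0'} (M i)" if "i < N + N'" for i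
  proof (cases "i < N")
    case True
    then show ?thesis
      unfolding M_def by (auto intro!: continuous_on_subset[OF F(2)])
  next
    case False
    then have "continuous_on {0<..<min e0 e0'} (L' (i - N))"
      using that by (intro continuous_on_subset[OF G(2)]) auto
    then show ?thesis
      using False by (simp add: M_def)
  qed
  ultimately show ?thesis
    unfolding has_root_branches_def using F(1,3) G(1,3)
    by (intro exI[of _ "N + N'"] exI[of _ M] exI[of _ "min e0 e0'"])
      (simp add: eval_param_hom.hom_mult proots_mult)
qed

lemma has_root_branches_degree_0:
  assumes "F \<noteq> 0" "degree F = 0"
  shows "has_root_branches F"
proof -
  obtain c where F: "F = [:c:]"
    using assms(2) degree_eq_zeroE by blast
  have "eval_param \<epsilon> F = [:poly c (complex_of_real \<epsilon>):]" for \<epsilon>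
    by (rule poly_eqI) (simp add: F coeff_pCons split: nat.splits)
  moreover obtain e0 where "e0 > 0" "\<And>\<epsilon>. 0 < \<epsilon> \<Longrightarrow> \<epsilon> < e0 \<Longrightarrow> poly c (complex_of_real \<epsilon>) \<noteq> 0"
    using eventually_poly_of_real_nonzero[of c] assms(1) by (auto simp: F eventually_at_right_field)
  ultimately show ?thesis
    unfolding has_root_branches_def by (intro exI[of _ 0] exI[of _ undefined] exI[of _ e0]) auto
qed

lemma exists_root_near:
  fixes p :: "complex poly"
  assumes "degree p = N" "r > 0" "norm (poly p y) < norm (lead_coeff p) * r ^ N"
  shows "\<exists>z. poly p z = 0 \<and> dist y z < r"
proof (rule ccontr)
  assume "\<not> ?thesis"
  then have "norm (lead_coeff p) * r ^ size (proots p) \<le> norm (poly p y)"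
    using \<open>r > 0\<close> by (intro norm_poly_ge_dist_roots) (auto simp: not_less)
  then show False
    using assms by (simp add: size_proots_complex)
qed

text \<open>Over an interval on which all roots are simple, the root set is a covering space; lifting the
  interval through each point of one fibre yields the branches.\<close>

lemma continuous_branches_simple_roots:
  fixes p :: "real \<Rightarrow> complex poly"
  assumes "a < b"
    and cont: "\<And>j. continuous_on {a<..<b} (\<lambda>t. coeff (p t) j)"
    and deg: "\<And>t. t \<in> {a<..<b} \<Longrightarrow> degree (p t) = N" and "N > 0"
    and simple: "\<And>t. t \<in> {a<..<b} \<Longrightarrow> card {y. poly (p t) y = 0} = N"
  shows "\<exists>L. (\<forall>i<N. continuous_on {a<..<b} (L i)) \<and>
    (\<forall>t\<in>{a<..<b}. bij_betw (\<lambda>i. L i t) {..<N} {y. poly (p t) y = 0})"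
proof -
  define S where "S = {a<..<b}"
  define C where "C = {(t, y). t \<in> S \<and> poly (p t) y = 0}"
  have "open S"
    by (simp add: S_def)
  have nz: "p t \<noteq> 0" if "t \<in> S" for t
    using deg[of t] that \<open>N > 0\<close> by (auto simp: S_def)
  have fin: "finite {y. poly (p t) y = 0}" if "t \<in> S" for t
    using poly_roots_finite[OF nz[OF that]] .
  have contp: "continuous_on S (\<lambda>t. poly (p t) y)" for y
  proof -
    have "continuous_on S (\<lambda>t. \<Sum>j\<le>N. coeff (p t) j * y ^ j)"
      unfolding S_def by (intro continuous_intros cont)
    then show ?thesis
      by (rule continuous_on_eq) (use deg in \<open>auto simp: poly_altdef S_def\<close>)
  qed
  \<comment> \<open>At \<open>t0\<close> the value at \<open>y\<close> is 0, so the inequality of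
    \<open>exists_root_near\<close> is strict there; both of its sides depend continuously on
    \<open>t\<close>.\<close>
  have near: "\<forall>\<^sub>F t in nhds t0. t \<in> S \<and> (\<exists>z. poly (p t) z = 0 \<and> dist y z < r)"
    if t0: "t0 \<in> S" and y: "poly (p t0) y = 0" and "r > 0" for t0 y r
  proof -
    have "continuous_on S (\<lambda>t. norm (lead_coeff (p t)) * r ^ N - norm (poly (p t) y))"
    proof -
      have "continuous_on S (\<lambda>t. norm (coeff (p t) N) * r ^ N - norm (poly (p t) y))"
        unfolding S_def by (intro continuous_intros cont contp[unfolded S_def])
      then show ?thesis
        by (rule continuous_on_eq) (use deg in \<open>auto simp: S_def\<close>)
    qed
    then have "isCont (\<lambda>t. norm (lead_coeff (p t)) * r ^ N - norm (poly (p t) y)) t0"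
      using \<open>open S\<close> t0 by (simp add: continuous_on_eq_continuous_at)
    moreover have "norm (lead_coeff (p t0)) * r ^ N - norm (poly (p t0) y) > 0"
      using nz[OF t0] y \<open>r > 0\<close> by simp
    ultimately have "\<forall>\<^sub>F t in nhds t0. norm (lead_coeff (p t)) * r ^ N - norm (poly (p t) y) > 0"
      unfolding eventually_nhds_conv_at isCont_def by (blast dest: order_tendstoD(1))
    moreover have "\<forall>\<^sub>F t in nhds t0. t \<in> S"
      using \<open>open S\<close> t0 by (rule eventually_nhds_in_open)
    ultimately show ?thesis
    proof eventually_elim
      case (elim t)
      then show ?case
        using exists_root_near[of "p t" N r y] deg[of t] nz \<open>N > 0\<close> \<open>r > 0\<close> by (auto simp: S_def)
    qed
  qed
  have cov: "covering_space C fst S"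
  proof
    show "continuous_on C fst"
      by (intro continuous_intros)
    have "\<exists>y. poly (p t) y = 0" if "t \<in> S" for t
      using simple[of t] that \<open>N > 0\<close> by (metis (mono_tags, lifting) Collect_empty_eq S_def card.empty not_gr0)
    then show "fst ` C = S"
      by (force simp: C_def)
  next
    fix t0 assume t0: "t0 \<in> S"
    define Y where "Y = {y. poly (p t0) y = 0}"
    have "finite Y" "card Y = N"
      using fin[OF t0] simple t0 by (auto simp: Y_def S_def)
    obtain r where "r > 0" and sep: "\<And>y y'. y \<in> Y \<Longrightarrow> y' \<in> Y \<Longrightarrow> y \<noteq> y' \<Longrightarrow> 2 * r \<le> dist y y'"
      using finite_separated[OF \<open>finite Y\<close>] by blast
    have disj: "ball y r \<inter> ball y' r = {}" if "y \<in> Y" "y' \<in> Y" "y \<noteq> y'" for y y'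
      using sep[OF that] by (intro disjoint_ballI) simp
    note r = \<open>r > 0\<close> disj
    have "\<forall>\<^sub>F t in nhds t0. \<forall>y\<in>Y. \<exists>z. poly (p t) z = 0 \<and> dist y z < r"
    proof (intro eventually_ball_finite[OF \<open>finite Y\<close>] ballI)
      fix y assume "y \<in> Y"
      then have "poly (p t0) y = 0"
        by (simp add: Y_def)
      from near[OF t0 this r(1)] show "\<forall>\<^sub>F t in nhds t0. \<exists>z. poly (p t) z = 0 \<and> dist y z < r"
        by (rule eventually_mono) blast
    qed
    then have "\<forall>\<^sub>F t in nhds t0. t \<in> S \<and> (\<forall>y\<in>Y. \<exists>z. poly (p t) z = 0 \<and> dist y z < r)"
      using \<open>open S\<close> t0 by (auto simp: eventually_conj_iff intro!: eventually_nhds_in_open)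
    then obtain T where T: "open T" "t0 \<in> T" "T \<subseteq> S"
        "\<And>t y. t \<in> T \<Longrightarrow> y \<in> Y \<Longrightarrow> \<exists>z. poly (p t) z = 0 \<and> dist y z < r"
      unfolding eventually_nhds by blast
    \<comment> \<open>Each of the \<open>N\<close> disjoint balls contains a root of
      \<open>p t\<close>, and there are only \<open>N\<close> roots, so each ball contains exactly
      one.\<close>
    have fibre: "\<exists>h. (\<forall>y\<in>Y. dist y (h y) < r) \<and> h ` Y = {z. poly (p t) z = 0}" if "t \<in> T" for t
    proof -
      have "\<forall>y\<in>Y. \<exists>z. poly (p t) z = 0 \<and> dist y z < r"
        using T(4)[OF that] by blast
      then obtain h where h: "\<And>y. y \<in> Y \<Longrightarrow> poly (p t) (h y) = 0" "\<And>y. y \<in> Y \<Longrightarrow> dist y (h y) < r"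
        by metis
      have "inj_on h Y"
      proof (rule inj_onI, rule ccontr)
        fix y y' assume y: "y \<in> Y" "y' \<in> Y" "h y = h y'" "y \<noteq> y'"
        have "h y \<in> ball y r \<inter> ball y' r"
          using h(2)[OF y(1)] h(2)[OF y(2)] y(3) by simp
        then show False
          using r(2)[OF y(1,2,4)] by simp
      qed
      moreover have "t \<in> S"
        using T that by blast
      ultimately have "h ` Y = {z. poly (p t) z = 0}"
        using fin[of t] simple[of t] h(1) \<open>card Y = N\<close>
        by (intro card_subset_eq) (auto simp: card_image S_def)
      then show ?thesis
        using h(2) by blast
    qed
    have ex1: "\<exists>!z. poly (p t) z = 0 \<and> dist y z < r" if ty: "t \<in> T" "y \<in> Y" for t y
    proof -
      obtain h where h: "\<And>y. y \<in> Y \<Longrightarrow> dist y (h y) < r" "h ` Y = {z. poly (p t) z = 0}"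
        using fibre[OF ty(1)] by blast
      show ?thesis
      proof (rule ex1I[of _ "h y"])
        show "poly (p t) (h y) = 0 \<and> dist y (h y) < r"
          using h(1)[OF ty(2)] h(2) ty(2) by blast
      next
        fix z assume z: "poly (p t) z = 0 \<and> dist y z < r"
        then have "z \<in> h ` Y"
          unfolding h(2) by simp
        then obtain y' where y': "y' \<in> Y" "z = h y'"
          by blast
        have "z \<in> ball y r \<inter> ball y' r"
          using z h(1)[OF y'(1)] y'(2) by simp
        then have "y = y'"
          using r(2)[OF ty(2) y'(1)] by blast
        then show "z = h y"
          using y' by simp
      qed
    qed
    have covers: "\<exists>y\<in>Y. dist y z < r" if tz: "t \<in> T" "poly (p t) z = 0" for t z
    proof -
      obtain h where h: "\<And>y. y \<in> Y \<Longrightarrow> dist y (h y) < r" "h ` Y = {z. poly (p t) z = 0}"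
        using fibre[OF tz(1)] by blast
      have "z \<in> h ` Y"
        unfolding h(2) using tz(2) by simp
      then show ?thesis
        using h(1) by blast
    qed
    define U where "U y = C \<inter> (T \<times> ball y r)" for y
    show "\<exists>T. t0 \<in> T \<and> openin (top_of_set S) T \<and>
        (\<exists>v. \<Union>v = C \<inter> fst -` T \<and> (\<forall>u\<in>v. openin (top_of_set C) u) \<and> pairwise disjnt v \<and>
             (\<forall>u\<in>v. \<exists>q. homeomorphism u T fst q))"
    proof (intro exI[of _ T] exI[of _ "U ` Y"] conjI ballI)
      show "openin (top_of_set S) T"
        using T by (intro open_subset) auto
      show "\<Union>(U ` Y) = C \<inter> fst -` T"
        using covers by (auto simp: U_def C_def)
      show "pairwise disjnt (U ` Y)"
        using r(2) by (fastforce simp: pairwise_def U_def disjnt_iff)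
    next
      fix u assume "u \<in> U ` Y"
      then obtain y where y: "y \<in> Y" "u = U y" by blast
      show "openin (top_of_set C) u"
        using T unfolding y U_def by (intro openin_open_Int open_Times) auto
      define g where "g t = (THE z. poly (p t) z = 0 \<and> dist y z < r)" for t
      have g: "poly (p t) (g t) = 0" "dist y (g t) < r" if "t \<in> T" for t
        unfolding g_def using theI'[OF ex1[OF that y(1)]] by auto
      have g_eq: "z = g t" if "t \<in> T" "poly (p t) z = 0" "dist y z < r" for t z
        using ex1[OF that(1) y(1)] that g[OF that(1)] by blast
      have "continuous_on T g"
      proof (subst continuous_on_eq_continuous_at[OF T(1)], rule ballI)
        fix t1 assume t1: "t1 \<in> T"
        show "isCont g t1"
          unfolding isCont_def
        proof (rule tendstoI)
          fix d :: real assume "d > 0"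
          \<comment> \<open>The second bound keeps the nearby root inside the ball of the sheet,
            where \<open>g t\<close> is the only root.\<close>
          define d' where "d' = min d (r - dist y (g t1))"
          have "d' > 0"
            using \<open>d > 0\<close> g[OF t1] by (simp add: d'_def)
          have "\<forall>\<^sub>F t in nhds t1. t \<in> T"
            using T(1) t1 by (rule eventually_nhds_in_open)
          moreover have "\<forall>\<^sub>F t in nhds t1. t \<in> S \<and> (\<exists>z. poly (p t) z = 0 \<and> dist (g t1) z < d')"
            using t1 T g[OF t1] \<open>d' > 0\<close> by (intro near) auto
          ultimately have "\<forall>\<^sub>F t in nhds t1. dist (g t) (g t1) < d"
          proof eventually_elim
            case (elim t)
            then obtain z where z: "poly (p t) z = 0" "dist (g t1) z < d'" by blast
            have "dist y z < r"
              using z(2) dist_triangle[of y z "g t1"] by (simp add: d'_def)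
            then have "z = g t"
              using elim z by (intro g_eq) auto
            then show ?case
              using z(2) by (simp add: d'_def dist_commute)
          qed
          then show "\<forall>\<^sub>F t in at t1. dist (g t) (g t1) < d"
            by (simp add: eventually_nhds_conv_at)
        qed
      qed
      then have "homeomorphism u T fst (\<lambda>t. (t, g t))"
        using g g_eq T(3) unfolding y(2) U_def
        by (intro homeomorphismI continuous_intros) (auto simp: C_def)
      then show "\<exists>q. homeomorphism u T fst q"
        by (intro exI)
    qed (rule T)
  qed
  define t0 where "t0 = (a + b) / 2"
  have t0: "t0 \<in> S"
    using \<open>a < b\<close> by (simp add: t0_def S_def)
  obtain f where f: "bij_betw f {..<N} {y. poly (p t0) y = 0}"
    using ex_bij_betw_nat_finite[OF fin[OF t0]] simple[of t0] t0 by (auto simp: S_def atLeast0LessThan)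
  have "\<exists>G. continuous_on S G \<and> G \<in> S \<rightarrow> C \<and> G t0 = (t0, f i) \<and> (\<forall>t\<in>S. fst (G t) = t)"
    if "i < N" for i
  proof -
    have "f i \<in> {y. poly (p t0) y = 0}"
      using f that by (auto simp: bij_betw_def)
    then have "(t0, f i) \<in> C"
      using t0 by (simp add: C_def)
    moreover have "convex S"
      by (simp add: S_def)
    ultimately obtain G where "continuous_on S G" "G \<in> S \<rightarrow> C" "G t0 = (t0, f i)"
      "\<And>t. t \<in> S \<Longrightarrow> fst (G t) = t"
      using covering_space_lift_strong[OF cov _ t0 convex_imp_simply_connected
          convex_imp_locally_path_connected, of "(t0, f i)" "\<lambda>x. x"]
      by auto
    then show ?thesis
      by auto
  qed
  then obtain G where G: "\<And>i. i < N \<Longrightarrow> continuous_on S (G i)" "\<And>i. i < N \<Longrightarrow> G i \<in> S \<rightarrow> C"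
      "\<And>i. i < N \<Longrightarrow> G i t0 = (t0, f i)" "\<And>i t. i < N \<Longrightarrow> t \<in> S \<Longrightarrow> fst (G i t) = t"
    by metis
  \<comment> \<open>Lifts of the same path that agree at one parameter agree on the connected set
    \<open>S\<close>, whereas at \<open>t0\<close> they start from different roots.\<close>
  have inj: "i = j" if "i < N" "j < N" "t \<in> S" "G i t = G j t" for i j t
  proof -
    have "G i t0 = G j t0"
      by (rule covering_space_lift_unique[OF cov, of "G i" t "G j" S "\<lambda>x. x" t0])
        (use G that t0 in \<open>auto simp: S_def\<close>)
    then show ?thesis
      using G(3) that f by (auto simp: bij_betw_def inj_on_def)
  qed
  show ?thesis
  proof (intro exI[of _ "\<lambda>i t. snd (G i t)"] conjI allI impI ballI)
    fix i assume "i < N"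
    then show "continuous_on {a<..<b} (\<lambda>t. snd (G i t))"
      using G(1) by (intro continuous_intros) (auto simp: S_def)
  next
    fix t assume "t \<in> {a<..<b}"
    then have t: "t \<in> S" by (simp add: S_def)
    have inj': "inj_on (\<lambda>i. snd (G i t)) {..<N}"
      using inj[OF _ _ t] G(4)[OF _ t] by (auto simp: inj_on_def prod_eq_iff)
    moreover have "(\<lambda>i. snd (G i t)) ` {..<N} = {y. poly (p t) y = 0}"
    proof (rule card_subset_eq)
      show "(\<lambda>i. snd (G i t)) ` {..<N} \<subseteq> {y. poly (p t) y = 0}"
      proof (intro image_subsetI CollectI)
        fix i assume "i \<in> {..<N}"
        then have "G i t \<in> C" "fst (G i t) = t"
          using G(2,4) t by auto
        then show "poly (p t) (snd (G i t)) = 0"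
          by (auto simp: C_def)
      qed
      show "card ((\<lambda>i. snd (G i t)) ` {..<N}) = card {y. poly (p t) y = 0}"
        using card_image[OF inj'] simple[of t] t by (simp add: S_def)
    qed (use fin t in auto)
    ultimately show "bij_betw (\<lambda>i. snd (G i t)) {..<N} {y. poly (p t) y = 0}"
      by (simp add: bij_betw_def)
  qed
qed

text \<open>A vanishing resultant means that \<open>gcd F (pderiv F)\<close> has positive degree in
  X, and this degree is at most that of the derivative. The gcd and its cofactor are factors over
  the polynomials in \<epsilon>, so no denominators in \<epsilon> appear.\<close>

lemma resultant_pderiv_nonzero_or_factors:
  fixes F :: "complex poly poly"
  assumes "degree F > 0"
  shows "resultant F (pderiv F) \<noteq> 0 \<or> (\<exists>G H. F = G * H \<and> degree G < degree F \<and> degree H < degree F)"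
proof (rule disjCI)
  assume no_factors: "\<not> (\<exists>G H. F = G * H \<and> degree G < degree F \<and> degree H < degree F)"
  show "resultant F (pderiv F) \<noteq> 0"
  proof
    assume "resultant F (pderiv F) = 0"
    then have "degree (gcd F (pderiv F)) > 0"
      by (simp add: resultant_0_gcd)
    moreover obtain H where H: "F = gcd F (pderiv F) * H"
      by (meson dvdE gcd_dvd1)
    moreover have "pderiv F \<noteq> 0"
      using assms by (simp add: pderiv_eq_0_iff)
    then have "degree (gcd F (pderiv F)) \<le> degree (pderiv F)"
      by (intro dvd_imp_degree_le) auto
    then have "degree (gcd F (pderiv F)) < degree F"
      using assms by (simp add: degree_pderiv)
    moreover have "degree F = degree (gcd F (pderiv F)) + degree H"
      using assms H by (metis degree_0 degree_mult_eq mult_eq_0_iff not_gr0)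
    ultimately show False
      using no_factors by (metis less_add_same_cancel2)
  qed
qed

lemma simple_roots_of_resultant:
  fixes p :: "complex poly"
  assumes "resultant p (pderiv p) \<noteq> 0" "p \<noteq> 0"
  shows "proots p = mset_set {y. poly p y = 0}" "card {y. poly p y = 0} = degree p"
proof -
  have "degree (gcd p (pderiv p)) = 0"
    using assms by (simp add: resultant_0_gcd)
  then have no_common: "\<not> (poly p y = 0 \<and> poly (pderiv p) y = 0)" for y
  proof -
    have False if "poly p y = 0" "poly (pderiv p) y = 0"
    proof -
      have "[:-y, 1:] dvd gcd p (pderiv p)"
        using that by (simp add: poly_eq_0_iff_dvd)
      then have "degree [:-y, 1:] \<le> degree (gcd p (pderiv p))"
        using assms(2) by (intro dvd_imp_degree_le) auto
      then show False
        using \<open>degree (gcd p (pderiv p)) = 0\<close> by simp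
    qed
    then show ?thesis by blast
  qed
  then have "rsquarefree p"
    by (simp add: rsquarefree_roots)
  show roots: "proots p = mset_set {y. poly p y = 0}"
  proof (rule multiset_eqI)
    fix y
    have "Polynomial.order y p = 0 \<or> Polynomial.order y p = 1"
      using \<open>rsquarefree p\<close> by (simp add: rsquarefree_def)
    then have "Polynomial.order y p = (if poly p y = 0 then 1 else 0)"
      using order_root[of p y] assms(2) by auto
    then show "count (proots p) y = count (mset_set {y. poly p y = 0}) y"
      using poly_roots_finite[OF assms(2)] assms(2) by (simp add: count_mset_set')
  qed
  show "card {y. poly p y = 0} = degree p"
    using size_proots_complex[of p] by (simp add: roots)
qed

lemma has_root_branches:
  assumes "F \<noteq> 0"
  shows "has_root_branches F"
  using assms
proof (induction "degree F" arbitrary: F rule: less_induct)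
  case less
  consider "degree F = 0"
    | G H where "F = G * H" "degree G < degree F" "degree H < degree F"
    | "degree F > 0" "resultant F (pderiv F) \<noteq> 0"
    using resultant_pderiv_nonzero_or_factors[of F] by blast
  then show ?case
  proof cases
    case 1
    then show ?thesis
      using less.prems by (rule has_root_branches_degree_0[rotated])
  next
    case 2
    then have "has_root_branches G" "has_root_branches H"
      using less.prems by (auto intro: less.hyps)
    then show ?thesis
      unfolding 2(1) by (rule has_root_branches_mult)
  next
    case 3
    define N where "N = degree F"
    \<comment> \<open>The resultant rules out multiple roots. The leading coefficient keeps the
      degree constant, which also lets evaluation at \<epsilon> commute with the resultant.\<close>
    have "\<forall>\<^sub>F \<epsilon> in at_right 0. poly (lead_coeff F * resultant F (pderiv F)) (complex_of_real \<epsilon>) \<noteq> 0"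
      using 3 less.prems by (intro eventually_poly_of_real_nonzero) auto
    then obtain e0 where e0: "e0 > 0"
      "\<And>\<epsilon>. \<epsilon> \<in> {0<..<e0} \<Longrightarrow> poly (lead_coeff F * resultant F (pderiv F)) (complex_of_real \<epsilon>) \<noteq> 0"
      by (auto simp: eventually_at_right_field)
    have deg: "degree (eval_param \<epsilon> F) = N" if "\<epsilon> \<in> {0<..<e0}" for \<epsilon>
    proof (rule antisym)
      show "degree (eval_param \<epsilon> F) \<le> N"
        by (rule degree_le) (auto simp: N_def coeff_eq_0)
      show "N \<le> degree (eval_param \<epsilon> F)"
        using e0(2)[OF that] by (intro le_degree) (auto simp: N_def)
    qed
    have pd: "pderiv (eval_param \<epsilon> F) = eval_param \<epsilon> (pderiv F)" for \<epsilon>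
      by (rule poly_eqI) (simp add: coeff_pderiv)
    have res: "resultant (eval_param \<epsilon> F) (pderiv (eval_param \<epsilon> F)) \<noteq> 0" if "\<epsilon> \<in> {0<..<e0}" for \<epsilon>
    proof -
      have h: "comm_ring_hom (\<lambda>c. poly c (complex_of_real \<epsilon>))"
        by unfold_locales auto
      have "degree (eval_param \<epsilon> (pderiv F)) = degree (pderiv F)"
        using deg[OF that] by (simp flip: pd add: degree_pderiv N_def)
      then have "resultant (eval_param \<epsilon> F) (eval_param \<epsilon> (pderiv F)) = poly (resultant F (pderiv F)) (complex_of_real \<epsilon>)"
        unfolding eval_param_def
        using deg[OF that] by (intro comm_ring_hom.resultant_map_poly[OF h]) (auto simp: N_def eval_param_def)
      then show ?thesis
        using e0(2)[OF that] by (simp add: pd)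
    qed
    have nz: "eval_param \<epsilon> F \<noteq> 0" if "\<epsilon> \<in> {0<..<e0}" for \<epsilon>
      using deg[OF that] 3 by (auto simp: N_def)
    have "\<exists>L. (\<forall>i<N. continuous_on {0<..<e0} (L i)) \<and>
      (\<forall>\<epsilon>\<in>{0<..<e0}. bij_betw (\<lambda>i. L i \<epsilon>) {..<N} {y. poly (eval_param \<epsilon> F) y = 0})"
    proof (rule continuous_branches_simple_roots)
      show "card {y. poly (eval_param t F) y = 0} = N" if "t \<in> {0<..<e0}" for t
        using simple_roots_of_resultant(2)[OF res nz] that deg by simp
    qed (use e0 3 deg in \<open>auto simp: N_def intro!: continuous_intros\<close>)
    then obtain L where L: "\<And>i. i < N \<Longrightarrow> continuous_on {0<..<e0} (L i)"
      "\<And>\<epsilon>. \<epsilon> \<in> {0<..<e0} \<Longrightarrow> bij_betw (\<lambda>i. L i \<epsilon>) {..<N} {y. poly (eval_param \<epsilon> F) y = 0}"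
      by blast
    have "proots (eval_param \<epsilon> F) = mset (map (\<lambda>i. L i \<epsilon>) [0..<N])" if "\<epsilon> \<in> {0<..<e0}" for \<epsilon>
    proof -
      have "proots (eval_param \<epsilon> F) = mset_set ((\<lambda>i. L i \<epsilon>) ` {..<N})"
        using simple_roots_of_resultant(1)[OF res nz] that L(2)[OF that] by (simp add: bij_betw_def)
      also have "\<dots> = image_mset (\<lambda>i. L i \<epsilon>) (mset_set {..<N})"
        using L(2)[OF that] by (intro image_mset_mset_set[symmetric]) (simp add: bij_betw_def)
      also have "\<dots> = mset (map (\<lambda>i. L i \<epsilon>) [0..<N])"
        by (simp add: atLeast0LessThan)
      finally show ?thesis .
    qed
    then show ?thesis
      unfolding has_root_branches_def using e0 L(1) nz
      by (intro exI[of _ N] exI[of _ L] exI[of _ e0]) auto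
  qed
qed

section \<open>Weights and the Newton polygon\<close>

text \<open>A bivariate polynomial is a polynomial in the outer variable \<open>X\<close> whose coefficients are
  polynomials in \<open>\<epsilon>\<close>: \<open>coeff2 F a b\<close> is the coefficient of \<open>\<epsilon>\<^sup>a X\<^sup>b\<close>.\<close>

abbreviation coeff2 :: "'a::zero poly poly \<Rightarrow> nat \<Rightarrow> nat \<Rightarrow> 'a" where
  "coeff2 F a b \<equiv> coeff (coeff F b) a"

lemma coeff2_mult:
  "coeff2 (F * G :: 'a::comm_semiring_0 poly poly) a b =
     (\<Sum>j\<le>b. \<Sum>i\<le>a. coeff2 F i j * coeff2 G (a - i) (b - j))"
  by (simp add: coeff_mult coeff_sum)

text \<open>The half-plane with normal (\<alpha>, \<beta>) contains the Newton polygon. For positive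
  \<alpha>, the substitution X = Y \<epsilon>^(\<beta>/\<alpha>) gives \<epsilon>^a X^b the
  \<epsilon>-exponent (\<alpha> a + \<beta> b)/\<alpha>, so integral weights describe fractional
  exponents.\<close>

definition weight_ge :: "int \<Rightarrow> int \<Rightarrow> 'a::zero poly poly \<Rightarrow> int \<Rightarrow> bool" where
  "weight_ge \<alpha> \<beta> F w \<longleftrightarrow> (\<forall>a b. coeff2 F a b \<noteq> 0 \<longrightarrow> w \<le> \<alpha> * int a + \<beta> * int b)"

lemma weight_ge_0 [simp]: "weight_ge \<alpha> \<beta> 0 w"
  by (simp add: weight_ge_def)

lemma weight_ge_1: "weight_ge \<alpha> \<beta> (1 :: 'a::comm_semiring_1 poly poly) 0"
  by (auto simp: weight_ge_def coeff_1 split: if_splits)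

lemma weight_ge_add:
  fixes F G :: "'a::comm_monoid_add poly poly"
  shows "weight_ge \<alpha> \<beta> F w \<Longrightarrow> weight_ge \<alpha> \<beta> G w \<Longrightarrow> weight_ge \<alpha> \<beta> (F + G) w"
  unfolding weight_ge_def by (metis add.right_neutral coeff_add)

lemma weight_ge_uminus:
  fixes F :: "'a::ab_group_add poly poly"
  shows "weight_ge \<alpha> \<beta> F w \<Longrightarrow> weight_ge \<alpha> \<beta> (- F) w"
  by (auto simp: weight_ge_def)

lemma weight_ge_sum:
  fixes F :: "'b \<Rightarrow> 'a::comm_monoid_add poly poly"
  shows "(\<And>x. x \<in> A \<Longrightarrow> weight_ge \<alpha> \<beta> (F x) w) \<Longrightarrow> weight_ge \<alpha> \<beta> (sum F A) w"
  by (induction A rule: infinite_finite_induct) (auto intro: weight_ge_add)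

lemma weight_ge_mult:
  fixes F G :: "'a::comm_semiring_0 poly poly"
  assumes "weight_ge \<alpha> \<beta> F v" "weight_ge \<alpha> \<beta> G w"
  shows "weight_ge \<alpha> \<beta> (F * G) (v + w)"
  unfolding weight_ge_def
proof (intro allI impI)
  fix a b assume "coeff2 (F * G) a b \<noteq> 0"
  then obtain j where "j \<le> b" "(\<Sum>i\<le>a. coeff2 F i j * coeff2 G (a - i) (b - j)) \<noteq> 0"
    unfolding coeff2_mult by (metis (no_types, lifting) atMost_iff sum.neutral)
  moreover from this obtain i where "i \<le> a" "coeff2 F i j * coeff2 G (a - i) (b - j) \<noteq> 0"
    by (metis (no_types, lifting) atMost_iff sum.neutral)
  ultimately have "j \<le> b" "i \<le> a" "v \<le> \<alpha> * int i + \<beta> * int j" "w \<le> \<alpha> * int (a - i) + \<beta> * int (b - j)"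
    using assms unfolding weight_ge_def by (metis mult_zero_left, metis mult_zero_right)+
  then show "v + w \<le> \<alpha> * int a + \<beta> * int b"
    by (simp add: of_nat_diff algebra_simps)
qed

lemma weight_ge_prod:
  fixes F :: "'b \<Rightarrow> 'a::comm_semiring_1 poly poly"
  shows "(\<And>x. x \<in> A \<Longrightarrow> weight_ge \<alpha> \<beta> (F x) (w x)) \<Longrightarrow> weight_ge \<alpha> \<beta> (prod F A) (sum w A)"
  by (induction A rule: infinite_finite_induct) (auto intro: weight_ge_mult weight_ge_1)

text \<open>Weak duality for the assignment problem.\<close>

lemma weight_ge_det:
  fixes A :: "'a::comm_ring_1 poly poly mat"
  assumes A: "A \<in> carrier_mat n n"
    and entries: "\<And>i j. i < n \<Longrightarrow> j < n \<Longrightarrow> weight_ge \<alpha> \<beta> (A $$ (i, j)) (u i + v j)"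
  shows "weight_ge \<alpha> \<beta> (det A) ((\<Sum>i<n. u i) + (\<Sum>j<n. v j))"
  unfolding det_def'[OF A]
proof (rule weight_ge_sum)
  fix p assume "p \<in> {p. p permutes {0..<n}}"
  then have p: "p permutes {..<n}"
    by (simp add: atLeast0LessThan)
  have "(\<Sum>i<n. u i) + (\<Sum>j<n. v j) = (\<Sum>i<n. u i) + (\<Sum>i<n. v (p i))"
    using sum.permute[OF p, of v] by (simp add: o_def)
  also have "\<dots> = (\<Sum>i<n. u i + v (p i))"
    by (simp add: sum.distrib)
  finally have "weight_ge \<alpha> \<beta> (\<Prod>i<n. A $$ (i, p i)) ((\<Sum>i<n. u i) + (\<Sum>j<n. v j))"
    using entries permutes_in_image[OF p] by (auto intro!: weight_ge_prod)
  then show "weight_ge \<alpha> \<beta> (signof p * (\<Prod>i = 0..<n. A $$ (i, p i))) ((\<Sum>i<n. u i) + (\<Sum>j<n. v j))"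
    by (auto simp: sign_def atLeast0LessThan intro: weight_ge_uminus)
qed

text \<open>A vertex of the Newton polygon exposed by the weight: the only monomial of minimal
  weight. Uniqueness excludes cancellation, which makes the notion multiplicative.\<close>

definition strict_lead :: "int \<Rightarrow> int \<Rightarrow> 'a::zero poly poly \<Rightarrow> nat \<Rightarrow> nat \<Rightarrow> bool" where
  "strict_lead \<alpha> \<beta> F a b \<longleftrightarrow> coeff2 F a b \<noteq> 0 \<and>
     (\<forall>a' b'. coeff2 F a' b' \<noteq> 0 \<longrightarrow> a' = a \<and> b' = b \<or>
        \<alpha> * int a + \<beta> * int b < \<alpha> * int a' + \<beta> * int b')"

lemma strict_lead_coeff2: "strict_lead \<alpha> \<beta> F a b \<Longrightarrow> coeff2 F a b \<noteq> 0"
  by (simp add: strict_lead_def)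

lemma strict_lead_1: "strict_lead \<alpha> \<beta> (1 :: 'a::comm_semiring_1 poly poly) 0 0"
  by (auto simp: strict_lead_def coeff_1 split: if_splits)

text \<open>Exponents of \<open>F\<close> and \<open>G\<close> have weights that add up to the
  minimum only for the pair (a, b), (c, d). The extreme coefficient of the product is therefore a
  single product of two non-zero elements of a domain.\<close>

lemma strict_lead_mult:
  fixes F G :: "'a::idom poly poly"
  assumes F: "strict_lead \<alpha> \<beta> F a b" and G: "strict_lead \<alpha> \<beta> G c d"
  shows "strict_lead \<alpha> \<beta> (F * G) (a + c) (b + d)"
proof -
  have key: "i = a \<and> j = b \<and> i' = a + c \<and> j' = b + d \<or>
      \<alpha> * int (a + c) + \<beta> * int (b + d) < \<alpha> * int i' + \<beta> * int j'"
    if nz: "coeff2 F i j * coeff2 G (i' - i) (j' - j) \<noteq> 0" and le: "i \<le> i'" "j \<le> j'" for i j i' j'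
  proof -
    have "i = a \<and> j = b \<or> \<alpha> * int a + \<beta> * int b < \<alpha> * int i + \<beta> * int j"
      using F nz by (auto simp: strict_lead_def)
    moreover have "i' - i = c \<and> j' - j = d \<or>
        \<alpha> * int c + \<beta> * int d < \<alpha> * int (i' - i) + \<beta> * int (j' - j)"
      using G nz by (auto simp: strict_lead_def)
    ultimately show ?thesis
      using le by (auto simp: of_nat_diff algebra_simps)
  qed
  have "coeff2 (F * G) (a + c) (b + d) =
     (\<Sum>j\<le>b + d. if j = b then coeff2 F a b * coeff2 G c d else 0)"
    unfolding coeff2_mult
  proof (rule sum.cong[OF refl])
    fix j assume "j \<in> {..b + d}"
    have "(\<Sum>i\<le>a + c. coeff2 F i j * coeff2 G (a + c - i) (b + d - j)) =
          (\<Sum>i\<le>a + c. if i = a then if j = b then coeff2 F a b * coeff2 G c d else 0 else 0)"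
    proof (rule sum.cong[OF refl])
      fix i assume "i \<in> {..a + c}"
      then show "coeff2 F i j * coeff2 G (a + c - i) (b + d - j) =
          (if i = a then if j = b then coeff2 F a b * coeff2 G c d else 0 else 0)"
        using key[where i = i and j = j and i' = "a + c" and j' = "b + d"] \<open>j \<in> {..b + d}\<close>
        by (cases "i = a \<and> j = b") (auto intro: ccontr)
    qed
    then show "(\<Sum>i\<le>a + c. coeff2 F i j * coeff2 G (a + c - i) (b + d - j)) =
        (if j = b then coeff2 F a b * coeff2 G c d else 0)"
      by simp
  qed
  then have "coeff2 (F * G) (a + c) (b + d) = coeff2 F a b * coeff2 G c d"
    by simp
  moreover have "i' = a + c \<and> j' = b + d \<or>
      \<alpha> * int (a + c) + \<beta> * int (b + d) < \<alpha> * int i' + \<beta> * int j'"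
    if "coeff2 (F * G) i' j' \<noteq> 0" for i' j'
  proof -
    obtain j where j: "j \<le> j'" "(\<Sum>i\<le>i'. coeff2 F i j * coeff2 G (i' - i) (j' - j)) \<noteq> 0"
      using \<open>coeff2 (F * G) i' j' \<noteq> 0\<close> unfolding coeff2_mult
      by (metis (no_types, lifting) atMost_iff sum.neutral)
    then obtain i where "i \<le> i'" "coeff2 F i j * coeff2 G (i' - i) (j' - j) \<noteq> 0"
      by (metis (no_types, lifting) atMost_iff sum.neutral)
    then show ?thesis
      using key j(1) by blast
  qed
  ultimately show ?thesis
    using F G by (auto simp: strict_lead_def)
qed

lemma strict_lead_power:
  fixes F :: "'a::idom poly poly"
  assumes "strict_lead \<alpha> \<beta> F a b"
  shows "strict_lead \<alpha> \<beta> (F ^ s) (s * a) (s * b)"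
  by (induction s) (auto intro: strict_lead_1 strict_lead_mult assms)

lemma strict_lead_prod_list:
  fixes F :: "'b \<Rightarrow> 'a::idom poly poly"
  assumes "\<And>x. x \<in> set xs \<Longrightarrow> strict_lead \<alpha> \<beta> (F x) (f x) (g x)"
  shows "strict_lead \<alpha> \<beta> (\<Prod>x\<leftarrow>xs. F x) (\<Sum>x\<leftarrow>xs. f x) (\<Sum>x\<leftarrow>xs. g x)"
  using assms by (induction xs) (auto intro: strict_lead_1 strict_lead_mult)

text \<open>For integral weights, the bound with \<open>+ 1\<close> says that \<open>G\<close> lies
  strictly above the supporting line through (a, b).\<close>

lemma strict_lead_add:
  fixes F G :: "'a::comm_monoid_add poly poly"
  assumes "strict_lead \<alpha> \<beta> F a b" "weight_ge \<alpha> \<beta> G (\<alpha> * int a + \<beta> * int b + 1)"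
  shows "strict_lead \<alpha> \<beta> (F + G) a b"
proof -
  have "coeff2 G a b = 0"
    using assms(2) unfolding weight_ge_def by force
  moreover have "\<alpha> * int a + \<beta> * int b < \<alpha> * int a' + \<beta> * int b'"
    if "coeff2 G a' b' \<noteq> 0" for a' b'
    using assms(2) that unfolding weight_ge_def by force
  ultimately show ?thesis
    using assms(1) unfolding strict_lead_def coeff_add
    by (metis add.left_neutral add.right_neutral)
qed

lemma strict_lead_monom:
  "c \<noteq> 0 \<Longrightarrow> strict_lead \<alpha> \<beta> (monom (monom c a) b) a b"
  by (auto simp: strict_lead_def split: if_splits)

lemma weight_ge_monom:
  "w \<le> \<alpha> * int a + \<beta> * int b \<Longrightarrow> weight_ge \<alpha> \<beta> (monom (monom c a) b) w"
  by (auto simp: weight_ge_def split: if_splits)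

text \<open>A feasible dual solution, of value \<open>w\<close>, of the assignment problem for one
  block. \<open>R\<close> bounds a single entry by the sum of its row and column potentials. The
  caps \<open>U\<close> and \<open>V\<close> control sums of potentials that belong to different
  blocks.\<close>

definition has_potentials ::
  "('a \<Rightarrow> int \<Rightarrow> bool) \<Rightarrow> int \<Rightarrow> int \<Rightarrow> 'a mat \<Rightarrow> int \<Rightarrow> bool" where
  "has_potentials R U V B w \<longleftrightarrow> square_mat B \<and>
     (\<exists>u v. (\<forall>i<dim_row B. \<forall>j<dim_row B. R (B $$ (i, j)) (u i + v j)) \<and>
        (\<forall>i<dim_row B. u i \<le> U \<and> v i \<le> V) \<and> (\<Sum>i<dim_row B. u i) + (\<Sum>i<dim_row B. v i) = w)"

text \<open>Concatenated potentials remain feasible because all entries outside the diagonal blocks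
  are 0, and 0 satisfies every bound.\<close>

lemma has_potentials_diag_block_mat:
  fixes R :: "'a::zero \<Rightarrow> int \<Rightarrow> bool"
  assumes "list_all2 (has_potentials R U V) Bs ws" and R0: "\<And>w. R 0 w"
  shows "has_potentials R U V (diag_block_mat Bs) (sum_list ws)"
  using assms(1)
proof (induction rule: list_all2_induct)
  case (Cons B Bs w ws)
  define n m where "n = dim_row B" and "m = dim_row (diag_block_mat Bs)"
  have sq: "dim_col B = n" "dim_col (diag_block_mat Bs) = m"
    using Cons by (auto simp: n_def m_def has_potentials_def)
  obtain u v where uv: "\<And>i j. i < n \<Longrightarrow> j < n \<Longrightarrow> R (B $$ (i, j)) (u i + v j)"
    "\<And>i. i < n \<Longrightarrow> u i \<le> U \<and> v i \<le> V" "(\<Sum>i<n. u i) + (\<Sum>i<n. v i) = w"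
    using Cons unfolding n_def has_potentials_def by blast
  obtain u' v' where uv': "\<And>i j. i < m \<Longrightarrow> j < m \<Longrightarrow> R (diag_block_mat Bs $$ (i, j)) (u' i + v' j)"
    "\<And>i. i < m \<Longrightarrow> u' i \<le> U \<and> v' i \<le> V" "(\<Sum>i<m. u' i) + (\<Sum>i<m. v' i) = sum_list ws"
    using Cons unfolding m_def has_potentials_def by blast
  define u2 v2 where "u2 i = (if i < n then u i else u' (i - n))"
    and "v2 i = (if i < n then v i else v' (i - n))" for i
  have split_sum: "(\<Sum>i<n + m. h i) = (\<Sum>i<n. h i) + (\<Sum>i<m. h (n + i))" for h :: "nat \<Rightarrow> int"
    by (induction m) auto
  have dims: "dim_row (diag_block_mat (B # Bs)) = n + m" "square_mat (diag_block_mat (B # Bs))"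
    using sq by (simp_all add: Let_def n_def m_def)
  have "R (diag_block_mat (B # Bs) $$ (i, j)) (u2 i + v2 j)" if "i < n + m" "j < n + m" for i j
    using that uv(1)[of i j] uv'(1)[of "i - n" "j - n"] R0 sq
    by (auto simp: Let_def u2_def v2_def n_def m_def)
  moreover have "u2 i \<le> U \<and> v2 i \<le> V" if "i < n + m" for i
    using that uv(2)[of i] uv'(2)[of "i - n"] by (auto simp: u2_def v2_def)
  moreover have "(\<Sum>i<n + m. u2 i) + (\<Sum>i<n + m. v2 i) = sum_list (w # ws)"
    unfolding split_sum using uv(3) uv'(3) by (simp add: u2_def v2_def)
  ultimately show ?case
    unfolding has_potentials_def dims(1) using dims(2) by blast
qed (auto simp: has_potentials_def)

section \<open>Determinants of block diagonal and cyclic bidiagonal matrices\<close>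

lemma det_diag_block_mat:
  fixes Bs :: "'a::idom mat list"
  assumes "\<And>B. B \<in> set Bs \<Longrightarrow> square_mat B"
  shows "det (diag_block_mat Bs) = prod_list (map det Bs)"
  using assms
proof (induction Bs)
  case (Cons B Bs)
  have "square_mat (diag_block_mat Bs)"
    by (rule diag_block_mat_square) (use Cons.prems in auto)
  then have "det (diag_block_mat (B # Bs)) = det B * det (diag_block_mat Bs)"
    using Cons.prems[of B] unfolding diag_block_mat.simps Let_def
    by (intro det_four_block_mat_lower_left_zero[where n = "dim_row B" and m = "dim_row (diag_block_mat Bs)"])
      (auto intro!: carrier_matI)
  then show ?case
    using Cons by simp
qed auto

text \<open>Only the identity and the full cycle contribute. The first column has its possibly
  non-zero entries at the top and at the bottom, and deleting their rows leaves an upper and a lower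
  triangular matrix.\<close>

lemma det_cyclic_bidiagonal:
  fixes d e c :: "'a::comm_ring_1"
  assumes "S > 0"
  shows "det (mat S S (\<lambda>(i, j). (if i = j then d else if Suc i = j then e else 0) +
      (if Suc i = S \<and> j = 0 then c else 0))) = d ^ S + (- 1) ^ (S - 1) * c * e ^ (S - 1)"
proof -
  define A where "A = mat S S (\<lambda>(i, j). (if i = j then d else if Suc i = j then e else 0) +
      (if Suc i = S \<and> j = 0 then c else 0))"
  have A: "A \<in> carrier_mat S S"
    by (simp add: A_def)
  have cof0: "cofactor A 0 0 = d ^ (S - 1)"
  proof -
    have "mat_delete A 0 0 = mat (S - 1) (S - 1) (\<lambda>(i, j). if i = j then d else if Suc i = j then e else 0)"
      unfolding mat_delete_def A_def by (intro eq_matI) auto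
    moreover have "det \<dots> = prod_list (diag_mat \<dots>)"
      by (intro det_upper_triangular[where n = "S - 1"]) (auto intro!: upper_triangularI)
    ultimately show ?thesis
      by (simp add: cofactor_def prod_list_diag_prod)
  qed
  have cofS: "cofactor A (S - 1) 0 = (- 1) ^ (S - 1) * e ^ (S - 1)"
  proof -
    have "mat_delete A (S - 1) 0 = mat (S - 1) (S - 1) (\<lambda>(i, j). if i = j then e else if i = Suc j then d else 0)"
      unfolding mat_delete_def A_def using assms by (intro eq_matI) auto
    moreover have "det \<dots> = prod_list (diag_mat \<dots>)"
      by (intro det_lower_triangular[where n = "S - 1"]) auto
    ultimately show ?thesis
      by (simp add: cofactor_def prod_list_diag_prod)
  qed
  have "det A = (\<Sum>i<S. A $$ (i, 0) * cofactor A i 0)"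
    using assms A by (intro laplace_expansion_column) auto
  \<comment> \<open>Two separate indicators instead of a case distinction: for \<open>S = 1\<close>
    both corners are the same entry \<open>d + c\<close>.\<close>
  also have "\<dots> = (\<Sum>i<S. (if i = 0 then d * cofactor A 0 0 else 0) +
      (if i = S - 1 then c * cofactor A (S - 1) 0 else 0))"
    using assms by (intro sum.cong) (auto simp: A_def algebra_simps)
  also have "\<dots> = d * cofactor A 0 0 + c * cofactor A (S - 1) 0"
    using assms by (simp add: sum.distrib)
  also have "\<dots> = d ^ S + (- 1) ^ (S - 1) * c * e ^ (S - 1)"
    using assms cof0 cofS by (cases S) (simp_all add: mult_ac)
  finally show ?thesis
    by (simp add: A_def)
qed

section \<open>Perturbations of the Weierstrass form\<close>

definition lift_X :: "complex poly \<Rightarrow> complex poly poly" where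
  "lift_X = map_poly (\<lambda>a. [:a:])"

abbreviation const2 :: "complex \<Rightarrow> complex poly poly" where
  "const2 a \<equiv> [:[:a:]:]"

text \<open>The matrix \<open>D + \<epsilon> X\<^sup>2 M\<close>.\<close>

definition perturbed :: "complex poly mat \<Rightarrow> complex mat \<Rightarrow> complex poly poly mat" where
  "perturbed D M = mat (dim_row D) (dim_row D)
     (\<lambda>ij. lift_X (D $$ ij) + monom (monom 1 1) 2 * const2 (M $$ ij))"

lemma coeff2_lift_X: "coeff2 (lift_X x) a b = (if a = 0 then coeff x b else 0)"
  by (simp add: lift_X_def coeff_map_poly coeff_pCons split: nat.splits)

lemma lift_X_0 [simp]: "lift_X 0 = 0"
  by (simp add: lift_X_def)

lemma comm_ring_hom_lift_X: "comm_ring_hom lift_X"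
proof -
  have "comm_ring_hom (\<lambda>a::complex. [:a:])"
    by unfold_locales (simp_all flip: one_pCons)
  then interpret map_poly_comm_ring_hom "\<lambda>a::complex. [:a:]"
    by (simp add: map_poly_comm_ring_hom_def)
  show ?thesis
    unfolding lift_X_def by (rule comm_ring_hom_axioms)
qed

lemma comm_ring_hom_const2: "comm_ring_hom const2"
  by unfold_locales (simp_all flip: one_pCons)

lemma lift_X_const: "lift_X [:a:] = const2 a"
  by (intro poly_eqI) (simp add: coeff2_lift_X coeff_pCons split: nat.splits)

lemma coeff2_const2_mult: "coeff2 (const2 a * F) i j = a * coeff2 F i j"
  by simp

lemma perturbed_carrier: "D \<in> carrier_mat n n \<Longrightarrow> perturbed D M \<in> carrier_mat n n"
  by (simp add: perturbed_def)

lemma perturbed_eq_add: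
  assumes "D \<in> carrier_mat n n" "M \<in> carrier_mat n n"
  shows "perturbed D M = map_mat lift_X D + monom (monom 1 1) 2 \<cdot>\<^sub>m map_mat const2 M"
  unfolding perturbed_def using assms by (intro eq_matI) auto

text \<open>\<open>P\<close> and \<open>Q\<close> are constant, so they can be pulled out of both
  summands: P D Q + \<epsilon> X^2 P M Q = P (D + \<epsilon> X^2 M) Q. The perturbation keeps its
  shape under a change of coordinates.\<close>

lemma det_perturbed_congruence:
  assumes D: "D \<in> carrier_mat n n" and M: "M \<in> carrier_mat n n"
    and P: "P \<in> carrier_mat n n" and Q: "Q \<in> carrier_mat n n"
  shows "det (perturbed (map_mat (\<lambda>a. [:a:]) P * D * map_mat (\<lambda>a. [:a:]) Q) (P * M * Q)) =
    const2 (det P * det Q) * det (perturbed D M)"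
proof -
  interpret l: comm_ring_hom lift_X by (rule comm_ring_hom_lift_X)
  interpret c: comm_ring_hom const2 by (rule comm_ring_hom_const2)
  let ?P = "map_mat const2 P" and ?Q = "map_mat const2 Q" and ?T = "monom (monom 1 1) 2 :: complex poly poly"
  let ?PX = "map_mat (\<lambda>a. [:a:]) P" and ?QX = "map_mat (\<lambda>a. [:a:]) Q"
  let ?D = "map_mat lift_X D" and ?M = "map_mat const2 M"
  have lP: "map_mat lift_X ?PX = ?P" "map_mat lift_X ?QX = ?Q"
    using P Q by (auto intro!: eq_matI simp: lift_X_const)
  have carr: "?P \<in> carrier_mat n n" "?Q \<in> carrier_mat n n" "?D \<in> carrier_mat n n" "?M \<in> carrier_mat n n"
    "?PX \<in> carrier_mat n n" "?QX \<in> carrier_mat n n"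
    using assms by auto
  have "perturbed (?PX * D * ?QX) (P * M * Q) =
      map_mat lift_X (?PX * D * ?QX) + ?T \<cdot>\<^sub>m map_mat const2 (P * M * Q)"
    using assms by (intro perturbed_eq_add[where n = n]) auto
  also have "map_mat lift_X (?PX * D * ?QX) = ?P * ?D * ?Q"
    using assms by (simp add: l.mat_hom_mult[where nr = n and n = n and nc = n] lP)
  also have "map_mat const2 (P * M * Q) = ?P * ?M * ?Q"
    using assms by (simp add: c.mat_hom_mult[where nr = n and n = n and nc = n])
  also have "?P * ?D * ?Q + ?T \<cdot>\<^sub>m (?P * ?M * ?Q) = ?P * (?D + ?T \<cdot>\<^sub>m ?M) * ?Q"
  proof -
    have "?P * (?D + ?T \<cdot>\<^sub>m ?M) = ?P * ?D + ?P * (?T \<cdot>\<^sub>m ?M)"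
      using carr by (intro mult_add_distrib_mat[where nr = n and n = n and nc = n]) auto
    also have "?P * (?T \<cdot>\<^sub>m ?M) = ?T \<cdot>\<^sub>m (?P * ?M)"
      using carr by (intro mult_smult_distrib[where nr = n and n = n and nc = n])
    also have "(?P * ?D + ?T \<cdot>\<^sub>m (?P * ?M)) * ?Q = ?P * ?D * ?Q + (?T \<cdot>\<^sub>m (?P * ?M)) * ?Q"
      using carr by (intro add_mult_distrib_mat[where nr = n and n = n and nc = n]) auto
    also have "(?T \<cdot>\<^sub>m (?P * ?M)) * ?Q = ?T \<cdot>\<^sub>m (?P * ?M * ?Q)"
      using carr by (intro mult_smult_assoc_mat[where nr = n and n = n and nc = n]) auto
    finally show ?thesis ..
  qed
  also have "?D + ?T \<cdot>\<^sub>m ?M = perturbed D M"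
    using D M by (simp add: perturbed_eq_add)
  also have "det (?P * perturbed D M * ?Q) = det ?P * det (perturbed D M) * det ?Q"
    using carr perturbed_carrier[OF D, of M] by (simp add: det_mult[of _ n])
  finally show ?thesis
    by (simp add: c.hom_det mult_ac)
qed

lemma dim_matrix_pencil [simp]: "dim_row (matrix_pencil n Bs) = n" "dim_col (matrix_pencil n Bs) = n"
  by (simp_all add: matrix_pencil_def)

lemma matrix_pencil_carrier [simp]: "matrix_pencil n Bs \<in> carrier_mat n n"
  by (simp add: matrix_pencil_def)

lemma index_matrix_pencil [simp]:
  "i < n \<Longrightarrow> j < n \<Longrightarrow> matrix_pencil n Bs $$ (i, j) = Poly (map (\<lambda>B. B $$ (i, j)) Bs)"
  by (simp add: matrix_pencil_def)

abbreviation (input) "fin_block \<equiv> \<lambda>(s, a). matrix_pencil s [- jordan_block s a, 1\<^sub>m s]"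
abbreviation (input) "zero_block \<equiv> \<lambda>s. matrix_pencil s [jordan_block s 0, 1\<^sub>m s]"
abbreviation (input) "inf_block \<equiv> \<lambda>s. matrix_pencil s [1\<^sub>m s, jordan_block s 0]"

abbreviation "weierstrass_blocks fs s0 sinf \<equiv>
  diag_block_mat (map fin_block fs @ map zero_block s0 @ map inf_block sinf)"

text \<open>The two existence clauses serve opposite purposes: bounds for all \<open>M\<close> are
  carried over to all \<open>m\<close>, and a single \<open>M\<close> with a non-zero coefficient
  yields a matrix \<open>m\<close>. The constant \<open>\<kappa>\<close> affects neither exponents
  nor roots.\<close>

lemma weierstrass_transform:
  assumes W: "weierstrass_form n c k fs s0 sinf"
  defines "D \<equiv> weierstrass_blocks fs s0 sinf"
  obtains \<kappa> where "\<kappa> \<noteq> 0" "D \<in> carrier_mat n n"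
    "n = (\<Sum>(s, a)\<leftarrow>fs. s) + sum_list s0 + sum_list sinf"
    "\<And>m. m \<in> carrier_mat n n \<Longrightarrow> \<exists>M\<in>carrier_mat n n.
        det (perturbed D M) = const2 \<kappa> * det (perturbed (matrix_pencil n [k, c]) m)"
    "\<And>M. M \<in> carrier_mat n n \<Longrightarrow> \<exists>m\<in>carrier_mat n n.
        det (perturbed D M) = const2 \<kappa> * det (perturbed (matrix_pencil n [k, c]) m)"
proof -
  obtain P Q where P: "P \<in> carrier_mat n n" and Q: "Q \<in> carrier_mat n n"
    and inv: "invertible_mat P" "invertible_mat Q"
    and D: "map_mat (\<lambda>a. [:a:]) P * matrix_pencil n [k, c] * map_mat (\<lambda>a. [:a:]) Q = D"
    using W unfolding weierstrass_form_def D_def by blast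
  obtain P' where P': "P * P' = 1\<^sub>m n" "P' * P = 1\<^sub>m (dim_row P')"
    using inv(1) P unfolding invertible_mat_def inverts_mat_def by auto
  \<comment> \<open>The inverse comes without dimensions: its columns are read off from
    \<open>P * P'\<close> and its rows from \<open>P' * P\<close>.\<close>
  have P'c: "P' \<in> carrier_mat n n"
    using arg_cong[OF P'(1), of dim_col] arg_cong[OF P'(2), of dim_col] P by auto
  obtain Q' where Q': "Q * Q' = 1\<^sub>m n" "Q' * Q = 1\<^sub>m (dim_row Q')"
    using inv(2) Q unfolding invertible_mat_def inverts_mat_def by auto
  have Q'c: "Q' \<in> carrier_mat n n"
    using arg_cong[OF Q'(1), of dim_col] arg_cong[OF Q'(2), of dim_col] Q by auto
  have dets: "det P * det P' = 1" "det Q * det Q' = 1"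
    using det_mult[OF P P'c] det_mult[OF Q Q'c] P'(1) Q'(1) by simp_all
  have Dc: "D \<in> carrier_mat n n"
    unfolding D[symmetric] using P Q by (intro mult_carrier_mat[where n = n]) auto
  have cong: "det (perturbed D (P * m * Q)) =
      const2 (det P * det Q) * det (perturbed (matrix_pencil n [k, c]) m)" if "m \<in> carrier_mat n n" for m
    unfolding D[symmetric] using that P Q by (intro det_perturbed_congruence) auto
  show thesis
  proof (rule that[of "det P * det Q"])
    show "det P * det Q \<noteq> 0"
      using dets by auto
    have "n = dim_row D"
      using Dc by simp
    then show "n = (\<Sum>(s, a)\<leftarrow>fs. s) + sum_list s0 + sum_list sinf"
      by (simp add: D_def dim_diag_block_mat case_prod_unfold o_def)
  next
    fix m :: "complex mat" assume "m \<in> carrier_mat n n"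
    then show "\<exists>M\<in>carrier_mat n n. det (perturbed D M) =
        const2 (det P * det Q) * det (perturbed (matrix_pencil n [k, c]) m)"
      using P Q cong by (intro bexI[of _ "P * m * Q"]) auto
  next
    fix M :: "complex mat" assume M: "M \<in> carrier_mat n n"
    have "P * (P' * M * Q') * Q = P * P' * M * (Q' * Q)"
      using P P'c Q Q'c M by (simp add: assoc_mult_mat[of _ n n _ n _ n])
    also have "\<dots> = M"
      using P' Q' Q'c M by simp
    finally show "\<exists>m\<in>carrier_mat n n. det (perturbed D M) =
        const2 (det P * det Q) * det (perturbed (matrix_pencil n [k, c]) m)"
      using P'c Q'c M cong[of "P' * M * Q'"] by (intro bexI[of _ "P' * M * Q'"]) auto
  qed (use Dc in auto)
qed

text \<open>The counterpart of \<open>weight_ge\<close> for entries free of \<epsilon>, where only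
  the weight of X enters.\<close>

definition order_ge :: "int \<Rightarrow> complex poly \<Rightarrow> int \<Rightarrow> bool" where
  "order_ge \<beta> x w \<longleftrightarrow> (\<forall>b. coeff x b \<noteq> 0 \<longrightarrow> w \<le> \<beta> * int b)"

lemma order_ge_0: "order_ge \<beta> 0 w"
  by (simp add: order_ge_def)

text \<open>The monomial \<epsilon> X^2 has weight \<alpha> + 2 \<beta>, so every entry of the
  perturbation is admissible whatever its position and value. The bound is therefore uniform in
  \<open>M\<close>.\<close>

lemma weight_ge_det_perturbed:
  assumes "D \<in> carrier_mat n n"
    and "has_potentials (order_ge \<beta>) U V D w"
    and UV: "U + V \<le> \<alpha> + 2 * \<beta>"
  shows "weight_ge \<alpha> \<beta> (det (perturbed D M)) w"
proof -
  obtain u v where uv: "\<And>i j b. i < n \<Longrightarrow> j < n \<Longrightarrow> coeff (D $$ (i, j)) b \<noteq> 0 \<Longrightarrow> u i + v j \<le> \<beta> * int b"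
      "\<And>i. i < n \<Longrightarrow> u i \<le> U \<and> v i \<le> V" "(\<Sum>i<n. u i) + (\<Sum>i<n. v i) = w"
    using assms(2) unfolding has_potentials_def order_ge_def carrier_matD(1)[OF assms(1)] by blast
  have "weight_ge \<alpha> \<beta> (det (perturbed D M)) ((\<Sum>i<n. u i) + (\<Sum>i<n. v i))"
  proof (rule weight_ge_det)
    fix i j assume ij: "i < n" "j < n"
    have "weight_ge \<alpha> \<beta> (lift_X (D $$ (i, j))) (u i + v j)"
      using uv(1)[OF ij] by (auto simp: weight_ge_def coeff2_lift_X split: if_splits)
    moreover have "weight_ge \<alpha> \<beta> (monom (monom (M $$ (i, j)) 1) 2) (u i + v j)"
      using uv(2)[of i] uv(2)[of j] ij UV by (intro weight_ge_monom) auto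
    then have "weight_ge \<alpha> \<beta> (monom (monom 1 1) 2 * const2 (M $$ (i, j))) (u i + v j)"
      by (simp add: smult_monom mult.commute)
    ultimately show "weight_ge \<alpha> \<beta> (perturbed D M $$ (i, j)) (u i + v j)"
      using ij assms(1) by (auto simp: perturbed_def intro: weight_ge_add)
  qed (rule perturbed_carrier[OF assms(1)])
  then show ?thesis
    by (simp only: uv(3))
qed

lemma coeff_Poly2: "coeff (Poly [x, y]) b = (if b = 0 then x else if b = 1 then y else 0)"
  by (simp add: coeff_pCons del: coeff_Poly_eq split: nat.splits)

text \<open>The bounds \<open>U\<close> and \<open>V\<close> are the same for all blocks, and \<open>U + V\<close> is the weight of \<open>\<epsilon> X\<^sup>2\<close>, so that
  entries of the perturbation outside the diagonal blocks are admissible.\<close>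

lemma potentials_inf_block:
  fixes s S :: nat
  shows "has_potentials (order_ge (- 1)) (int s - 1) 0 (inf_block S) (- int (S - s))"
proof -
  \<comment> \<open>Potentials p and - p would be tight on the diagonal and on the superdiagonal.
    The cap s - 1 on the rows forces a truncation, which stays tight on the superdiagonal and loses
    1 at every diagonal position from s on.\<close>
  define u v where "u p = min (int p) (int s - 1)" and "v p = - min (int p) (int s)" for p
  have "u i + v j \<le> - 1 * int b" if "i < S" "j < S" "coeff (inf_block S $$ (i, j)) b \<noteq> 0" for i j b
    using that by (auto simp: coeff_Poly2 u_def v_def simp del: Poly.simps coeff_Poly_eq split: if_splits)
  moreover have "u i \<le> int s - 1 \<and> v i \<le> 0" for i
    by (auto simp: u_def v_def)
  moreover have "(\<Sum>i<S. u i) + (\<Sum>i<S. v i) = - int (S - s)"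
    by (induction S) (auto simp: u_def v_def)
  ultimately show ?thesis
    unfolding has_potentials_def order_ge_def by (intro conjI exI[of _ u] exI[of _ v]) auto
qed

text \<open>The truncation is the one used at infinity, with the columns raised by 1, since now the
  diagonal carries X and the superdiagonal 1. Diagonal positions from s on contribute 0 instead of
  1.\<close>

lemma potentials_zero_block:
  fixes s S :: nat
  shows "has_potentials (order_ge 1) (int s - 1) 1 (zero_block S) (int (min S s))"
proof -
  define u v where "u p = min (int p) (int s - 1)" and "v p = 1 - min (int p) (int s)" for p
  have "u i + v j \<le> 1 * int b" if "i < S" "j < S" "coeff (zero_block S $$ (i, j)) b \<noteq> 0" for i j b
    using that by (auto simp: coeff_Poly2 u_def v_def simp del: Poly.simps coeff_Poly_eq split: if_splits)
  moreover have "u i \<le> int s - 1 \<and> v i \<le> 1" for i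
    by (auto simp: u_def v_def)
  moreover have "(\<Sum>i<S. u i) + (\<Sum>i<S. v i) = int (min S s)"
    by (induction S) (auto simp: u_def v_def)
  ultimately show ?thesis
    unfolding has_potentials_def order_ge_def by (intro conjI exI[of _ u] exI[of _ v]) auto
qed

text \<open>The potential -1 on every row only records that each entry has degree at most 1 in X;
  this serves the blocks of finite eigenvalues in the weights for infinity.\<close>

lemma potentials_linear_block:
  assumes "-1 \<le> U" "0 \<le> V"
  shows "has_potentials (order_ge (- 1)) U V (matrix_pencil S [A, B]) (- int S)"
  unfolding has_potentials_def order_ge_def using assms
  by (intro conjI exI[of _ "\<lambda>_. -1"] exI[of _ "\<lambda>_. 0"]) (auto simp: coeff_Poly2 simp del: Poly.simps coeff_Poly_eq split: if_splits)

lemma potentials_trivial: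
  assumes "0 \<le> U" "0 \<le> V"
  shows "has_potentials (order_ge 1) U V (matrix_pencil S Bs) 0"
  unfolding has_potentials_def order_ge_def using assms
  by (intro conjI exI[of _ "\<lambda>_. 0"]) auto

section \<open>Lower bounds valid for every perturbation\<close>

lemma list_all2_map_map_same:
  "(\<And>x. x \<in> set xs \<Longrightarrow> R (f x) (g x)) \<Longrightarrow> list_all2 R (map f xs) (map g xs)"
  by (auto simp: list_all2_conv_all_nth)

text \<open>Blocks of finite eigenvalues contribute their full size, blocks at infinity only the
  truncated excess of their size over \<open>s\<close>. The caps s - 1 and 0 add up to the weight (s
  + 1) - 2 of \<epsilon> X^2.\<close>

lemma weight_ge_inf:
  assumes "weierstrass_blocks fs s0 sinf \<in> carrier_mat n n" "n = (\<Sum>(s, a)\<leftarrow>fs. s) + sum_list s0 + sum_list sinf"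
  shows "weight_ge (int s + 1) (- 1) (det (perturbed (weierstrass_blocks fs s0 sinf) M))
    (- int (n - sum_list sinf) - int (\<Sum>S\<leftarrow>sinf. S - s))"
proof -
  define ws where "ws = map (\<lambda>(S, a). - int S) fs @ map (\<lambda>S. - int S) s0 @ map (\<lambda>S. - int (S - s)) sinf"
  have "has_potentials (order_ge (- 1)) (int s - 1) 0
     (weierstrass_blocks fs s0 sinf) (sum_list ws)"
    unfolding ws_def
    by (intro has_potentials_diag_block_mat list_all2_appendI list_all2_map_map_same)
      (auto intro!: potentials_linear_block potentials_inf_block order_ge_0)
  moreover have "sum_list ws = - int (n - sum_list sinf) - int (\<Sum>S\<leftarrow>sinf. S - s)"
  proof -
    have "(\<Sum>(S, a)\<leftarrow>fs. - int S) = - int (\<Sum>(s, a)\<leftarrow>fs. s)" by (induction fs) auto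
    moreover have "(\<Sum>S\<leftarrow>s0. - int S) = - int (sum_list s0)" by (induction s0) auto
    moreover have "(\<Sum>S\<leftarrow>sinf. - int (S - s)) = - int (\<Sum>S\<leftarrow>sinf. S - s)" by (induction sinf) auto
    ultimately show ?thesis
      unfolding ws_def assms(2) by simp
  qed
  ultimately show ?thesis
    using assms(1) by (intro weight_ge_det_perturbed) auto
qed

text \<open>The caps s - 1 and 1 add up to the weight (s - 2) + 2 of \<epsilon> X^2. In the boundary
  case s = 2 the parameter has weight 0, and the bound is a divisibility by a power of X.\<close>

lemma weight_ge_zero:
  assumes "weierstrass_blocks fs s0 sinf \<in> carrier_mat n n" "s \<ge> 2"
  shows "weight_ge (int s - 2) 1 (det (perturbed (weierstrass_blocks fs s0 sinf) M)) (int (\<Sum>S\<leftarrow>s0. min S s))"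
proof -
  define ws where "ws = map (\<lambda>_. 0) fs @ map (\<lambda>S. int (min S s)) s0 @ map (\<lambda>_. 0) sinf"
  have "has_potentials (order_ge 1) (int s - 1) 1
     (weierstrass_blocks fs s0 sinf) (sum_list ws)"
    unfolding ws_def using assms(2)
    by (intro has_potentials_diag_block_mat list_all2_appendI list_all2_map_map_same)
      (auto intro!: potentials_trivial potentials_zero_block order_ge_0)
  moreover have "sum_list ws = int (\<Sum>S\<leftarrow>s0. min S s)"
  proof -
    have "(\<Sum>S\<leftarrow>s0. int (min S s)) = int (\<Sum>S\<leftarrow>s0. min S s)" by (induction s0) auto
    then show ?thesis
      unfolding ws_def by (simp add: sum_list_triv)
  qed
  ultimately show ?thesis
    using assms(1) by (intro weight_ge_det_perturbed) auto
qed

section \<open>Explicit perturbations with known vertices\<close>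

lemma perturbed_diag_block_mat:
  assumes "list_all2 (\<lambda>D M. square_mat D \<and> square_mat M \<and> dim_row D = dim_row M) Ds Ms"
  shows "perturbed (diag_block_mat Ds) (diag_block_mat Ms) = diag_block_mat (map2 perturbed Ds Ms)"
  using assms
proof (induction rule: list_all2_induct)
  case Nil
  then show ?case
    by (auto simp: perturbed_def)
next
  case (Cons D Ds M Ms)
  have "square_mat (diag_block_mat Ds)" "square_mat (diag_block_mat Ms)"
    by (rule diag_block_mat_square; use Cons in \<open>force simp: list_all2_conv_all_nth in_set_conv_nth\<close>)+
  moreover have "map dim_row Ds = map dim_row Ms"
    using Cons(2) by (auto simp: list_all2_conv_all_nth intro!: nth_equalityI)
  then have "dim_row (diag_block_mat Ds) = dim_row (diag_block_mat Ms)"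
    by (simp add: dim_diag_block_mat)
  ultimately show ?case
    using Cons(1) by (simp add: Let_def flip: Cons.IH) (intro eq_matI; force simp: perturbed_def)
qed

lemma det_perturbed_diag_block_mat:
  assumes "list_all2 (\<lambda>D M. square_mat D \<and> square_mat M \<and> dim_row D = dim_row M) Ds Ms"
  shows "det (perturbed (diag_block_mat Ds) (diag_block_mat Ms)) = (\<Prod>(D, M)\<leftarrow>zip Ds Ms. det (perturbed D M))"
  unfolding perturbed_diag_block_mat[OF assms]
  by (subst det_diag_block_mat) (auto simp: perturbed_def o_def case_prod_unfold)

text \<open>The entry that closes the superdiagonal chain to a cycle of length \<open>S\<close>, so
  that the determinant of a perturbed block becomes a binomial.\<close>

definition corner :: "nat \<Rightarrow> complex mat" where
  "corner S = mat S S (\<lambda>(i, j). if Suc i = S \<and> j = 0 then 1 else 0)"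

lemma lift_X_Poly2: "lift_X (Poly [x, y]) = monom (monom x 0) 0 + monom (monom y 0) 1"
  by (intro poly_eqI) (auto simp: coeff2_lift_X coeff_Poly2 simp del: Poly.simps coeff_Poly_eq)

lemma monom_minus_1_power_mult:
  "(- 1) ^ i * (monom (monom 1 a) b :: complex poly poly) = monom (monom ((- 1) ^ i) a) b"
  by (cases "even i") (simp_all add: minus_monom)

lemma det_zero_block_corner:
  assumes "S > 0"
  shows "det (perturbed (zero_block S) (corner S)) = monom (monom 1 0) S + monom (monom ((- 1) ^ (S - 1)) 1) 2"
proof -
  have "perturbed (zero_block S) (corner S) = mat S S (\<lambda>(i, j).
      (if i = j then monom (monom 1 0) 1 else if Suc i = j then 1 else 0) +
      (if Suc i = S \<and> j = 0 then monom (monom 1 1) 2 else 0))"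
    unfolding perturbed_def
    by (intro eq_matI) (auto simp: corner_def lift_X_Poly2 monom_0 simp del: Poly.simps coeff_Poly_eq)
  also have "det \<dots> = monom (monom 1 0) 1 ^ S + (- 1) ^ (S - 1) * monom (monom 1 1) 2 * 1 ^ (S - 1)"
    using assms by (rule det_cyclic_bidiagonal)
  also have "\<dots> = monom (monom 1 0) S + monom (monom ((- 1) ^ (S - 1)) 1) 2"
    by (simp add: monom_power monom_minus_1_power_mult)
  finally show ?thesis .
qed

lemma det_inf_block_corner:
  assumes "S > 0"
  shows "det (perturbed (inf_block S) (corner S)) = monom (monom 1 0) 0 + monom (monom ((- 1) ^ (S - 1)) 1) (S + 1)"
proof -
  have "perturbed (inf_block S) (corner S) = mat S S (\<lambda>(i, j).
      (if i = j then 1 else if Suc i = j then monom (monom 1 0) 1 else 0) +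
      (if Suc i = S \<and> j = 0 then monom (monom 1 1) 2 else 0))"
    unfolding perturbed_def
    by (intro eq_matI) (auto simp: corner_def lift_X_Poly2 monom_0 simp del: Poly.simps coeff_Poly_eq)
  also have "det \<dots> = 1 ^ S + (- 1) ^ (S - 1) * monom (monom 1 1) 2 * monom (monom 1 0) 1 ^ (S - 1)"
    using assms by (rule det_cyclic_bidiagonal)
  also have "monom (monom (1::complex) 0) 1 ^ (S - 1) = monom (monom 1 0) (S - 1)"
    unfolding monom_power by (simp add: monom_0 flip: one_pCons)
  also have "(- 1) ^ (S - 1) * monom (monom 1 1) 2 * monom (monom 1 0) (S - 1) =
      (monom (monom ((- 1) ^ (S - 1)) 1) (S + 1) :: complex poly poly)"
    unfolding monom_minus_1_power_mult mult_monom using assms by simp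
  also have "1 ^ S = (monom (monom 1 0) 0 :: complex poly poly)"
    by (simp add: monom_0 flip: one_pCons)
  finally show ?thesis .
qed

lemma det_perturbed_upper_triangular:
  assumes "\<And>i j. j < i \<Longrightarrow> i < S \<Longrightarrow> D $$ (i, j) = 0 \<and> M $$ (i, j) = 0"
    "\<And>i. i < S \<Longrightarrow> D $$ (i, i) = d \<and> M $$ (i, i) = e" "D \<in> carrier_mat S S"
  shows "det (perturbed D M) = (lift_X d + monom (monom e 1) 2) ^ S"
proof -
  have "det (perturbed D M) = prod_list (diag_mat (perturbed D M))"
    using assms by (intro det_upper_triangular[where n = S])
      (auto simp: perturbed_def intro!: upper_triangularI)
  also have "\<dots> = (\<Prod>i<S. lift_X d + monom (monom e 1) 2)"
    unfolding prod_list_diag_prod using assms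
    by (intro prod.cong) (auto simp: perturbed_def smult_monom)
  finally show ?thesis
    by simp
qed

lemma zip_map_map_same: "zip (map f xs) (map g xs) = map (\<lambda>x. (f x, g x)) xs"
  by (induction xs) auto

lemma det_weierstrass_corner:
  fixes fs :: "(nat \<times> complex) list"
  assumes pos: "\<forall>s\<in>set s0. s > 0" "\<forall>s\<in>set sinf. s > 0"
  defines "M \<equiv> diag_block_mat (map (\<lambda>(s, a). 0\<^sub>m s s) fs @ map corner s0 @ map corner sinf)"
  shows "det (perturbed (weierstrass_blocks fs s0 sinf) M) =
     (\<Prod>(S, a)\<leftarrow>fs. (monom (monom (- a) 0) 0 + monom (monom 1 0) 1) ^ S) *
     ((\<Prod>S\<leftarrow>s0. monom (monom 1 0) S + monom (monom ((- 1) ^ (S - 1)) 1) 2) *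
      (\<Prod>S\<leftarrow>sinf. monom (monom 1 0) 0 + monom (monom ((- 1) ^ (S - 1)) 1) (S + 1)))"
    and "dim_row M = (\<Sum>(s, a)\<leftarrow>fs. s) + sum_list s0 + sum_list sinf" "square_mat M"
proof -
  have fin: "det (perturbed (fin_block sa) ((\<lambda>(s, a). 0\<^sub>m s s) sa)) =
      (\<lambda>(S, a). (monom (monom (- a) 0) 0 + monom (monom 1 0) 1) ^ S) sa" for sa :: "nat \<times> complex"
  proof -
    obtain s a where sa: "sa = (s, a)" by (cases sa)
    have "det (perturbed (matrix_pencil s [- jordan_block s a, 1\<^sub>m s]) (0\<^sub>m s s)) =
        (lift_X (Poly [- a, 1]) + monom (monom 0 1) 2) ^ s"
      by (rule det_perturbed_upper_triangular) auto
    then show ?thesis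
      by (simp add: sa lift_X_Poly2 del: Poly.simps)
  qed
  have "det (perturbed (weierstrass_blocks fs s0 sinf) M) =
    (\<Prod>(D, M)\<leftarrow>zip (map fin_block fs @ map zero_block s0 @ map inf_block sinf)
       (map (\<lambda>(s, a). 0\<^sub>m s s) fs @ map corner s0 @ map corner sinf). det (perturbed D M))"
    unfolding M_def
    by (intro det_perturbed_diag_block_mat list_all2_appendI list_all2_map_map_same) (auto simp: corner_def)
  also have "\<dots> = (\<Prod>sa\<leftarrow>fs. det (perturbed (fin_block sa) ((\<lambda>(s, a). 0\<^sub>m s s) sa))) *
     ((\<Prod>S\<leftarrow>s0. det (perturbed (zero_block S) (corner S))) * (\<Prod>S\<leftarrow>sinf. det (perturbed (inf_block S) (corner S))))"
    by (simp add: zip_map_map_same o_def)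
  finally show "det (perturbed (weierstrass_blocks fs s0 sinf) M) =
     (\<Prod>(S, a)\<leftarrow>fs. (monom (monom (- a) 0) 0 + monom (monom 1 0) 1) ^ S) *
     ((\<Prod>S\<leftarrow>s0. monom (monom 1 0) S + monom (monom ((- 1) ^ (S - 1)) 1) 2) *
      (\<Prod>S\<leftarrow>sinf. monom (monom 1 0) 0 + monom (monom ((- 1) ^ (S - 1)) 1) (S + 1)))"
    using pos unfolding fin by (simp add: det_zero_block_corner det_inf_block_corner cong: map_cong)
  show "dim_row M = (\<Sum>(s, a)\<leftarrow>fs. s) + sum_list s0 + sum_list sinf"
    by (simp add: M_def dim_diag_block_mat case_prod_unfold o_def corner_def)
  show "square_mat M"
    unfolding M_def by (rule diag_block_mat_square) (auto simp: corner_def)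
qed

text \<open>The vertex (n, 2 n) has coefficient det M and so requires an invertible perturbation,
  which corner entries do not provide in general. The identity keeps all blocks upper
  triangular.\<close>

lemma det_weierstrass_one:
  fixes fs :: "(nat \<times> complex) list"
  assumes n: "n = (\<Sum>(s, a)\<leftarrow>fs. s) + sum_list s0 + sum_list sinf"
  shows "det (perturbed (weierstrass_blocks fs s0 sinf) (1\<^sub>m n)) =
     (\<Prod>(S, a)\<leftarrow>fs. (monom (monom (- a) 0) 0 + monom (monom 1 0) 1 + monom (monom 1 1) 2) ^ S) *
     ((\<Prod>S\<leftarrow>s0. (monom (monom 1 0) 1 + monom (monom 1 1) 2) ^ S) *
      (\<Prod>S\<leftarrow>sinf. (monom (monom 1 0) 0 + monom (monom 1 1) 2) ^ S))"
proof -
  have fin: "det (perturbed (fin_block sa) ((\<lambda>(s, a). 1\<^sub>m s) sa)) =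
      (\<lambda>(S, a). (lift_X (Poly [- a, 1]) + monom (monom 1 1) 2) ^ S) sa" for sa :: "nat \<times> complex"
  proof -
    obtain s a where sa: "sa = (s, a)" by (cases sa)
    have "det (perturbed (matrix_pencil s [- jordan_block s a, 1\<^sub>m s]) (1\<^sub>m s)) =
        (lift_X (Poly [- a, 1]) + monom (monom 1 1) 2) ^ s"
      by (rule det_perturbed_upper_triangular) auto
    then show ?thesis
      by (simp only: sa prod.case)
  qed
  have zero: "det (perturbed (zero_block S) (1\<^sub>m S)) = (lift_X (Poly [0, 1]) + monom (monom 1 1) 2) ^ S" for S
    by (rule det_perturbed_upper_triangular) auto
  have inf: "det (perturbed (inf_block S) (1\<^sub>m S)) = (lift_X (Poly [1, 0]) + monom (monom 1 1) 2) ^ S" for S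
    by (rule det_perturbed_upper_triangular) auto
  define Ms :: "complex mat list" where "Ms = map (\<lambda>(s, a). 1\<^sub>m s) fs @ map 1\<^sub>m s0 @ map 1\<^sub>m sinf"
  have "diag_block_mat (map (\<lambda>A. 1\<^sub>m (dim_row A)) Ms) = (1\<^sub>m (sum_list (map dim_row Ms)) :: complex mat)"
    by (rule diag_block_one_mat)
  moreover have "map (\<lambda>A. 1\<^sub>m (dim_row A)) Ms = Ms" "sum_list (map dim_row Ms) = n"
    by (auto simp: Ms_def n case_prod_unfold o_def)
  ultimately have one: "(1\<^sub>m n :: complex mat) = diag_block_mat Ms"
    by simp
  have "det (perturbed (weierstrass_blocks fs s0 sinf) (1\<^sub>m n)) =
    (\<Prod>(D, M)\<leftarrow>zip (map fin_block fs @ map zero_block s0 @ map inf_block sinf) Ms. det (perturbed D M))"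
    unfolding one Ms_def
    by (intro det_perturbed_diag_block_mat list_all2_appendI list_all2_map_map_same) auto
  also have "\<dots> = (\<Prod>sa\<leftarrow>fs. det (perturbed (fin_block sa) ((\<lambda>(s, a). 1\<^sub>m s) sa))) *
     ((\<Prod>S\<leftarrow>s0. det (perturbed (zero_block S) (1\<^sub>m S))) * (\<Prod>S\<leftarrow>sinf. det (perturbed (inf_block S) (1\<^sub>m S))))"
    by (simp add: Ms_def zip_map_map_same o_def)
  finally show ?thesis
    unfolding fin zero inf by (simp add: lift_X_Poly2 del: Poly.simps)
qed

lemma strict_lead_binomial:
  assumes "x \<noteq> 0" "\<alpha> * int a + \<beta> * int b < \<alpha> * int a' + \<beta> * int b'"
  shows "strict_lead \<alpha> \<beta> (monom (monom x a) b + monom (monom (y::complex) a') b') a b"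
    and "strict_lead \<alpha> \<beta> (monom (monom y a') b' + monom (monom x a) b) a b"
proof -
  show "strict_lead \<alpha> \<beta> (monom (monom x a) b + monom (monom y a') b') a b"
    using assms by (intro strict_lead_add strict_lead_monom weight_ge_monom) auto
  then show "strict_lead \<alpha> \<beta> (monom (monom y a') b' + monom (monom x a) b) a b"
    by (simp only: add.commute)
qed

lemma sum_list_of_bool: "(\<Sum>x\<leftarrow>xs. if P x then 1 else 0) = length (filter P xs)"
  by (induction xs) auto

text \<open>The weight (2 s + 3, -2) is twice the mean of (s + 1, -1) and (s + 2, -1), the weights
  of the two edges that meet at this vertex. It gives \<epsilon> X^(S+1) the odd value 2 (s - S) +
  1, so there is never a tie with 1, and this monomial leads exactly for S > s. The other factors
  lead with their highest power of X free of \<epsilon>.\<close>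

lemma strict_lead_corner_inf:
  fixes fs :: "(nat \<times> complex) list"
  assumes pos: "\<forall>s\<in>set s0. s > 0"
  shows "strict_lead (2 * int s + 3) (- 2)
    ((\<Prod>(S, a)\<leftarrow>fs. (monom (monom (- a) 0) 0 + monom (monom 1 0) 1) ^ S) *
     ((\<Prod>S\<leftarrow>s0. monom (monom (1::complex) 0) S + monom (monom ((- 1) ^ (S - 1)) 1) 2) *
      (\<Prod>S\<leftarrow>sinf. monom (monom (1::complex) 0) 0 + monom (monom ((- 1) ^ (S - 1)) 1) (S + 1))))
    (length (filter (\<lambda>S. S > s) sinf))
    ((\<Sum>(S, a)\<leftarrow>fs. S) + (sum_list s0 + (\<Sum>S\<leftarrow>sinf. if S > s then S + 1 else 0)))"
proof -
  let ?\<alpha> = "2 * int s + 3" and ?\<beta> = "- 2 :: int"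
  have "strict_lead ?\<alpha> ?\<beta> (\<Prod>x\<leftarrow>fs. (\<lambda>(S, a). (monom (monom (- a) 0) 0 + monom (monom 1 0) 1) ^ S) x)
      (\<Sum>x\<leftarrow>fs. 0) (\<Sum>x\<leftarrow>fs. (\<lambda>(S, a). S) x)"
  proof (intro strict_lead_prod_list)
    fix x :: "nat \<times> complex"
    obtain S a where x: "x = (S, a)" by (cases x)
    have "strict_lead ?\<alpha> ?\<beta> ((monom (monom (- a) 0) 0 + monom (monom 1 0) 1) ^ S) (S * 0) (S * 1)"
      by (intro strict_lead_power strict_lead_binomial(2)) auto
    then show "strict_lead ?\<alpha> ?\<beta> ((\<lambda>(S, a). (monom (monom (- a) 0) 0 + monom (monom 1 0) 1) ^ S) x) 0 ((\<lambda>(S, a). S) x)"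
      by (simp add: x)
  qed
  moreover have "strict_lead ?\<alpha> ?\<beta> (\<Prod>S\<leftarrow>s0. monom (monom (1::complex) 0) S + monom (monom ((- 1) ^ (S - 1)) 1) 2)
      (\<Sum>S\<leftarrow>s0. 0) (\<Sum>S\<leftarrow>s0. S)"
    using pos by (intro strict_lead_prod_list strict_lead_binomial(1)) auto
  moreover have "strict_lead ?\<alpha> ?\<beta> (\<Prod>S\<leftarrow>sinf. monom (monom (1::complex) 0) 0 + monom (monom ((- 1) ^ (S - 1)) 1) (S + 1))
      (\<Sum>S\<leftarrow>sinf. if S > s then 1 else 0) (\<Sum>S\<leftarrow>sinf. if S > s then S + 1 else 0)"
  proof (intro strict_lead_prod_list)
    fix S
    show "strict_lead ?\<alpha> ?\<beta> (monom (monom (1::complex) 0) 0 + monom (monom ((- 1) ^ (S - 1)) 1) (S + 1))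
        (if S > s then 1 else 0) (if S > s then S + 1 else 0)"
      by (cases "S > s"; simp only: if_True if_False;
        rule strict_lead_binomial(2) strict_lead_binomial(1)) auto
  qed
  ultimately have "strict_lead ?\<alpha> ?\<beta>
    ((\<Prod>(S, a)\<leftarrow>fs. (monom (monom (- a) 0) 0 + monom (monom 1 0) 1) ^ S) *
     ((\<Prod>S\<leftarrow>s0. monom (monom (1::complex) 0) S + monom (monom ((- 1) ^ (S - 1)) 1) 2) *
      (\<Prod>S\<leftarrow>sinf. monom (monom (1::complex) 0) 0 + monom (monom ((- 1) ^ (S - 1)) 1) (S + 1))))
    ((\<Sum>x\<leftarrow>fs. 0) + ((\<Sum>S\<leftarrow>s0. 0) + (\<Sum>S\<leftarrow>sinf. if S > s then 1 else 0)))
    ((\<Sum>(S, a)\<leftarrow>fs. S) + ((\<Sum>S\<leftarrow>s0. S) + (\<Sum>S\<leftarrow>sinf. if S > s then S + 1 else 0)))"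
    by (intro strict_lead_mult)
  then show ?thesis
    by (simp add: sum_list_of_bool sum_list_triv)
qed

text \<open>The weight (2 s - 3, 2) is twice the mean of (s - 2, 1) and (s - 1, 1). It gives X^S and
  \<epsilon> X^2 the values 2 S and 2 s + 1, so the latter leads exactly for S > s. The other
  factors lead with their constant terms, which is where a \<noteq> 0 enters.\<close>

lemma strict_lead_corner_zero:
  fixes fs :: "(nat \<times> complex) list"
  assumes "s \<ge> 2" and nz: "\<forall>(S, a)\<in>set fs. a \<noteq> 0"
  shows "strict_lead (2 * int s - 3) 2
    ((\<Prod>(S, a)\<leftarrow>fs. (monom (monom (- a) 0) 0 + monom (monom 1 0) 1) ^ S) *
     ((\<Prod>S\<leftarrow>s0. monom (monom (1::complex) 0) S + monom (monom ((- 1) ^ (S - 1)) 1) 2) *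
      (\<Prod>S\<leftarrow>sinf. monom (monom (1::complex) 0) 0 + monom (monom ((- 1) ^ (S - 1)) 1) (S + 1))))
    (length (filter (\<lambda>S. S > s) s0)) (\<Sum>S\<leftarrow>s0. if S > s then 2 else S)"
proof -
  let ?\<alpha> = "2 * int s - 3" and ?\<beta> = "2 :: int"
  have "strict_lead ?\<alpha> ?\<beta> (\<Prod>x\<leftarrow>fs. (\<lambda>(S, a). (monom (monom (- a) 0) 0 + monom (monom 1 0) 1) ^ S) x)
      (\<Sum>x\<leftarrow>fs. 0) (\<Sum>x\<leftarrow>fs. 0)"
  proof (intro strict_lead_prod_list)
    fix x assume "x \<in> set fs"
    obtain S a where x: "x = (S, a)" by (cases x)
    then have "a \<noteq> 0"
      using nz \<open>x \<in> set fs\<close> by auto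
    then have "strict_lead ?\<alpha> ?\<beta> ((monom (monom (- a) 0) 0 + monom (monom 1 0) 1) ^ S) (S * 0) (S * 0)"
      by (intro strict_lead_power strict_lead_binomial(1)) auto
    then show "strict_lead ?\<alpha> ?\<beta> ((\<lambda>(S, a). (monom (monom (- a) 0) 0 + monom (monom 1 0) 1) ^ S) x) 0 0"
      by (simp add: x)
  qed
  moreover have "strict_lead ?\<alpha> ?\<beta> (\<Prod>S\<leftarrow>s0. monom (monom (1::complex) 0) S + monom (monom ((- 1) ^ (S - 1)) 1) 2)
      (\<Sum>S\<leftarrow>s0. if S > s then 1 else 0) (\<Sum>S\<leftarrow>s0. if S > s then 2 else S)"
  proof (intro strict_lead_prod_list)
    fix S
    show "strict_lead ?\<alpha> ?\<beta> (monom (monom (1::complex) 0) S + monom (monom ((- 1) ^ (S - 1)) 1) 2)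
        (if S > s then 1 else 0) (if S > s then 2 else S)"
      by (cases "S > s"; simp only: if_True if_False;
        rule strict_lead_binomial(2) strict_lead_binomial(1)) auto
  qed
  moreover have "strict_lead ?\<alpha> ?\<beta> (\<Prod>S\<leftarrow>sinf. monom (monom (1::complex) 0) 0 + monom (monom ((- 1) ^ (S - 1)) 1) (S + 1))
      (\<Sum>S\<leftarrow>sinf. 0) (\<Sum>S\<leftarrow>sinf. 0)"
    using \<open>s \<ge> 2\<close> by (intro strict_lead_prod_list strict_lead_binomial(1)) auto
  ultimately have "strict_lead ?\<alpha> ?\<beta>
    ((\<Prod>(S, a)\<leftarrow>fs. (monom (monom (- a) 0) 0 + monom (monom 1 0) 1) ^ S) *
     ((\<Prod>S\<leftarrow>s0. monom (monom (1::complex) 0) S + monom (monom ((- 1) ^ (S - 1)) 1) 2) *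
      (\<Prod>S\<leftarrow>sinf. monom (monom (1::complex) 0) 0 + monom (monom ((- 1) ^ (S - 1)) 1) (S + 1))))
    ((\<Sum>x\<leftarrow>fs. 0) + ((\<Sum>S\<leftarrow>s0. if S > s then 1 else 0) + (\<Sum>S\<leftarrow>sinf. 0)))
    ((\<Sum>x\<leftarrow>fs. 0) + ((\<Sum>S\<leftarrow>s0. if S > s then 2 else S) + (\<Sum>S\<leftarrow>sinf. 0)))"
    by (intro strict_lead_mult)
  then show ?thesis
    by (simp add: sum_list_of_bool sum_list_triv)
qed

text \<open>Under the weight (-3, 1) the monomials 1, X and \<epsilon> X^2 have the values 0, 1 and
  -1, so \<epsilon> X^2 leads in every factor.\<close>

lemma strict_lead_one:
  fixes fs :: "(nat \<times> complex) list"
  shows "strict_lead (- 3) 1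
    ((\<Prod>(S, a)\<leftarrow>fs. (monom (monom (- a) 0) 0 + monom (monom 1 0) 1 + monom (monom 1 1) 2) ^ S) *
     ((\<Prod>S\<leftarrow>s0. (monom (monom (1::complex) 0) 1 + monom (monom 1 1) 2) ^ S) *
      (\<Prod>S\<leftarrow>sinf. (monom (monom (1::complex) 0) 0 + monom (monom 1 1) 2) ^ S)))
    ((\<Sum>(S, a)\<leftarrow>fs. S) + (sum_list s0 + sum_list sinf))
    (2 * ((\<Sum>(S, a)\<leftarrow>fs. S) + (sum_list s0 + sum_list sinf)))"
proof -
  let ?\<alpha> = "- 3 :: int" and ?\<beta> = "1 :: int"
  have "strict_lead ?\<alpha> ?\<beta> (\<Prod>x\<leftarrow>fs. (\<lambda>(S, a). (monom (monom (- a) 0) 0 + monom (monom 1 0) 1 + monom (monom 1 1) 2) ^ S) x)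
      (\<Sum>x\<leftarrow>fs. fst x) (\<Sum>x\<leftarrow>fs. 2 * fst x)"
  proof (intro strict_lead_prod_list)
    fix x :: "nat \<times> complex"
    obtain S a where x: "x = (S, a)" by (cases x)
    have "strict_lead ?\<alpha> ?\<beta> (monom (monom 1 1) 2 + (monom (monom (- a) 0) 0 + monom (monom 1 0) 1)) 1 2"
      by (intro strict_lead_add strict_lead_monom weight_ge_add weight_ge_monom) auto
    then have "strict_lead ?\<alpha> ?\<beta> (monom (monom (- a) 0) 0 + monom (monom 1 0) 1 + monom (monom 1 1) 2) 1 2"
      by (simp only: add_ac)
    from strict_lead_power[OF this, of S]
    show "strict_lead ?\<alpha> ?\<beta> ((\<lambda>(S, a). (monom (monom (- a) 0) 0 + monom (monom 1 0) 1 + monom (monom 1 1) 2) ^ S) x)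
        (fst x) (2 * fst x)"
      by (simp add: x mult.commute)
  qed
  moreover have "strict_lead ?\<alpha> ?\<beta> (\<Prod>S\<leftarrow>s0. (monom (monom (1::complex) 0) 1 + monom (monom 1 1) 2) ^ S)
      (\<Sum>S\<leftarrow>s0. S * 1) (\<Sum>S\<leftarrow>s0. S * 2)"
    by (intro strict_lead_prod_list strict_lead_power strict_lead_binomial(2)) auto
  moreover have "strict_lead ?\<alpha> ?\<beta> (\<Prod>S\<leftarrow>sinf. (monom (monom (1::complex) 0) 0 + monom (monom 1 1) 2) ^ S)
      (\<Sum>S\<leftarrow>sinf. S * 1) (\<Sum>S\<leftarrow>sinf. S * 2)"
    by (intro strict_lead_prod_list strict_lead_power strict_lead_binomial(2)) auto
  ultimately have "strict_lead ?\<alpha> ?\<beta>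
    ((\<Prod>(S, a)\<leftarrow>fs. (monom (monom (- a) 0) 0 + monom (monom 1 0) 1 + monom (monom 1 1) 2) ^ S) *
     ((\<Prod>S\<leftarrow>s0. (monom (monom (1::complex) 0) 1 + monom (monom 1 1) 2) ^ S) *
      (\<Prod>S\<leftarrow>sinf. (monom (monom (1::complex) 0) 0 + monom (monom 1 1) 2) ^ S)))
    ((\<Sum>x\<leftarrow>fs. fst x) + ((\<Sum>S\<leftarrow>s0. S * 1) + (\<Sum>S\<leftarrow>sinf. S * 1)))
    ((\<Sum>x\<leftarrow>fs. 2 * fst x) + ((\<Sum>S\<leftarrow>s0. S * 2) + (\<Sum>S\<leftarrow>sinf. S * 2)))"
    by (intro strict_lead_mult)
  then show ?thesis
    by (simp add: case_prod_unfold sum_list_const_mult sum_list_mult_const algebra_simps)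
qed

section \<open>Generic matrices\<close>

text \<open>A semantic notion of polynomial in the entries, suited to closure under determinants.
  The formal polynomial required by \<open>generically\<close> is derived from it once, after all
  conditions have been combined.\<close>

inductive entry_polynomial :: "nat \<Rightarrow> (complex mat \<Rightarrow> complex) \<Rightarrow> bool" for n where
  const: "entry_polynomial n (\<lambda>_. c)"
| entry: "i < n \<Longrightarrow> j < n \<Longrightarrow> entry_polynomial n (\<lambda>m. m $$ (i, j))"
| add: "entry_polynomial n f \<Longrightarrow> entry_polynomial n g \<Longrightarrow> entry_polynomial n (\<lambda>m. f m + g m)"
| mult: "entry_polynomial n f \<Longrightarrow> entry_polynomial n g \<Longrightarrow> entry_polynomial n (\<lambda>m. f m * g m)"

lemma entry_polynomial_sum:
  "(\<And>x. x \<in> X \<Longrightarrow> entry_polynomial n (f x)) \<Longrightarrow> entry_polynomial n (\<lambda>m. \<Sum>x\<in>X. f x m)"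
  by (induction X rule: infinite_finite_induct) (auto intro: entry_polynomial.intros)

definition monomial_eval :: "((nat \<times> nat) \<Rightarrow>\<^sub>0 nat) \<Rightarrow> complex mat \<Rightarrow> complex" where
  "monomial_eval u m = (\<Prod>ij\<in>Poly_Mapping.keys u. (m $$ ij) ^ Poly_Mapping.lookup u ij)"

lemma monomial_eval_superset:
  assumes "finite K" "Poly_Mapping.keys u \<subseteq> K"
  shows "monomial_eval u m = (\<Prod>ij\<in>K. (m $$ ij) ^ Poly_Mapping.lookup u ij)"
  unfolding monomial_eval_def using assms
  by (intro prod.mono_neutral_left) (auto simp: in_keys_iff)

lemma monomial_eval_plus: "monomial_eval (u + v) m = monomial_eval u m * monomial_eval v m"
proof -
  let ?K = "Poly_Mapping.keys u \<union> Poly_Mapping.keys v"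
  have "monomial_eval (u + v) m = (\<Prod>ij\<in>?K. (m $$ ij) ^ Poly_Mapping.lookup (u + v) ij)"
    by (rule monomial_eval_superset) (auto simp: Poly_Mapping.keys_add)
  also have "\<dots> = (\<Prod>ij\<in>?K. (m $$ ij) ^ Poly_Mapping.lookup u ij) * (\<Prod>ij\<in>?K. (m $$ ij) ^ Poly_Mapping.lookup v ij)"
    by (simp add: lookup_add power_add prod.distrib)
  also have "\<dots> = monomial_eval u m * monomial_eval v m"
    by (simp add: monomial_eval_superset[of ?K])
  finally show ?thesis .
qed

text \<open>A common superset of the supports makes evaluations comparable term by term, even when
  terms cancel in a sum.\<close>

lemma entry_poly_eval_superset:
  assumes "finite K" "Poly_Mapping.keys p \<subseteq> K"
  shows "entry_poly_eval p m = (\<Sum>u\<in>K. Poly_Mapping.lookup p u * monomial_eval u m)"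
  unfolding entry_poly_eval_def monomial_eval_def using assms
  by (intro sum.mono_neutral_left) (auto simp: in_keys_iff)

lemma entry_poly_eval_add: "entry_poly_eval (p + q) m = entry_poly_eval p m + entry_poly_eval q m"
proof -
  let ?K = "Poly_Mapping.keys p \<union> Poly_Mapping.keys q"
  have "entry_poly_eval (p + q) m = (\<Sum>u\<in>?K. Poly_Mapping.lookup (p + q) u * monomial_eval u m)"
    by (rule entry_poly_eval_superset) (auto simp: Poly_Mapping.keys_add)
  also have "\<dots> = (\<Sum>u\<in>?K. Poly_Mapping.lookup p u * monomial_eval u m) + (\<Sum>u\<in>?K. Poly_Mapping.lookup q u * monomial_eval u m)"
    by (simp add: lookup_add distrib_right sum.distrib)
  also have "\<dots> = entry_poly_eval p m + entry_poly_eval q m"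
    by (simp add: entry_poly_eval_superset[of ?K])
  finally show ?thesis .
qed

lemma entry_poly_eval_sum: "entry_poly_eval (\<Sum>x\<in>X. p x) m = (\<Sum>x\<in>X. entry_poly_eval (p x) m)"
  by (induction X rule: infinite_finite_induct) (auto simp: entry_poly_eval_add, auto simp: entry_poly_eval_def)

lemma entry_poly_eval_single: "entry_poly_eval (Poly_Mapping.single u c) m = c * monomial_eval u m"
  by (subst entry_poly_eval_superset[of "{u}"]) auto

definition entries_below :: "nat \<Rightarrow> (((nat \<times> nat) \<Rightarrow>\<^sub>0 nat) \<Rightarrow>\<^sub>0 complex) \<Rightarrow> bool" where
  "entries_below n p \<longleftrightarrow> (\<forall>u\<in>Poly_Mapping.keys p. Poly_Mapping.keys u \<subseteq> {..<n} \<times> {..<n})"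

lemma entries_below_add: "entries_below n p \<Longrightarrow> entries_below n q \<Longrightarrow> entries_below n (p + q)"
  using Poly_Mapping.keys_add[of p q] unfolding entries_below_def by blast

lemma entries_below_sum: "(\<And>x. x \<in> X \<Longrightarrow> entries_below n (p x)) \<Longrightarrow> entries_below n (\<Sum>x\<in>X. p x)"
  by (induction X rule: infinite_finite_induct) (auto intro: entries_below_add, auto simp: entries_below_def)

lemma entries_below_single:
  "Poly_Mapping.keys u \<subseteq> {..<n} \<times> {..<n} \<Longrightarrow> entries_below n (Poly_Mapping.single u c)"
  by (auto simp: entries_below_def split: if_splits)

lemma entry_polynomial_imp_entry_poly_eval:
  assumes "entry_polynomial n f"
  shows "\<exists>p. entries_below n p \<and> (\<forall>m. entry_poly_eval p m = f m)"
  using assms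
proof induction
  case (const c)
  show ?case
    by (intro exI[of _ "Poly_Mapping.single 0 c"])
      (auto simp: entry_poly_eval_single monomial_eval_def intro: entries_below_single)
next
  case (entry i j)
  then show ?case
    by (intro exI[of _ "Poly_Mapping.single (Poly_Mapping.single (i, j) 1) 1"])
      (auto simp: entry_poly_eval_single monomial_eval_def intro!: entries_below_single)
next
  case (add f g)
  then obtain p q where "entries_below n p" "\<And>m. entry_poly_eval p m = f m"
    "entries_below n q" "\<And>m. entry_poly_eval q m = g m"
    by blast
  then show ?case
    by (intro exI[of _ "p + q"]) (auto simp: entry_poly_eval_add intro: entries_below_add)
next
  case (mult f g)
  then obtain p q where p: "entries_below n p" "\<And>m. entry_poly_eval p m = f m"
    and q: "entries_below n q" "\<And>m. entry_poly_eval q m = g m"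
    by blast
  \<comment> \<open>The convolution product, written as a sum of single monomials so that additivity
    and the rule for monomials evaluate it.\<close>
  define r where "r = (\<Sum>u\<in>Poly_Mapping.keys p. \<Sum>v\<in>Poly_Mapping.keys q.
    Poly_Mapping.single (u + v) (Poly_Mapping.lookup p u * Poly_Mapping.lookup q v))"
  have "entries_below n r"
    unfolding r_def using p(1) q(1) Poly_Mapping.keys_add
    by (intro entries_below_sum entries_below_single) (fastforce simp: entries_below_def)
  moreover have "entry_poly_eval r m = f m * g m" for m
  proof -
    have "entry_poly_eval r m = (\<Sum>u\<in>Poly_Mapping.keys p. \<Sum>v\<in>Poly_Mapping.keys q.
        (Poly_Mapping.lookup p u * monomial_eval u m) * (Poly_Mapping.lookup q v * monomial_eval v m))"
      unfolding r_def entry_poly_eval_sum entry_poly_eval_single monomial_eval_plus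
      by (simp add: mult_ac)
    also have "\<dots> = entry_poly_eval p m * entry_poly_eval q m"
      by (simp add: sum_product entry_poly_eval_superset[of "Poly_Mapping.keys p" p]
          entry_poly_eval_superset[of "Poly_Mapping.keys q" q])
    finally show ?thesis
      using p(2) q(2) by simp
  qed
  ultimately show ?case by blast
qed

lemma entry_polynomial_on_line:
  assumes "entry_polynomial n f"
  shows "\<exists>p. \<forall>t. f (mat n n (\<lambda>ij. a $$ ij + t * b $$ ij)) = poly p t"
  using assms
proof induction
  case (const c)
  show ?case by (intro exI[of _ "[:c:]"]) simp
next
  case (entry i j)
  then show ?case by (intro exI[of _ "[:a $$ (i, j), b $$ (i, j):]"]) simp
next
  case (add f g)
  then show ?case by (metis poly_add)
next
  case (mult f g)
  then show ?case by (metis poly_mult)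
qed

text \<open>Along the line through \<open>m1\<close> and \<open>m2\<close> both functions are
  univariate polynomials, non-zero at the parameters 0 and 1 respectively. Their product is a
  non-zero polynomial and so has a non-root.\<close>

lemma entry_polynomial_mult_nonzero:
  assumes f: "entry_polynomial n f" "m1 \<in> carrier_mat n n" "f m1 \<noteq> 0"
    and g: "entry_polynomial n g" "m2 \<in> carrier_mat n n" "g m2 \<noteq> 0"
  shows "\<exists>m\<in>carrier_mat n n. f m * g m \<noteq> 0"
proof -
  define l where "l t = mat n n (\<lambda>ij. m1 $$ ij + t * (m2 - m1) $$ ij)" for t
  obtain p q where p: "\<And>t. f (l t) = poly p t" and q: "\<And>t. g (l t) = poly q t"
    unfolding l_def using entry_polynomial_on_line[OF f(1)] entry_polynomial_on_line[OF g(1)] by metis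
  have "l 0 = m1" "l 1 = m2"
    using f(2) g(2) by (auto simp: l_def intro!: eq_matI)
  then have "p \<noteq> 0" "q \<noteq> 0"
    using f(3) g(3) p[of 0] q[of 1] by auto
  then have "p * q \<noteq> 0" by simp
  then obtain t where "poly (p * q) t \<noteq> 0"
    using poly_all_0_iff_0 by blast
  then show ?thesis
    by (intro bexI[of _ "l t"]) (auto simp: p q, auto simp: l_def)
qed

text \<open>All conditions are multiplied into a single polynomial, which is not the zero polynomial
  because it has a non-zero value.\<close>

lemma generically_finite:
  assumes "finite \<Phi>"
    and \<Phi>: "\<And>f. f \<in> \<Phi> \<Longrightarrow> entry_polynomial n f \<and> (\<exists>m\<in>carrier_mat n n. f m \<noteq> 0)"
    and imp: "\<And>m. m \<in> carrier_mat n n \<Longrightarrow> (\<And>f. f \<in> \<Phi> \<Longrightarrow> f m \<noteq> 0) \<Longrightarrow> \<P> m"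
  shows "generically n \<P>"
proof -
  have "\<exists>g. entry_polynomial n g \<and> (\<exists>m\<in>carrier_mat n n. g m \<noteq> 0) \<and> (\<forall>m. g m \<noteq> 0 \<longrightarrow> (\<forall>f\<in>\<Phi>. f m \<noteq> 0))"
    using assms(1) \<Phi>
  proof (induction \<Phi>)
    case empty
    show ?case
      by (intro exI[of _ "\<lambda>_. 1"]) (auto intro: entry_polynomial.const intro!: bexI[of _ "0\<^sub>m n n"])
  next
    case (insert f \<Phi>)
    then obtain g m2 where g: "entry_polynomial n g" "m2 \<in> carrier_mat n n" "g m2 \<noteq> 0"
      "\<And>m. g m \<noteq> 0 \<Longrightarrow> \<forall>f\<in>\<Phi>. f m \<noteq> 0"
      by (metis insertI2)
    obtain m1 where f: "entry_polynomial n f" "m1 \<in> carrier_mat n n" "f m1 \<noteq> 0"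
      using insert.prems by auto
    show ?case
      using entry_polynomial_mult_nonzero[OF f g(1-3)] f(1) g(1,4)
      by (intro exI[of _ "\<lambda>m. f m * g m"]) (auto intro: entry_polynomial.mult)
  qed
  then obtain g m where g: "entry_polynomial n g" "m \<in> carrier_mat n n" "g m \<noteq> 0"
      "\<And>m. g m \<noteq> 0 \<Longrightarrow> \<forall>f\<in>\<Phi>. f m \<noteq> 0"
    by blast
  obtain p where p: "entries_below n p" "\<And>m. entry_poly_eval p m = g m"
    using entry_polynomial_imp_entry_poly_eval[OF g(1)] by blast
  have "p \<noteq> 0"
    using p(2)[of m] g(3) by (auto simp: entry_poly_eval_def)
  then show ?thesis
    unfolding generically_def using p g(4) imp by (intro exI[of _ p]) (auto simp: entries_below_def)
qed

text \<open>Closure under finite sums and products passes to the Leibniz formula. The predicate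
  \<open>C\<close> is abstract because it is instantiated both by scalar functions and by functions
  into bivariate polynomials all of whose coefficients are polynomial in the entries.\<close>

lemma det_closed:
  fixes A :: "'m \<Rightarrow> 'a::comm_ring_1 mat"
  assumes const: "\<And>c. C (\<lambda>_. c)"
    and add: "\<And>f g. C f \<Longrightarrow> C g \<Longrightarrow> C (\<lambda>m. f m + g m)"
    and mult: "\<And>f g. C f \<Longrightarrow> C g \<Longrightarrow> C (\<lambda>m. f m * g m)"
    and A: "\<And>m. A m \<in> carrier_mat n n"
    and entries: "\<And>i j. i < n \<Longrightarrow> j < n \<Longrightarrow> C (\<lambda>m. A m $$ (i, j))"
  shows "C (\<lambda>m. det (A m))"
proof -
  have sum: "C (\<lambda>m. \<Sum>x\<in>X. f x m)" if "\<And>x. x \<in> X \<Longrightarrow> C (f x)" for X and f :: "'c \<Rightarrow> 'm \<Rightarrow> 'a"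
    using that by (induction X rule: infinite_finite_induct) (auto intro: const add)
  have prod: "C (\<lambda>m. \<Prod>x\<in>X. f x m)" if "\<And>x. x \<in> X \<Longrightarrow> C (f x)" for X and f :: "'d \<Rightarrow> 'm \<Rightarrow> 'a"
    using that by (induction X rule: infinite_finite_induct) (auto intro: const mult)
  show ?thesis
    unfolding det_def'[OF A]
  proof (intro sum mult const prod entries)
    fix p i assume "p \<in> {p. p permutes {0..<n}}" "i \<in> {0..<n}"
    then show "i < n" "p i < n"
      using permutes_in_image[of p "{0..<n}" i] by auto
  qed
qed

lemma entry_polynomial_coeff2_det_perturbed:
  assumes "D \<in> carrier_mat n n"
  shows "entry_polynomial n (\<lambda>m. coeff2 (det (perturbed D m)) a b)"
proof -
  define C where "C F \<longleftrightarrow> (\<forall>a b. entry_polynomial n (\<lambda>m. coeff2 (F m :: complex poly poly) a b))" for F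
  have "C (\<lambda>m. det (perturbed D m))"
  proof (rule det_closed[of C])
    show "C (\<lambda>_. c)" for c
      by (auto simp: C_def intro: entry_polynomial.const)
    show add: "C (\<lambda>m. f m + g m)" if "C f" "C g" for f g
      using that by (auto simp: C_def intro: entry_polynomial.add)
    show "C (\<lambda>m. f m * g m)" if "C f" "C g" for f g
      using that unfolding C_def coeff2_mult
      by (intro allI entry_polynomial_sum entry_polynomial.mult) auto
    fix i j assume ij: "i < n" "j < n"
    have "C (\<lambda>m. monom (monom (m $$ (i, j)) 1) 2)"
      unfolding C_def
    proof (intro allI)
      fix a b
      show "entry_polynomial n (\<lambda>m. coeff2 (monom (monom (m $$ (i, j)) 1) 2) a b)"
      proof (cases "a = 1 \<and> b = 2")
        case True
        then show ?thesis
          using entry_polynomial.entry[OF ij] by simp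
      next
        case False
        then have "(\<lambda>m :: complex mat. coeff2 (monom (monom (m $$ (i, j)) 1) 2) a b) = (\<lambda>_. 0)"
          by auto
        then show ?thesis
          by (simp only: entry_polynomial.const)
      qed
    qed
    moreover have "C (\<lambda>_. lift_X (D $$ (i, j)))"
      by (auto simp: C_def intro: entry_polynomial.const)
    ultimately have "C (\<lambda>m. lift_X (D $$ (i, j)) + monom (monom (m $$ (i, j)) 1) 2)"
      by (rule add[rotated])
    then show "C (\<lambda>m. perturbed D m $$ (i, j))"
      using ij assms by (simp add: perturbed_def smult_monom)
  qed (rule perturbed_carrier[OF assms])
  then show ?thesis
    by (simp add: C_def)
qed

text \<open>This function is the value of det (X m + c) at X = 1, a certificate for the regularity
  of that pencil.\<close>

lemma entry_polynomial_det_add: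
  assumes "c \<in> carrier_mat n n"
  shows "entry_polynomial n (\<lambda>m. det (mat n n (\<lambda>ij. m $$ ij + c $$ ij)))"
  by (rule det_closed[of "entry_polynomial n"])
    (auto intro: entry_polynomial.const entry_polynomial.add entry_polynomial.mult
      intro!: entry_polynomial.add[OF entry_polynomial.entry entry_polynomial.const])

section \<open>Edges of the Newton polygon\<close>

lemma eval_param_det_perturbed:
  assumes "D \<in> carrier_mat n n"
  shows "eval_param \<epsilon> (det (perturbed D m)) =
    det (mat n n (\<lambda>ij. D $$ ij + monom (complex_of_real \<epsilon> * m $$ ij) 2))"
proof -
  have "map_mat (eval_param \<epsilon>) (perturbed D m) = mat n n (\<lambda>ij. D $$ ij + monom (complex_of_real \<epsilon> * m $$ ij) 2)"
    using assms
    by (intro eq_matI poly_eqI)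
      (auto simp: perturbed_def eval_param_hom.hom_add lift_X_def coeff_map_poly smult_monom poly_monom)
  then show ?thesis
    by (metis eval_param_hom.hom_det)
qed

lemma Poly3: "Poly [x, y, z] = Poly [x, y] + monom z 2"
  by (simp add: monom_Suc numeral_2_eq_2 monom_0)

lemma det_quadratic_pencil:
  assumes "c \<in> carrier_mat n n" "k \<in> carrier_mat n n" "m \<in> carrier_mat n n"
  shows "det (matrix_pencil n [k, c, complex_of_real \<epsilon> \<cdot>\<^sub>m m]) =
    eval_param \<epsilon> (det (perturbed (matrix_pencil n [k, c]) m))"
proof -
  have "matrix_pencil n [k, c, complex_of_real \<epsilon> \<cdot>\<^sub>m m] =
      mat n n (\<lambda>ij. matrix_pencil n [k, c] $$ ij + monom (complex_of_real \<epsilon> * m $$ ij) 2)"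
    using assms by (intro eq_matI) (auto simp: matrix_pencil_def Poly3 simp del: Poly.simps)
  then show ?thesis
    by (simp only: eval_param_det_perturbed[OF matrix_pencil_carrier])
qed

lemma eval_param_0_det_perturbed:
  assumes "D \<in> carrier_mat n n"
  shows "eval_param 0 (det (perturbed D m)) = det D"
proof -
  have "mat n n (\<lambda>ij. D $$ ij + monom (complex_of_real 0 * m $$ ij) 2) = D"
    using assms by (intro eq_matI) auto
  with eval_param_det_perturbed[OF assms, of 0 m] show ?thesis
    by (simp only:)
qed

lemma poly_tendsto_at_right_0:
  "((\<lambda>\<epsilon>. poly p (complex_of_real \<epsilon>)) \<longlongrightarrow> poly p 0) (at_right 0)"
proof -
  have "isCont (\<lambda>\<epsilon>. poly p (complex_of_real \<epsilon>)) 0"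
    by (intro continuous_intros)
  then show ?thesis
    unfolding isCont_def by (auto intro: tendsto_within_subset)
qed

text \<open>The degree is \<open>hi\<close> and the order of vanishing at 0 is \<open>lo\<close>.
  Coefficients strictly between may vanish without changing the count.\<close>

lemma size_nonzero_roots:
  fixes g :: "complex poly"
  assumes "coeff g lo \<noteq> 0" "coeff g hi \<noteq> 0" and supp: "\<And>j. coeff g j \<noteq> 0 \<Longrightarrow> lo \<le> j \<and> j \<le> hi"
  shows "size (filter_mset (\<lambda>z. z \<noteq> 0) (proots g)) = hi - lo"
proof -
  have "g \<noteq> 0"
    using assms(1) by auto
  have deg: "degree g = hi"
  proof (rule antisym)
    show "degree g \<le> hi"
      using supp[of "degree g"] \<open>g \<noteq> 0\<close> by simp
    show "hi \<le> degree g"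
      using assms(2) by (rule le_degree)
  qed
  have "monom 1 lo dvd g" "\<not> monom 1 (Suc lo) dvd g"
    unfolding monom_1_dvd_iff' using assms(1) supp[of lo] supp by (metis not_le, metis lessI)
  then have ord: "Polynomial.order 0 g = lo"
    using \<open>g \<noteq> 0\<close> by (simp add: monom_1_dvd_iff)
  have "size (proots g) = size (filter_mset (\<lambda>z. z \<noteq> 0) (proots g)) + size (filter_mset (\<lambda>z. \<not> z \<noteq> 0) (proots g))"
    by (simp flip: size_union)
  also have "size (filter_mset (\<lambda>z. \<not> z \<noteq> 0) (proots g)) = count (proots g) 0"
    by (simp add: filter_eq_replicate_mset)
  finally show ?thesis
    using \<open>g \<noteq> 0\<close> by (simp add: size_proots_complex deg ord)
qed

lemma powr_tendsto_at_right_0: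
  assumes "x \<ge> 0"
  shows "((\<lambda>\<epsilon>. complex_of_real (\<epsilon> powr x)) \<longlongrightarrow> (if x = 0 then 1 else 0)) (at_right 0)"
proof (cases "x = 0")
  case True
  \<comment> \<open>\<open>0 powr 0\<close> is 0, so the constant value 1 is claimed for positive
    \<epsilon> only.\<close>
  have "\<forall>\<^sub>F \<epsilon> in at_right (0::real). 1 = complex_of_real (\<epsilon> powr x)"
    using True by (auto simp: eventually_at_right_field intro!: exI[of _ 1])
  then show ?thesis
    using True by (auto intro: Lim_transform_eventually[OF tendsto_const])
next
  case False
  have "\<forall>\<^sub>F \<epsilon> in at_right (0::real). 0 \<le> \<epsilon>"
    by (auto simp: eventually_at_right_field intro!: exI[of _ 1])
  then have "((\<lambda>\<epsilon>::real. \<epsilon> powr x) \<longlongrightarrow> 0 powr x) (at_right 0)"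
    using False assms by (intro tendsto_powr' tendsto_intros) auto
  then show ?thesis
    using False by (auto dest: tendsto_of_real[where 'a = complex])
qed

text \<open>Counts the eigenvalues belonging to the edge of slope \<open>- \<beta> / \<alpha>\<close> of the Newton polygon: the bounds
  for the neighbouring slopes confine the edge to \<open>\<epsilon>\<close>-exponents between \<open>h1\<close> and \<open>h2\<close>.\<close>

lemma card_of_order_edge:
  fixes \<alpha> h1 h2 b1 b2 :: nat and \<beta> w :: int
  assumes L: "eigenvalue_functions A N L"
    and F: "\<And>\<epsilon>. det (A \<epsilon>) = eval_param \<epsilon> F"
    and "\<alpha> > 0" and \<beta>: "\<beta> = 1 \<or> \<beta> = - 1" and "h1 \<le> h2"
    and ge: "weight_ge (int \<alpha>) \<beta> F w"
    and ge1: "weight_ge (int \<alpha> + 1) \<beta> F (w + int h1)"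
    and ge2: "weight_ge (int \<alpha> - 1) \<beta> F (w - int h2)"
    and v1: "coeff2 F h1 b1 \<noteq> 0" "\<beta> * int b1 = w - int \<alpha> * int h1"
    and v2: "coeff2 F h2 b2 \<noteq> 0" "\<beta> * int b2 = w - int \<alpha> * int h2"
  shows "card {i. i < N \<and> of_order (L i) (of_int \<beta> / real \<alpha>)} = \<alpha> * (h2 - h1)"
proof -
  define \<Lambda> where "\<Lambda> = of_int \<beta> / real \<alpha>"
  \<comment> \<open>Divides out the power of \<epsilon> that a monomial of weight \<open>w\<close>
    acquires under the substitution.\<close>
  define C where "C \<epsilon> = complex_of_real (\<epsilon> powr (- of_int w / real \<alpha>))" for \<epsilon> :: real
  \<comment> \<open>Monomials on the supporting line survive the limit; all others keep a positive
    power of \<epsilon>.\<close>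
  define \<gamma> where "\<gamma> j = (\<Sum>a\<le>degree (coeff F j). if int \<alpha> * int a + \<beta> * int j = w then coeff2 F a j else 0)" for j
  define g where "g = Poly (map \<gamma> [0..<Suc (degree F)])"
  have "\<gamma> j = 0" if "j > degree F" for j
    unfolding \<gamma>_def coeff_eq_0[OF that] by (simp cong: if_cong)
  then have coeff_g: "coeff g j = \<gamma> j" for j
    by (auto simp: g_def nth_default_def simp del: upt_Suc)
  have lim: "((\<lambda>\<epsilon>. C \<epsilon> * coeff (det (A \<epsilon>)) j * complex_of_real (\<epsilon> powr \<Lambda>) ^ j) \<longlongrightarrow> \<gamma> j) (at_right 0)" for j
  proof -
    define x where "x a = (real_of_int (int \<alpha> * int a + \<beta> * int j - w)) / real \<alpha>" for a
    have "((\<lambda>\<epsilon>. \<Sum>a\<le>degree (coeff F j). coeff2 F a j * complex_of_real (\<epsilon> powr x a)) \<longlongrightarrow>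
        (\<Sum>a\<le>degree (coeff F j). if int \<alpha> * int a + \<beta> * int j = w then coeff2 F a j else 0)) (at_right 0)"
    proof (rule tendsto_sum)
      fix a
      show "((\<lambda>\<epsilon>. coeff2 F a j * complex_of_real (\<epsilon> powr x a)) \<longlongrightarrow>
          (if int \<alpha> * int a + \<beta> * int j = w then coeff2 F a j else 0)) (at_right 0)"
      proof (cases "coeff2 F a j = 0")
        case False
        then have "int \<alpha> * int a + \<beta> * int j - w \<ge> 0"
          using ge by (auto simp: weight_ge_def)
        then have "real_of_int (int \<alpha> * int a + \<beta> * int j - w) \<ge> 0"
          by (simp only: of_int_0_le_iff)
        then have "x a \<ge> 0"
          unfolding x_def by (rule divide_nonneg_nonneg) simp
        moreover have "x a = 0 \<longleftrightarrow> int \<alpha> * int a + \<beta> * int j = w"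
          using \<open>\<alpha> > 0\<close> unfolding x_def divide_eq_0_iff of_int_eq_0_iff by auto
        ultimately show ?thesis
          using tendsto_mult[OF tendsto_const powr_tendsto_at_right_0[of "x a"], of "coeff2 F a j"]
          by (simp cong: if_cong split: if_splits)
      qed simp
    qed
    then have "((\<lambda>\<epsilon>. \<Sum>a\<le>degree (coeff F j). coeff2 F a j * complex_of_real (\<epsilon> powr x a)) \<longlongrightarrow> \<gamma> j) (at_right 0)"
      by (simp only: \<gamma>_def)
    moreover have "\<forall>\<^sub>F \<epsilon> in at_right 0. (\<Sum>a\<le>degree (coeff F j). coeff2 F a j * complex_of_real (\<epsilon> powr x a)) =
        C \<epsilon> * coeff (det (A \<epsilon>)) j * complex_of_real (\<epsilon> powr \<Lambda>) ^ j"
    proof -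
      have eq: "(\<Sum>a\<le>degree (coeff F j). coeff2 F a j * complex_of_real (\<epsilon> powr x a)) =
        C \<epsilon> * coeff (det (A \<epsilon>)) j * complex_of_real (\<epsilon> powr \<Lambda>) ^ j" if "\<epsilon> > 0" for \<epsilon> :: real
      proof -
        have "complex_of_real (\<epsilon> powr x a) = C \<epsilon> * complex_of_real \<epsilon> ^ a * complex_of_real (\<epsilon> powr \<Lambda>) ^ j" for a
        proof -
          have "x a = - of_int w / real \<alpha> + real a + \<Lambda> * real j"
            using \<open>\<alpha> > 0\<close> by (simp add: x_def \<Lambda>_def field_simps)
          then have "\<epsilon> powr x a = \<epsilon> powr (- of_int w / real \<alpha>) * \<epsilon> powr real a * \<epsilon> powr (\<Lambda> * real j)"
            by (simp only: powr_add)
          also have "\<epsilon> powr (\<Lambda> * real j) = (\<epsilon> powr \<Lambda>) ^ j"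
            using that by (simp add: powr_realpow flip: powr_powr)
          also have "\<epsilon> powr real a = \<epsilon> ^ a"
            using that by (rule powr_realpow)
          finally have "\<epsilon> powr x a = \<epsilon> powr (- of_int w / real \<alpha>) * \<epsilon> ^ a * (\<epsilon> powr \<Lambda>) ^ j" .
          then show ?thesis
            by (simp add: C_def)
        qed
        then show ?thesis
          by (simp add: F poly_altdef sum_distrib_left sum_distrib_right mult_ac)
      qed
      then show ?thesis
        by (auto simp: eventually_at_right_field intro!: exI[of _ 1])
    qed
    ultimately show ?thesis
      by (rule Lim_transform_eventually)
  qed
  have supp: "\<exists>a. h1 \<le> a \<and> a \<le> h2 \<and> \<beta> * int j = w - int \<alpha> * int a" if nz: "\<gamma> j \<noteq> 0" for j
  proof -
    obtain a where "(if int \<alpha> * int a + \<beta> * int j = w then coeff2 F a j else 0) \<noteq> 0"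
      using nz unfolding \<gamma>_def by (rule sum.not_neutral_contains_not_neutral)
    then have a: "int \<alpha> * int a + \<beta> * int j = w" "coeff2 F a j \<noteq> 0"
      by (auto split: if_splits)
    \<comment> \<open>On the supporting line the two neighbouring weights take the values w + a and
      w - a, so their bounds give h1 \<le> a and a \<le> h2.\<close>
    have "w + int h1 \<le> (int \<alpha> + 1) * int a + \<beta> * int j" "w - int h2 \<le> (int \<alpha> - 1) * int a + \<beta> * int j"
      using ge1 ge2 a(2) unfolding weight_ge_def by blast+
    then show ?thesis
      using a(1) by (intro exI[of _ a]) (auto simp: algebra_simps)
  qed
  \<comment> \<open>For a fixed power of X the supporting line contains only one power of
    \<epsilon>, since \<alpha> > 0; the sum has a single term.\<close>
  have vertex: "\<gamma> b \<noteq> 0" if "coeff2 F h b \<noteq> 0" "\<beta> * int b = w - int \<alpha> * int h" for b h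
  proof -
    have "\<gamma> b = (\<Sum>a\<le>degree (coeff F b). if a = h then coeff2 F h b else 0)"
      unfolding \<gamma>_def using that(2) \<open>\<alpha> > 0\<close> by (intro sum.cong) auto
    then show ?thesis
      using that(1) le_degree by auto
  qed
  \<comment> \<open>The sign of \<beta> decides whether the power of X falls or grows with that of
    \<epsilon> along the edge.\<close>
  have "size (filter_mset (\<lambda>z. z \<noteq> 0) (proots g)) = \<alpha> * (h2 - h1)"
    using \<beta>
  proof
    assume "\<beta> = 1"
    have "size (filter_mset (\<lambda>z. z \<noteq> 0) (proots g)) = b1 - b2"
    proof (rule size_nonzero_roots)
      fix j assume "coeff g j \<noteq> 0"
      then obtain a where a: "h1 \<le> a" "a \<le> h2" "int j = w - int \<alpha> * int a"
        using supp[of j] \<open>\<beta> = 1\<close> by (auto simp: coeff_g)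
      have "int \<alpha> * int h1 \<le> int \<alpha> * int a" "int \<alpha> * int a \<le> int \<alpha> * int h2"
        using a by (simp_all add: mult_left_mono)
      then show "b2 \<le> j \<and> j \<le> b1"
        using a(3) v1(2) v2(2) \<open>\<beta> = 1\<close> by simp
    qed (use vertex v1 v2 in \<open>auto simp: coeff_g\<close>)
    also have "int (b1 - b2) = int (\<alpha> * (h2 - h1))"
    proof -
      have "int \<alpha> * int h1 \<le> int \<alpha> * int h2"
        using \<open>h1 \<le> h2\<close> by (simp add: mult_left_mono)
      then have "b2 \<le> b1"
        using v1(2) v2(2) \<open>\<beta> = 1\<close> by simp
      then show ?thesis
        using v1(2) v2(2) \<open>\<beta> = 1\<close> \<open>h1 \<le> h2\<close> by (simp add: of_nat_diff algebra_simps)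
    qed
    then have "b1 - b2 = \<alpha> * (h2 - h1)"
      by (simp only: of_nat_eq_iff)
    finally show ?thesis .
  next
    assume "\<beta> = - 1"
    have "size (filter_mset (\<lambda>z. z \<noteq> 0) (proots g)) = b2 - b1"
    proof (rule size_nonzero_roots)
      fix j assume "coeff g j \<noteq> 0"
      then obtain a where a: "h1 \<le> a" "a \<le> h2" "- int j = w - int \<alpha> * int a"
        using supp[of j] \<open>\<beta> = - 1\<close> by (auto simp: coeff_g)
      have "int \<alpha> * int h1 \<le> int \<alpha> * int a" "int \<alpha> * int a \<le> int \<alpha> * int h2"
        using a by (simp_all add: mult_left_mono)
      then show "b1 \<le> j \<and> j \<le> b2"
        using a(3) v1(2) v2(2) \<open>\<beta> = - 1\<close> by simp
    qed (use vertex v1 v2 in \<open>auto simp: coeff_g\<close>)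
    moreover have "int (b2 - b1) = int (\<alpha> * (h2 - h1))"
    proof -
      have "int \<alpha> * int h1 \<le> int \<alpha> * int h2"
        using \<open>h1 \<le> h2\<close> by (simp add: mult_left_mono)
      then have "b1 \<le> b2"
        using v1(2) v2(2) \<open>\<beta> = - 1\<close> by simp
      then show ?thesis
        using v1(2) v2(2) \<open>\<beta> = - 1\<close> \<open>h1 \<le> h2\<close> by (simp add: of_nat_diff algebra_simps)
    qed
    ultimately show ?thesis
      by (simp only: of_nat_eq_iff)
  qed
  moreover obtain xs where xs: "mset xs = filter_mset (\<lambda>z. z \<noteq> 0) (proots g)"
    using ex_mset by blast
  moreover have "\<exists>\<sigma>. bij_betw \<sigma> {..<length xs} {i. i < N \<and> of_order (L i) \<Lambda>} \<and>
    (\<forall>j<length xs. L (\<sigma> j) \<sim>[at_right 0] (\<lambda>\<epsilon>. xs ! j * complex_of_real (\<epsilon> powr \<Lambda>)))"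
  proof (rule eigenvalues_of_order[OF L])
    show "g \<noteq> 0"
      using vertex[OF v1] by (metis coeff_0 coeff_g)
    show "C \<epsilon> \<noteq> 0" if "\<epsilon> > 0" for \<epsilon>
      using that by (simp add: C_def)
  qed (use lim xs in \<open>simp_all add: coeff_g\<close>)
  ultimately show ?thesis
    unfolding \<Lambda>_def by (metis bij_betw_same_card card_lessThan size_mset)
qed

text \<open>The multiplicity of the root 0 is the same for all small \<epsilon>, but different
  branches might vanish at different parameters. A branch that is non-zero at one parameter stays so
  nearby; as the number of vanishing branches is fixed, their index set is locally constant, hence
  constant on the interval.\<close>

lemma card_eventually_zero_ge:
  assumes L: "eigenvalue_functions A N L"
    and F: "\<And>\<epsilon>. det (A \<epsilon>) = eval_param \<epsilon> F" and "F \<noteq> 0"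
    and low: "\<And>j. j < v0 \<Longrightarrow> coeff F j = 0"
  shows "v0 \<le> card {i. i < N \<and> (\<forall>\<^sub>F \<epsilon> in at_right 0. L i \<epsilon> = 0)}"
proof -
  \<comment> \<open>The exact order of vanishing, possibly larger than \<open>v0\<close>: only the
    exact value makes the number of vanishing branches constant.\<close>
  define v where "v = (LEAST j. coeff F j \<noteq> 0)"
  have "\<exists>j. coeff F j \<noteq> 0"
    using \<open>F \<noteq> 0\<close> leading_coeff_neq_0 by blast
  then have v: "coeff F v \<noteq> 0"
    unfolding v_def by (rule LeastI_ex)
  have below_v: "coeff F j = 0" if "j < v" for j
    using not_less_Least[of j "\<lambda>j. coeff F j \<noteq> 0"] that by (auto simp: v_def)
  from v have "v0 \<le> v"
    using low by (meson not_le)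
  obtain e0 where e0: "e0 > 0" and cont: "\<And>i. i < N \<Longrightarrow> continuous_on {0<..<e0} (L i)"
    and reg: "\<And>\<epsilon>. \<epsilon> \<in> {0<..<e0} \<Longrightarrow> det (A \<epsilon>) \<noteq> 0"
    and roots: "\<And>\<epsilon>. \<epsilon> \<in> {0<..<e0} \<Longrightarrow> proots (det (A \<epsilon>)) = mset (map (\<lambda>i. L i \<epsilon>) [0..<N])"
    using L by (auto simp: eigenvalue_functions_def regular_pencil_def pencil_eigenvalues_def)
  obtain e1 where e1: "e1 > 0" "\<And>\<epsilon>. 0 < \<epsilon> \<Longrightarrow> \<epsilon> < e1 \<Longrightarrow> poly (coeff F v) (complex_of_real \<epsilon>) \<noteq> 0"
    using eventually_poly_of_real_nonzero[OF v] by (auto simp: eventually_at_right_field)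
  define e where "e = min e0 e1"
  define Z where "Z \<epsilon> = {i. i < N \<and> L i \<epsilon> = 0}" for \<epsilon>
  have card_Z: "card (Z \<epsilon>) = v" if \<epsilon>: "\<epsilon> \<in> {0<..<e}" for \<epsilon>
  proof -
    have \<epsilon>': "\<epsilon> \<in> {0<..<e0}" "0 < \<epsilon>" "\<epsilon> < e1"
      using \<epsilon> by (auto simp: e_def)
    have "monom 1 v dvd det (A \<epsilon>)" "\<not> monom 1 (Suc v) dvd det (A \<epsilon>)"
      using v below_v e1(2)[OF \<epsilon>'(2,3)] by (auto simp: monom_1_dvd_iff' F)
    then have "Polynomial.order 0 (det (A \<epsilon>)) = v"
      using reg[OF \<epsilon>'(1)] by (simp add: monom_1_dvd_iff)
    then have "count (mset (map (\<lambda>i. L i \<epsilon>) [0..<N])) 0 = v"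
      using roots[OF \<epsilon>'(1)] reg[OF \<epsilon>'(1)] by (metis count_proots)
    moreover have "count (mset (map (\<lambda>i. L i \<epsilon>) [0..<N])) 0 = length (filter (\<lambda>i. L i \<epsilon> = 0) [0..<N])"
      by (rule count_mset_map_filter)
    moreover have "length (filter (\<lambda>i. L i \<epsilon> = 0) [0..<N]) = card (Z \<epsilon>)"
      using distinct_card[of "filter (\<lambda>i. L i \<epsilon> = 0) [0..<N]"] by (simp add: Z_def)
    ultimately show ?thesis by simp
  qed
  have local: "\<forall>\<^sub>F t in at s within {0<..<e}. Z s = Z t" if s: "s \<in> {0<..<e}" for s
  proof -
    have "\<forall>\<^sub>F t in at s within {0<..<e}. \<forall>i\<in>{..<N} - Z s. L i t \<noteq> 0"
    proof (intro eventually_ball_finite ballI)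
      fix i assume i: "i \<in> {..<N} - Z s"
      then have "continuous_on {0<..<e} (L i)"
        by (intro continuous_on_subset[OF cont]) (auto simp: e_def)
      then have "(L i \<longlongrightarrow> L i s) (at s within {0<..<e})"
        using s by (simp add: continuous_on_def)
      then show "\<forall>\<^sub>F t in at s within {0<..<e}. L i t \<noteq> 0"
        using i by (intro tendsto_imp_eventually_ne) (auto simp: Z_def)
    qed simp
    moreover have "\<forall>\<^sub>F t in at s within {0<..<e}. t \<in> {0<..<e}"
      by (simp add: eventually_at_filter)
    ultimately show ?thesis
    proof eventually_elim
      case (elim t)
      then have "Z t \<subseteq> Z s"
        by (auto simp: Z_def)
      then have "Z t = Z s"
        using card_Z[OF s] card_Z[OF elim(2)] by (intro card_subset_eq) (auto simp: Z_def)
      then show ?case ..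
    qed
  qed
  have "e > 0"
    using e0 e1 by (simp add: e_def)
  then have mid: "e / 2 \<in> {0<..<e}"
    by simp
  have const: "Z (e / 2) = Z t" if "t \<in> {0<..<e}" for t
    by (rule connected_local_const[OF connected_Ioo mid that]) (use local in blast)
  have "\<forall>\<^sub>F t in at_right 0. t \<in> {0<..<e}"
    using \<open>e > 0\<close> by (rule eventually_at_right_real)
  then have "\<forall>\<^sub>F t in at_right 0. L i t = 0" if "i \<in> Z (e / 2)" for i
    by (rule eventually_mono) (use const that in \<open>auto simp: Z_def\<close>)
  then have "Z (e / 2) \<subseteq> {i. i < N \<and> (\<forall>\<^sub>F \<epsilon> in at_right 0. L i \<epsilon> = 0)}"
    by (auto simp: Z_def)
  then have "card (Z (e / 2)) \<le> card {i. i < N \<and> (\<forall>\<^sub>F \<epsilon> in at_right 0. L i \<epsilon> = 0)}"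
    by (intro card_mono) auto
  then show ?thesis
    using card_Z[OF mid] \<open>v0 \<le> v\<close> by simp
qed

text \<open>Substituting \<open>X = Y / \<epsilon>\<close> in \<open>\<epsilon> X\<^sup>2 m + X c + k\<close> and multiplying by \<open>\<epsilon>\<close> gives
  \<open>Y\<^sup>2 m + Y c + \<epsilon> k\<close>.\<close>

lemma scaled_coeffs_tendsto:
  assumes c: "c \<in> carrier_mat n n" and k: "k \<in> carrier_mat n n" and m: "m \<in> carrier_mat n n"
  shows "((\<lambda>\<epsilon>. complex_of_real (\<epsilon> ^ n) * coeff (det (matrix_pencil n [k, c, complex_of_real \<epsilon> \<cdot>\<^sub>m m])) j *
      complex_of_real (\<epsilon> powr - 1) ^ j) \<longlongrightarrow> coeff (monom 1 n * det (matrix_pencil n [c, m])) j) (at_right 0)"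
proof -
  \<comment> \<open>The entries are polynomial in \<epsilon> and Y, so the limit becomes continuity
    of the coefficients of \<open>det B\<close> at \<epsilon> = 0, where every entry is divisible by
    Y.\<close>
  define B :: "complex poly poly mat" where
    "B = mat n n (\<lambda>ij. [:[:0, k $$ ij:], [:c $$ ij:], [:m $$ ij:]:])"
  have B_eval: "map_mat (eval_param \<epsilon>) B = mat n n (\<lambda>ij. [:complex_of_real \<epsilon> * k $$ ij, c $$ ij, m $$ ij:])" for \<epsilon>
    by (intro eq_matI poly_eqI) (auto simp: B_def coeff_pCons split: nat.splits)
  have "det (map_mat (eval_param 0) B) = det (monom 1 1 \<cdot>\<^sub>m matrix_pencil n [c, m])"
    unfolding B_eval by (intro arg_cong[of _ _ det] eq_matI) (auto simp: matrix_pencil_def monom_Suc monom_0)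
  also have "\<dots> = monom 1 n * det (matrix_pencil n [c, m])"
    by (simp add: monom_power)
  finally have B0: "eval_param 0 (det B) = monom 1 n * det (matrix_pencil n [c, m])"
    by simp
  have eq: "coeff (eval_param \<epsilon> (det B)) j = complex_of_real (\<epsilon> ^ n) *
      coeff (det (matrix_pencil n [k, c, complex_of_real \<epsilon> \<cdot>\<^sub>m m])) j * complex_of_real (\<epsilon> powr - 1) ^ j"
    if "\<epsilon> > 0" for \<epsilon> :: real
  proof -
    define y where "y = complex_of_real (\<epsilon> powr - 1)"
    have y: "y = 1 / complex_of_real \<epsilon>" "complex_of_real \<epsilon> \<noteq> 0"
      using that by (simp_all add: y_def powr_minus field_simps)
    have hom: "comm_ring_hom (\<lambda>p. pcompose p [:0, y:])"
      by unfold_locales (auto simp: pcompose_add pcompose_mult)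
    let ?A = "matrix_pencil n [k, c, complex_of_real \<epsilon> \<cdot>\<^sub>m m]"
    have "map_mat (eval_param \<epsilon>) B = [:complex_of_real \<epsilon>:] \<cdot>\<^sub>m map_mat (\<lambda>p. pcompose p [:0, y:]) ?A"
      unfolding B_eval y(1) using m y(2)
      by (intro eq_matI) (auto simp: matrix_pencil_def pcompose_pCons field_simps)
    then have "det (map_mat (eval_param \<epsilon>) B) = [:complex_of_real \<epsilon>:] ^ n * pcompose (det ?A) [:0, y:]"
      by (simp add: comm_ring_hom.hom_det[OF hom])
    then have "eval_param \<epsilon> (det B) = Polynomial.smult (complex_of_real \<epsilon> ^ n) (pcompose (det ?A) [:0, y:])"
      by (simp add: poly_const_pow)
    then show ?thesis
      by (simp add: coeff_pcompose_linear y_def flip: coeff_eval_param)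
  qed
  have "((\<lambda>\<epsilon>. coeff (eval_param \<epsilon> (det B)) j) \<longlongrightarrow> coeff (eval_param 0 (det B)) j) (at_right 0)"
    using poly_tendsto_at_right_0[of "coeff (det B) j"] by simp
  then show ?thesis
    unfolding B0
    by (rule Lim_transform_eventually) (use eq in \<open>auto simp: eventually_at_right_field intro!: exI[of _ 1]\<close>)
qed

section \<open>The quadratic pencil\<close>

text \<open>Passing from s to s + 1 changes the weight bound by the number of blocks larger than s,
  which is the \<epsilon>-exponent of the vertex shared by the two edges.\<close>

lemma sum_diff_Suc:
  "(\<Sum>S\<leftarrow>xs. S - s) = (\<Sum>S\<leftarrow>xs. S - Suc s) + length (filter (\<lambda>S. S > s) xs)"
  by (induction xs) auto

lemma sum_min_Suc:
  "(\<Sum>S\<leftarrow>xs. min S (Suc s)) = (\<Sum>S\<leftarrow>xs. min S s) + length (filter (\<lambda>S. S > s) xs)"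
  by (induction xs) auto

text \<open>The \<epsilon>-exponents at the two ends of the edge for s differ by the number of
  blocks of size s.\<close>

lemma length_filter_greater_pred:
  fixes s :: nat
  shows "s > 0 \<Longrightarrow> length (filter (\<lambda>S. S > s - 1) xs) = length (filter (\<lambda>S. S > s) xs) + count_list xs s"
  by (induction xs) auto

text \<open>Together with its companion for s - 1, this places both ends of an edge on the
  supporting line for s: blocks of size exactly s may contribute either of their two
  monomials.\<close>

lemma sum_Suc_greater:
  "(\<Sum>S\<leftarrow>xs. if S > s then S + 1 else 0) = (\<Sum>S\<leftarrow>xs. S - s) + (s + 1) * length (filter (\<lambda>S. S > s) xs)"
  by (induction xs) auto

lemma sum_Suc_greater_pred:
  "s > 0 \<Longrightarrow> (\<Sum>S\<leftarrow>xs. if S > s - 1 then S + 1 else 0) =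
     (\<Sum>S\<leftarrow>xs. S - s) + (s + 1) * length (filter (\<lambda>S. S > s - 1) xs)"
  by (induction xs) auto

lemma sum_zero_vertex:
  "s \<ge> 2 \<Longrightarrow> (\<Sum>S\<leftarrow>xs. if S > s then 2 else S) + (s - 2) * length (filter (\<lambda>S. S > s) xs) = (\<Sum>S\<leftarrow>xs. min S s)"
  by (induction xs) auto

lemma sum_zero_vertex_pred:
  "s \<ge> 3 \<Longrightarrow> (\<Sum>S\<leftarrow>xs. if S > s - 1 then 2 else S) + (s - 2) * length (filter (\<lambda>S. S > s - 1) xs) =
     (\<Sum>S\<leftarrow>xs. min S s)"
  by (induction xs) auto

text \<open>The origin of 2 q_0 - q'_0: blocks of size 1 contribute 1 to the order of vanishing, and
  all others 2.\<close>

lemma sum_min_2: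
  "\<forall>S\<in>set xs. S > 0 \<Longrightarrow> (\<Sum>S\<leftarrow>xs. min S 2) + count_list xs 1 = 2 * length xs"
  by (induction xs) auto

locale perturbed_weierstrass_pencil =
  fixes n :: nat and c k :: "complex mat" and fs :: "(nat \<times> complex) list" and s0 sinf :: "nat list"
  assumes c: "c \<in> carrier_mat n n" and k: "k \<in> carrier_mat n n"
    and regular: "regular_pencil (matrix_pencil n [k, c])"
    and W: "weierstrass_form n c k fs s0 sinf"
begin

definition F :: "complex mat \<Rightarrow> complex poly poly" where
  "F m = det (perturbed (matrix_pencil n [k, c]) m)"

definition inf_weight :: "nat \<Rightarrow> int" where
  "inf_weight s = - int (n - sum_list sinf) - int (\<Sum>S\<leftarrow>sinf. S - s)"

text \<open>The vertex shared by the edges for s and s + 1: each block at infinity larger than s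
  contributes \<epsilon> X^(S+1), each other one contributes 1, and the finite eigenvalues
  contribute their full degree.\<close>

definition inf_vertex :: "nat \<Rightarrow> nat \<times> nat" where
  "inf_vertex s = (length (filter (\<lambda>S. S > s) sinf), (n - sum_list sinf) + (\<Sum>S\<leftarrow>sinf. if S > s then S + 1 else 0))"

text \<open>The analogue at 0: blocks larger than s contribute \<epsilon> X^2, the others
  X^S.\<close>

definition zero_vertex :: "nat \<Rightarrow> nat \<times> nat" where
  "zero_vertex s = (length (filter (\<lambda>S. S > s) s0), \<Sum>S\<leftarrow>s0. if S > s then 2 else S)"

lemma pos: "\<forall>s\<in>set s0. s > 0" "\<forall>s\<in>set sinf. s > 0" "\<forall>(s, a)\<in>set fs. a \<noteq> 0"
  using W by (auto simp: weierstrass_form_def)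

lemma n_eq: "n = (\<Sum>(s, a)\<leftarrow>fs. s) + sum_list s0 + sum_list sinf"
  by (rule weierstrass_transform[OF W])

lemma eval_F: "m \<in> carrier_mat n n \<Longrightarrow>
    det (matrix_pencil n [k, c, complex_of_real \<epsilon> \<cdot>\<^sub>m m]) = eval_param \<epsilon> (F m)"
  unfolding F_def by (rule det_quadratic_pencil[OF c k])

lemma eval_F_0: "eval_param 0 (F m) = det (matrix_pencil n [k, c])"
  unfolding F_def by (rule eval_param_0_det_perturbed[OF matrix_pencil_carrier])

lemma F_nonzero: "F m \<noteq> 0"
  using eval_F_0[of m] regular by (auto simp: regular_pencil_def)

lemma weight_ge_const2_mult: "\<kappa> \<noteq> 0 \<Longrightarrow> weight_ge \<alpha> \<beta> (const2 \<kappa> * G) w \<longleftrightarrow> weight_ge \<alpha> \<beta> G w"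
  unfolding weight_ge_def coeff2_const2_mult by simp

lemma weight_ge_F_inf:
  assumes "m \<in> carrier_mat n n"
  shows "weight_ge (int s + 1) (- 1) (F m) (inf_weight s)"
proof -
  obtain \<kappa> where "\<kappa> \<noteq> 0" and D: "weierstrass_blocks fs s0 sinf \<in> carrier_mat n n"
    and tr: "\<And>m. m \<in> carrier_mat n n \<Longrightarrow> \<exists>M\<in>carrier_mat n n.
      det (perturbed (weierstrass_blocks fs s0 sinf) M) = const2 \<kappa> * F m"
    unfolding F_def by (rule weierstrass_transform[OF W]) blast
  obtain M where M: "det (perturbed (weierstrass_blocks fs s0 sinf) M) = const2 \<kappa> * F m"
    using tr[OF assms] by blast
  have "weight_ge (int s + 1) (- 1) (const2 \<kappa> * F m) (inf_weight s)"
    unfolding inf_weight_def M[symmetric] by (rule weight_ge_inf[OF D n_eq])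
  then show ?thesis
    unfolding weight_ge_const2_mult[OF \<open>\<kappa> \<noteq> 0\<close>] .
qed

lemma weight_ge_F_zero:
  assumes "m \<in> carrier_mat n n" "s \<ge> 2"
  shows "weight_ge (int s - 2) 1 (F m) (int (\<Sum>S\<leftarrow>s0. min S s))"
proof -
  obtain \<kappa> where "\<kappa> \<noteq> 0" and D: "weierstrass_blocks fs s0 sinf \<in> carrier_mat n n"
    and tr: "\<And>m. m \<in> carrier_mat n n \<Longrightarrow> \<exists>M\<in>carrier_mat n n.
      det (perturbed (weierstrass_blocks fs s0 sinf) M) = const2 \<kappa> * F m"
    unfolding F_def by (rule weierstrass_transform[OF W]) blast
  obtain M where M: "det (perturbed (weierstrass_blocks fs s0 sinf) M) = const2 \<kappa> * F m"
    using tr[OF assms(1)] by blast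
  have "weight_ge (int s - 2) 1 (const2 \<kappa> * F m) (int (\<Sum>S\<leftarrow>s0. min S s))"
    unfolding M[symmetric] by (rule weight_ge_zero[OF D assms(2)])
  then show ?thesis
    unfolding weight_ge_const2_mult[OF \<open>\<kappa> \<noteq> 0\<close>] .
qed

text \<open>Every entry has degree at most 2 in X. The weight (0, -1) continues the family (s + 1,
  -1) to s = -1 and bounds the edge for \<epsilon>^(-1) at the vertex (n, 2 n).\<close>

lemma weight_ge_F_degree:
  shows "weight_ge 0 (- 1) (F m) (- 2 * int n)"
  unfolding F_def
proof (rule weight_ge_det_perturbed[where U = "- 2" and V = 0 and n = n])
  show "has_potentials (order_ge (- 1)) (- 2) 0 (matrix_pencil n [k, c]) (- 2 * int n)"
    unfolding has_potentials_def order_ge_def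
    by (intro conjI exI[of _ "\<lambda>_. - 2"] exI[of _ "\<lambda>_. 0"])
      (auto simp: coeff_Poly2 simp del: Poly.simps coeff_Poly_eq split: if_splits)
qed auto

text \<open>Non-vanishing is checked in Weierstrass coordinates: the exposed vertex of one explicit
  \<open>M\<close> gives a matrix \<open>m\<close> in the original coordinates with a non-zero
  coefficient at the same exponents.\<close>

lemma vertex_witness:
  assumes "strict_lead \<alpha> \<beta> (det (perturbed (weierstrass_blocks fs s0 sinf) M)) a b" "M \<in> carrier_mat n n"
  shows "\<exists>m\<in>carrier_mat n n. coeff2 (F m) a b \<noteq> 0"
proof -
  obtain \<kappa> where tr: "\<And>M. M \<in> carrier_mat n n \<Longrightarrow> \<exists>m\<in>carrier_mat n n.
      det (perturbed (weierstrass_blocks fs s0 sinf) M) = const2 \<kappa> * F m"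
    unfolding F_def by (rule weierstrass_transform[OF W]) blast
  obtain m where "m \<in> carrier_mat n n" "det (perturbed (weierstrass_blocks fs s0 sinf) M) = const2 \<kappa> * F m"
    using tr[OF assms(2)] by blast
  with strict_lead_coeff2[OF assms(1)] show ?thesis
    by (intro bexI[of _ m]) (auto simp: coeff2_const2_mult simp del: mult_pCons_left)
qed

lemma corner_witnesses:
  shows "\<exists>m\<in>carrier_mat n n. coeff2 (F m) (fst (inf_vertex s)) (snd (inf_vertex s)) \<noteq> 0"
    and "s \<ge> 2 \<Longrightarrow> \<exists>m\<in>carrier_mat n n. coeff2 (F m) (fst (zero_vertex s)) (snd (zero_vertex s)) \<noteq> 0"
    and "\<exists>m\<in>carrier_mat n n. coeff2 (F m) n (2 * n) \<noteq> 0"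
proof -
  let ?M = "diag_block_mat (map (\<lambda>(s, a). 0\<^sub>m s s) fs @ map corner s0 @ map corner sinf)"
  have M: "?M \<in> carrier_mat n n"
    using det_weierstrass_corner(2,3)[OF pos(1,2), of fs] n_eq by (intro carrier_matI) simp_all
  have n': "n - sum_list sinf = (\<Sum>(s, a)\<leftarrow>fs. s) + sum_list s0"
    using n_eq by linarith
  show "\<exists>m\<in>carrier_mat n n. coeff2 (F m) (fst (inf_vertex s)) (snd (inf_vertex s)) \<noteq> 0"
    unfolding inf_vertex_def fst_conv snd_conv n' add.assoc
    by (rule vertex_witness[OF _ M], subst det_weierstrass_corner(1)[OF pos(1,2)], rule strict_lead_corner_inf[OF pos(1)])
  show "\<exists>m\<in>carrier_mat n n. coeff2 (F m) (fst (zero_vertex s)) (snd (zero_vertex s)) \<noteq> 0" if "s \<ge> 2"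
    unfolding zero_vertex_def fst_conv snd_conv
    by (rule vertex_witness[OF _ M], subst det_weierstrass_corner(1)[OF pos(1,2)], rule strict_lead_corner_zero[OF that pos(3)])
  have n'': "(\<Sum>(s, a)\<leftarrow>fs. s) + (sum_list s0 + sum_list sinf) = n"
    using n_eq by linarith
  show "\<exists>m\<in>carrier_mat n n. coeff2 (F m) n (2 * n) \<noteq> 0"
    by (rule vertex_witness[OF _ one_carrier_mat], subst det_weierstrass_one[OF n_eq])
      (rule strict_lead_one[of fs s0 sinf, unfolded n''])
qed

text \<open>The edge for s joins \<open>inf_vertex s\<close> and \<open>inf_vertex (s - 1)\<close>.
  Its extent in \<epsilon> is the number of blocks of size s, and each unit amounts to s + 1 powers
  of X, that is, to s + 1 eigenvalues.\<close>

lemma order_inf: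
  assumes m: "m \<in> carrier_mat n n" and "s > 0"
    and L: "eigenvalue_functions (\<lambda>\<epsilon>. matrix_pencil n [k, c, complex_of_real \<epsilon> \<cdot>\<^sub>m m]) N L"
    and v: "coeff2 (F m) (fst (inf_vertex s)) (snd (inf_vertex s)) \<noteq> 0"
      "coeff2 (F m) (fst (inf_vertex (s - 1))) (snd (inf_vertex (s - 1))) \<noteq> 0"
  shows "card {i. i < N \<and> of_order (L i) (- 1 / (real s + 1))} = (s + 1) * count_list sinf s"
proof -
  have "card {i. i < N \<and> of_order (L i) (of_int (- 1) / real (s + 1))} =
      (s + 1) * (fst (inf_vertex (s - 1)) - fst (inf_vertex s))"
  proof (rule card_of_order_edge[OF L eval_F[OF m] _ _ _ _ _ _ v(1) _ v(2)])
    show "weight_ge (int (s + 1)) (- 1) (F m) (inf_weight s)"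
      using weight_ge_F_inf[OF m, of s] by (simp add: add.commute)
    have "inf_weight (Suc s) = inf_weight s + int (fst (inf_vertex s))"
      using sum_diff_Suc[of s sinf] by (simp add: inf_weight_def inf_vertex_def)
    then show "weight_ge (int (s + 1) + 1) (- 1) (F m) (inf_weight s + int (fst (inf_vertex s)))"
      using weight_ge_F_inf[OF m, of "Suc s"] by (simp add: add.commute)
    have "inf_weight (s - 1) = inf_weight s - int (fst (inf_vertex (s - 1)))"
      using sum_diff_Suc[where s = "s - 1" and xs = sinf] \<open>s > 0\<close> by (simp add: inf_weight_def inf_vertex_def)
    then show "weight_ge (int (s + 1) - 1) (- 1) (F m) (inf_weight s - int (fst (inf_vertex (s - 1))))"
      using weight_ge_F_inf[OF m, of "s - 1"] \<open>s > 0\<close> by (simp add: of_nat_diff)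
    show "- 1 * int (snd (inf_vertex s)) = inf_weight s - int (s + 1) * int (fst (inf_vertex s))"
      using sum_Suc_greater[of s sinf] by (simp add: inf_vertex_def inf_weight_def algebra_simps)
    show "- 1 * int (snd (inf_vertex (s - 1))) = inf_weight s - int (s + 1) * int (fst (inf_vertex (s - 1)))"
      using sum_Suc_greater_pred[OF \<open>s > 0\<close>, of sinf] by (simp add: inf_vertex_def inf_weight_def algebra_simps)
    show "fst (inf_vertex s) \<le> fst (inf_vertex (s - 1))"
      using length_filter_greater_pred[OF \<open>s > 0\<close>, of sinf] by (simp add: inf_vertex_def)
  qed simp_all
  also have "fst (inf_vertex (s - 1)) - fst (inf_vertex s) = count_list sinf s"
    using length_filter_greater_pred[OF \<open>s > 0\<close>, of sinf] by (simp add: inf_vertex_def)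
  finally show ?thesis
    by (simp add: add.commute)
qed

text \<open>The same argument with the weight (s - 2, 1). The condition s > 2 makes the weight of
  \<epsilon> positive and keeps s - 1 in the range of the lower bounds.\<close>

lemma order_zero:
  assumes m: "m \<in> carrier_mat n n" and "s > 2"
    and L: "eigenvalue_functions (\<lambda>\<epsilon>. matrix_pencil n [k, c, complex_of_real \<epsilon> \<cdot>\<^sub>m m]) N L"
    and v: "coeff2 (F m) (fst (zero_vertex s)) (snd (zero_vertex s)) \<noteq> 0"
      "coeff2 (F m) (fst (zero_vertex (s - 1))) (snd (zero_vertex (s - 1))) \<noteq> 0"
  shows "card {i. i < N \<and> of_order (L i) (1 / (real s - 2))} = (s - 2) * count_list s0 s"
proof -
  define w where "w s = int (\<Sum>S\<leftarrow>s0. min S s)" for s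
  have s: "s > 0" "s \<ge> 2" "s \<ge> 3" "s - 1 \<ge> 2"
    using \<open>s > 2\<close> by auto
  have "card {i. i < N \<and> of_order (L i) (of_int 1 / real (s - 2))} =
      (s - 2) * (fst (zero_vertex (s - 1)) - fst (zero_vertex s))"
  proof (rule card_of_order_edge[OF L eval_F[OF m] _ _ _ _ _ _ v(1) _ v(2)])
    show "weight_ge (int (s - 2)) 1 (F m) (w s)"
      using weight_ge_F_zero[OF m s(2)] s by (simp add: w_def of_nat_diff)
    have "w (Suc s) = w s + int (fst (zero_vertex s))"
      unfolding w_def sum_min_Suc by (simp add: zero_vertex_def)
    then show "weight_ge (int (s - 2) + 1) 1 (F m) (w s + int (fst (zero_vertex s)))"
      using weight_ge_F_zero[OF m, of "Suc s"] s by (simp add: w_def of_nat_diff algebra_simps)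
    have "w (Suc (s - 1)) = w (s - 1) + int (fst (zero_vertex (s - 1)))"
      unfolding w_def sum_min_Suc by (simp add: zero_vertex_def)
    then have "w (s - 1) = w s - int (fst (zero_vertex (s - 1)))"
      using s by simp
    moreover have "int (s - 1) - 2 = int (s - 2) - 1"
      using s by simp
    ultimately show "weight_ge (int (s - 2) - 1) 1 (F m) (w s - int (fst (zero_vertex (s - 1))))"
      using weight_ge_F_zero[OF m s(4)] by (simp only: w_def)
    have "snd (zero_vertex s) + (s - 2) * fst (zero_vertex s) = (\<Sum>S\<leftarrow>s0. min S s)"
      using sum_zero_vertex[OF s(2), of s0] by (simp add: zero_vertex_def)
    from arg_cong[OF this, of int]
    show "1 * int (snd (zero_vertex s)) = w s - int (s - 2) * int (fst (zero_vertex s))"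
      by (simp only: w_def of_nat_add of_nat_mult)
    have "snd (zero_vertex (s - 1)) + (s - 2) * fst (zero_vertex (s - 1)) = (\<Sum>S\<leftarrow>s0. min S s)"
      using sum_zero_vertex_pred[OF s(3), of s0] by (simp add: zero_vertex_def)
    from arg_cong[OF this, of int]
    show "1 * int (snd (zero_vertex (s - 1))) = w s - int (s - 2) * int (fst (zero_vertex (s - 1)))"
      by (simp only: w_def of_nat_add of_nat_mult)
    show "fst (zero_vertex s) \<le> fst (zero_vertex (s - 1))"
      using length_filter_greater_pred[OF s(1), of s0] by (simp add: zero_vertex_def)
  qed (use s in simp_all)
  also have "fst (zero_vertex (s - 1)) - fst (zero_vertex s) = count_list s0 s"
    using length_filter_greater_pred[OF s(1), of s0] by (simp add: zero_vertex_def)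
  finally show ?thesis
    using s by (simp add: of_nat_diff)
qed

text \<open>The edge s = 0 at infinity, of weight (1, -1): one end is \<open>inf_vertex 0\<close>,
  with a factor \<epsilon> for each block at infinity, and the other is (n, 2 n).\<close>

lemma order_minus_1_generic:
  assumes m: "m \<in> carrier_mat n n"
    and L: "eigenvalue_functions (\<lambda>\<epsilon>. matrix_pencil n [k, c, complex_of_real \<epsilon> \<cdot>\<^sub>m m]) N L"
    and v: "coeff2 (F m) (fst (inf_vertex 0)) (snd (inf_vertex 0)) \<noteq> 0" "coeff2 (F m) n (2 * n) \<noteq> 0"
  shows "card {i. i < N \<and> of_order (L i) (- 1)} = n - length sinf"
proof -
  have len: "fst (inf_vertex 0) = length sinf"
    using pos(2) by (simp add: inf_vertex_def)
  have "length xs \<le> sum_list xs" if "\<forall>s\<in>set xs. s > 0" for xs :: "nat list"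
    using that by (induction xs) auto
  from this[OF pos(2)] have "length sinf \<le> n"
    using n_eq by linarith
  have "sum_list sinf \<le> n"
    using n_eq by linarith
  then have w0: "inf_weight 0 = - int n"
    by (simp add: inf_weight_def of_nat_diff)
  have "card {i. i < N \<and> of_order (L i) (of_int (- 1) / real 1)} = 1 * (n - fst (inf_vertex 0))"
  proof (rule card_of_order_edge[OF L eval_F[OF m] _ _ _ _ _ _ v(1) _ v(2)])
    show "weight_ge (int 1) (- 1) (F m) (inf_weight 0)"
      using weight_ge_F_inf[OF m, of 0] by simp
    have "inf_weight (Suc 0) = inf_weight 0 + int (fst (inf_vertex 0))"
      using sum_diff_Suc[of 0 sinf] by (simp add: inf_weight_def inf_vertex_def)
    then show "weight_ge (int 1 + 1) (- 1) (F m) (inf_weight 0 + int (fst (inf_vertex 0)))"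
      using weight_ge_F_inf[OF m, of "Suc 0"] by simp
    show "weight_ge (int 1 - 1) (- 1) (F m) (inf_weight 0 - int n)"
      using weight_ge_F_degree[of m] by (simp add: w0)
    show "- 1 * int (snd (inf_vertex 0)) = inf_weight 0 - int 1 * int (fst (inf_vertex 0))"
      using sum_Suc_greater[of 0 sinf] by (simp add: inf_vertex_def inf_weight_def)
    show "fst (inf_vertex 0) \<le> n"
      using \<open>length sinf \<le> n\<close> by (simp add: len)
  qed (simp_all add: w0)
  then show ?thesis
    by (simp add: len)
qed

lemma eigenvalue_functions_exist:
  assumes "m \<in> carrier_mat n n"
  shows "\<exists>N L. eigenvalue_functions (\<lambda>\<epsilon>. matrix_pencil n [k, c, complex_of_real \<epsilon> \<cdot>\<^sub>m m]) N L"
  using has_root_branches[OF F_nonzero, of m]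
  unfolding has_root_branches_def eigenvalue_functions_def regular_pencil_def pencil_eigenvalues_def
    eval_F[OF assms]
  by blast

lemma finite_limits:
  assumes m: "m \<in> carrier_mat n n"
    and L: "eigenvalue_functions (\<lambda>\<epsilon>. matrix_pencil n [k, c, complex_of_real \<epsilon> \<cdot>\<^sub>m m]) N L"
    and lams: "mset lams = nonzero_eigenvalues (matrix_pencil n [k, c])"
  shows "\<exists>\<sigma>. bij_betw \<sigma> {..<length lams} {i. i < N \<and> of_order (L i) 0} \<and>
    (\<forall>j<length lams. (L (\<sigma> j) \<longlongrightarrow> lams ! j) (at_right 0))"
proof -
  have ev: "\<forall>\<^sub>F \<epsilon> in at_right (0::real). \<epsilon> \<noteq> 0"
    by (auto simp: eventually_at_right_field intro!: exI[of _ 1])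
  have "\<exists>\<sigma>. bij_betw \<sigma> {..<length lams} {i. i < N \<and> of_order (L i) 0} \<and>
    (\<forall>j<length lams. L (\<sigma> j) \<sim>[at_right 0] (\<lambda>\<epsilon>. lams ! j * complex_of_real (\<epsilon> powr 0)))"
  proof (rule eigenvalues_of_order[OF L, where C = "\<lambda>_. 1" and g = "det (matrix_pencil n [k, c])"])
    fix j
    have "((\<lambda>\<epsilon>. coeff (eval_param \<epsilon> (F m)) j) \<longlongrightarrow> coeff (det (matrix_pencil n [k, c])) j) (at_right 0)"
      using poly_tendsto_at_right_0[of "coeff (F m) j"] eval_F_0[of m, symmetric] by simp
    then show "((\<lambda>\<epsilon>. 1 * coeff (det (matrix_pencil n [k, c, complex_of_real \<epsilon> \<cdot>\<^sub>m m])) j *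
        complex_of_real (\<epsilon> powr 0) ^ j) \<longlongrightarrow> coeff (det (matrix_pencil n [k, c])) j) (at_right 0)"
      by (rule Lim_transform_eventually, intro eventually_mono[OF ev]) (simp add: eval_F[OF m])
  qed (use regular lams in \<open>auto simp: regular_pencil_def nonzero_eigenvalues_def pencil_eigenvalues_def\<close>)
  then obtain \<sigma> where \<sigma>: "bij_betw \<sigma> {..<length lams} {i. i < N \<and> of_order (L i) 0}"
    "\<And>j. j < length lams \<Longrightarrow> L (\<sigma> j) \<sim>[at_right 0] (\<lambda>\<epsilon>. lams ! j * complex_of_real (\<epsilon> powr 0))"
    by blast
  have "(L (\<sigma> j) \<longlongrightarrow> lams ! j) (at_right 0)" if "j < length lams" for j
  proof -
    have "lams ! j \<in># nonzero_eigenvalues (matrix_pencil n [k, c])"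
      unfolding lams[symmetric] using that by simp
    then have "lams ! j \<noteq> 0"
      by (simp add: nonzero_eigenvalues_def)
    from \<sigma>(2)[OF that, unfolded asymp_equiv_powr_iff[OF this]] show ?thesis
      by (rule Lim_transform_eventually, intro eventually_mono[OF ev]) simp
  qed
  with \<sigma>(1) show ?thesis by blast
qed

lemma order_minus_1:
  assumes m: "m \<in> carrier_mat n n" and "regular_pencil (matrix_pencil n [c, m])"
    and L: "eigenvalue_functions (\<lambda>\<epsilon>. matrix_pencil n [k, c, complex_of_real \<epsilon> \<cdot>\<^sub>m m]) N L"
    and mus: "mset mus = nonzero_eigenvalues (matrix_pencil n [c, m])"
  shows "\<exists>\<sigma>. bij_betw \<sigma> {..<length mus} {i. i < N \<and> of_order (L i) (- 1)} \<and>
    (\<forall>j<length mus. L (\<sigma> j) \<sim>[at_right 0] (\<lambda>\<epsilon>. mus ! j * complex_of_real (\<epsilon> powr - 1)))"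
proof (rule eigenvalues_of_order[OF L, where C = "\<lambda>\<epsilon>. complex_of_real (\<epsilon> ^ n)"
      and g = "monom 1 n * det (matrix_pencil n [c, m])"])
  have nz: "det (matrix_pencil n [c, m]) \<noteq> 0"
    using assms(2) by (simp add: regular_pencil_def)
  show "monom 1 n * det (matrix_pencil n [c, m]) \<noteq> 0"
    using nz by (simp add: monom_eq_0_iff)
  \<comment> \<open>The factor Y^n of the limit polynomial only adds roots 0, which the filter
    removes.\<close>
  have "proots (monom 1 n :: complex poly) = replicate_mset n 0"
    using proots_linear_factor[of "0::complex"]
    by (intro multiset_eqI) (simp add: monom_altdef proots_power)
  then show "mset mus = filter_mset (\<lambda>z. z \<noteq> 0) (proots (monom 1 n * det (matrix_pencil n [c, m])))"
    using nz mus by (simp add: proots_mult nonzero_eigenvalues_def pencil_eigenvalues_def)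
qed (use scaled_coeffs_tendsto[OF c k m] in auto)

lemma eventually_zero_count:
  assumes m: "m \<in> carrier_mat n n"
    and L: "eigenvalue_functions (\<lambda>\<epsilon>. matrix_pencil n [k, c, complex_of_real \<epsilon> \<cdot>\<^sub>m m]) N L"
  shows "2 * length s0 - count_list s0 1 \<le> card {i. i < N \<and> (\<forall>\<^sub>F \<epsilon> in at_right 0. L i \<epsilon> = 0)}"
proof (rule card_eventually_zero_ge[OF L eval_F[OF m] F_nonzero])
  fix j assume j: "j < 2 * length s0 - count_list s0 1"
  \<comment> \<open>For s = 2 the weight ignores \<epsilon> and counts powers of X.\<close>
  have "weight_ge (int 2 - 2) 1 (F m) (int (\<Sum>S\<leftarrow>s0. min S 2))"
    by (rule weight_ge_F_zero[OF m]) simp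
  then have "coeff2 (F m) a j = 0" for a
    using sum_min_2[OF pos(1)] j unfolding weight_ge_def by (fastforce simp: algebra_simps)
  then show "coeff (F m) j = 0"
    by (intro poly_eqI) simp
qed

lemma generic_part:
  "generically n (\<lambda>m.
      regular_pencil (matrix_pencil n [c, m]) \<and>
      size (nonzero_eigenvalues (matrix_pencil n [c, m])) = n - length sinf \<and>
      (\<forall>N L. eigenvalue_functions (\<lambda>\<epsilon>. matrix_pencil n [k, c, complex_of_real \<epsilon> \<cdot>\<^sub>m m]) N L \<longrightarrow>
         (\<forall>s \<in> set sinf.
            card {i. i < N \<and> of_order (L i) (- 1 / (real s + 1))} = (s + 1) * count_list sinf s) \<and>
         (\<forall>s \<in> set s0. s > 2 \<longrightarrow>
            card {i. i < N \<and> of_order (L i) (1 / (real s - 2))} = (s - 2) * count_list s0 s)))"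
proof -
  \<comment> \<open>Both ends of every edge that occurs, with s - 1 standing for the second end of
    the edge for s, and the ends \<open>inf_vertex 0\<close> and (n, 2 n) of the edge for
    \<epsilon>^(-1).\<close>
  define V where "V = inf_vertex ` (set sinf \<union> (\<lambda>s. s - 1) ` set sinf \<union> {0}) \<union>
    zero_vertex ` {s \<in> set s0 \<union> (\<lambda>s. s - 1) ` set s0. s \<ge> 2} \<union> {(n, 2 * n)}"
  define d where "d m = det (mat n n (\<lambda>ij. m $$ ij + c $$ ij))" for m :: "complex mat"
  show ?thesis
  proof (rule generically_finite[where \<Phi> = "insert d ((\<lambda>v m. coeff2 (F m) (fst v) (snd v)) ` V)"])
    show "finite (insert d ((\<lambda>v m. coeff2 (F m) (fst v) (snd v)) ` V))"
      by (simp add: V_def)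
  next
    fix f assume "f \<in> insert d ((\<lambda>v m. coeff2 (F m) (fst v) (snd v)) ` V)"
    then consider "f = d" | v where "v \<in> V" "f = (\<lambda>m. coeff2 (F m) (fst v) (snd v))"
      by blast
    then show "entry_polynomial n f \<and> (\<exists>m\<in>carrier_mat n n. f m \<noteq> 0)"
    proof cases
      case 1
      have "mat n n (\<lambda>ij. (1\<^sub>m n - c) $$ ij + c $$ ij) = 1\<^sub>m n"
        using c by (intro eq_matI) auto
      then have "d (1\<^sub>m n - c) \<noteq> 0"
        by (simp add: d_def)
      then show ?thesis
        using entry_polynomial_det_add[OF c] c 1 unfolding d_def
        by (intro conjI bexI[of _ "1\<^sub>m n - c"]) auto
    next
      case 2
      have "\<exists>m\<in>carrier_mat n n. coeff2 (F m) (fst v) (snd v) \<noteq> 0"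
        using 2(1) corner_witnesses unfolding V_def by auto
      then show ?thesis
        unfolding 2(2) F_def using entry_polynomial_coeff2_det_perturbed[OF matrix_pencil_carrier] by blast
    qed
  next
    fix m assume m: "m \<in> carrier_mat n n"
      and nz: "\<And>f. f \<in> insert d ((\<lambda>v m. coeff2 (F m) (fst v) (snd v)) ` V) \<Longrightarrow> f m \<noteq> 0"
    have vertex: "coeff2 (F m) (fst v) (snd v) \<noteq> 0" if "v \<in> V" for v
      using nz that by blast
    have "poly (det (matrix_pencil n [c, m])) 1 = d m"
    proof -
      have hom: "comm_ring_hom (\<lambda>p :: complex poly. poly p 1)"
        by unfold_locales auto
      have "map_mat (\<lambda>p. poly p 1) (matrix_pencil n [c, m]) = mat n n (\<lambda>ij. m $$ ij + c $$ ij)"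
        by (intro eq_matI) (auto simp: matrix_pencil_def)
      then show ?thesis
        unfolding d_def by (metis comm_ring_hom.hom_det[OF hom])
    qed
    then have reg: "regular_pencil (matrix_pencil n [c, m])"
      using nz[of d] by (auto simp: regular_pencil_def)
    obtain N L where L: "eigenvalue_functions (\<lambda>\<epsilon>. matrix_pencil n [k, c, complex_of_real \<epsilon> \<cdot>\<^sub>m m]) N L"
      using eigenvalue_functions_exist[OF m] by blast
    obtain mus where mus: "mset mus = nonzero_eigenvalues (matrix_pencil n [c, m])"
      using ex_mset by blast
    \<comment> \<open>One chosen family of branches is counted in two ways, which yields the number
      of non-zero eigenvalues of X m + c.\<close>
    have "length mus = card {i. i < N \<and> of_order (L i) (- 1)}"
      using order_minus_1[OF m reg L mus] by (metis bij_betw_same_card card_lessThan)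
    also have "\<dots> = n - length sinf"
      using vertex[of "inf_vertex 0"] vertex[of "(n, 2 * n)"]
      by (intro order_minus_1_generic[OF m L]) (auto simp: V_def)
    finally have t: "size (nonzero_eigenvalues (matrix_pencil n [c, m])) = n - length sinf"
      by (simp flip: mus)
    have iv: "card {i. i < N \<and> of_order (L i) (- 1 / (real s + 1))} = (s + 1) * count_list sinf s"
      if "eigenvalue_functions (\<lambda>\<epsilon>. matrix_pencil n [k, c, complex_of_real \<epsilon> \<cdot>\<^sub>m m]) N L" "s \<in> set sinf" for N L s
      using that pos(2) by (intro order_inf[OF m _ that(1)] vertex) (auto simp: V_def)
    have v: "card {i. i < N \<and> of_order (L i) (1 / (real s - 2))} = (s - 2) * count_list s0 s"
      if "eigenvalue_functions (\<lambda>\<epsilon>. matrix_pencil n [k, c, complex_of_real \<epsilon> \<cdot>\<^sub>m m]) N L" "s \<in> set s0" "s > 2" for N L s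
      using that by (intro order_zero[OF m _ that(1)] vertex) (auto simp: V_def)
    show "regular_pencil (matrix_pencil n [c, m]) \<and>
      size (nonzero_eigenvalues (matrix_pencil n [c, m])) = n - length sinf \<and>
      (\<forall>N L. eigenvalue_functions (\<lambda>\<epsilon>. matrix_pencil n [k, c, complex_of_real \<epsilon> \<cdot>\<^sub>m m]) N L \<longrightarrow>
         (\<forall>s \<in> set sinf.
            card {i. i < N \<and> of_order (L i) (- 1 / (real s + 1))} = (s + 1) * count_list sinf s) \<and>
         (\<forall>s \<in> set s0. s > 2 \<longrightarrow>
            card {i. i < N \<and> of_order (L i) (1 / (real s - 2))} = (s - 2) * count_list s0 s))"
      using reg t iv v by blast
  qed
qed

end

theorem corollary1:
  fixes n :: nat and c k :: "complex mat" and s0 sinf :: "nat list" and lams :: "complex list"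
    and A :: "complex mat \<Rightarrow> real \<Rightarrow> complex poly mat"
  defines "A \<equiv> \<lambda>m \<epsilon>. matrix_pencil n [k, c, complex_of_real \<epsilon> \<cdot>\<^sub>m m]"
  assumes c: "c \<in> carrier_mat n n" and k: "k \<in> carrier_mat n n"
    and regular: "regular_pencil (matrix_pencil n [k, c])"
    and weierstrass: "\<exists>fs. weierstrass_form n c k fs s0 sinf"
    and lams: "mset lams = nonzero_eigenvalues (matrix_pencil n [k, c])"
  shows
    "(\<forall>m \<in> carrier_mat n n.
        (\<exists>N L. eigenvalue_functions (A m) N L) \<and>
        (\<forall>N L. eigenvalue_functions (A m) N L \<longrightarrow>
           (\<exists>\<sigma>. bij_betw \<sigma> {..<length lams} {i. i < N \<and> of_order (L i) 0} \<and>
              (\<forall>j<length lams. (L (\<sigma> j) \<longlongrightarrow> lams ! j) (at_right 0))) \<and>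
           (regular_pencil (matrix_pencil n [c, m]) \<longrightarrow>
              (\<forall>mus. mset mus = nonzero_eigenvalues (matrix_pencil n [c, m]) \<longrightarrow>
                 (\<exists>\<sigma>. bij_betw \<sigma> {..<length mus} {i. i < N \<and> of_order (L i) (- 1)} \<and>
                    (\<forall>j<length mus.
                       L (\<sigma> j) \<sim>[at_right 0] (\<lambda>\<epsilon>. mus ! j * complex_of_real (\<epsilon> powr - 1)))))) \<and>
           card {i. i < N \<and> (\<forall>\<^sub>F \<epsilon> in at_right 0. L i \<epsilon> = 0)}
             \<ge> 2 * length s0 - count_list s0 1)) \<and>
     generically n (\<lambda>m.
        regular_pencil (matrix_pencil n [c, m]) \<and>
        size (nonzero_eigenvalues (matrix_pencil n [c, m])) = n - length sinf \<and>
        (\<forall>N L. eigenvalue_functions (A m) N L \<longrightarrow>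
           (\<forall>s \<in> set sinf.
              card {i. i < N \<and> of_order (L i) (- 1 / (real s + 1))} = (s + 1) * count_list sinf s) \<and>
           (\<forall>s \<in> set s0. s > 2 \<longrightarrow>
              card {i. i < N \<and> of_order (L i) (1 / (real s - 2))} = (s - 2) * count_list s0 s)))"
proof -
  obtain fs where W: "weierstrass_form n c k fs s0 sinf"
    using weierstrass by blast
  interpret perturbed_weierstrass_pencil n c k fs s0 sinf
    by (unfold_locales; fact)
  show ?thesis
    unfolding A_def
    using eigenvalue_functions_exist finite_limits[OF _ _ lams] order_minus_1 eventually_zero_count generic_part
    by (intro conjI ballI allI impI) blast+
qed

end
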